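(* For every integer $n\ge 2$, every temporal clique on $n$ vertices admits a temporal $3$-spanner of size at most $n^{1+2/\sqrt{\ln n}}$ (which is $n^{1+o(1)}$ as $n\to\infty$). Moreover, such a spanner can be computed in time $\mathcal{O}(n^{2+o(1)})$.
   Context: A temporal graph $G=(V,E,\lambda)$ consists of a finite set of vertices $V$, a set of (undirected) edges $E\subseteq\binom{V}{2}$, and a labeling $\lambda\colon E\to\mathcal{P}(\mathbb{N})$ assigning to each edge a nonempty set of positive integer time labels. It is a temporal clique if $E=\binom{V}{2}$. For $u,v\in V$, a temporal $u$-$v$-path is a $u$-$v$-path in $(V,E)$ whose sequence of traversed edges $e_1,\dots,e_k$ (in order from $u$ to $v$) admits labels $\lambda_i\in\lambda(e_i)$ with $\lambda_1\le\dots\le\lambda_k$; its length (number of hops) is $k$. The size of a temporal graph $(V,E,\lambda)$ is $\sum_{e\in E}|\lambda(e)|$. A temporal $\alpha$-spanner of a temporal graph $G=(V,E,\lambda)$ is a temporal graph $G'=(V,E',\lambda')$ with $E'\subseteq E$ and $\lambda'(e)\subseteq\lambda(e)$ for every $e\in E'$ that approximates the minimum-hop temporal distance between every ordered pair of vertices within a factor $\alpha$. For a temporal clique this means: for every ordered pair of distinct vertices $u,v$, $G'$ contains a temporal $u$-$v$-path with at most $\alpha$ edges. *)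

theory Defs
  imports Complex_Main "HOL-Library.Ramsey" "HOL-Library.Extended_Real"
    "HOL-Library.Landau_Symbols"
begin

section \<open>Temporal graphs\<close>

text \<open>The labeling is a total function in HOL; its values outside \<open>edges G\<close> carry no meaning.
  Label sets may be infinite.\<close>

record 'a tgraph =
  verts :: "'a set"
  edges :: "'a set set"
  labels :: "'a set \<Rightarrow> nat set"

definition temporal_graph :: "'a tgraph \<Rightarrow> bool" where
  "temporal_graph G \<longleftrightarrow> finite (verts G) \<and> edges G \<subseteq> nsets (verts G) 2 \<and>
     (\<forall>e\<in>edges G. labels G e \<noteq> {} \<and> labels G e \<subseteq> {0<..})"

definition temporal_clique :: "'a tgraph \<Rightarrow> bool" where
  "temporal_clique G \<longleftrightarrow> temporal_graph G \<and> edges G = nsets (verts G) 2"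

text \<open>A path is given by its list \<open>p\<close> of (distinct) vertices, so it has \<open>length p - 1\<close> edges.\<close>

definition temporal_path :: "'a tgraph \<Rightarrow> 'a \<Rightarrow> 'a \<Rightarrow> 'a list \<Rightarrow> bool" where
  "temporal_path G u v p \<longleftrightarrow>
     p \<noteq> [] \<and> hd p = u \<and> last p = v \<and> distinct p \<and> set p \<subseteq> verts G \<and>
     (\<exists>ls. length ls = length p - 1 \<and> sorted ls \<and>
        (\<forall>i<length ls. {p ! i, p ! Suc i} \<in> edges G \<and> ls ! i \<in> labels G {p ! i, p ! Suc i}))"

definition tdist :: "'a tgraph \<Rightarrow> 'a \<Rightarrow> 'a \<Rightarrow> enat" where
  "tdist G u v = (INF p\<in>{p. temporal_path G u v p}. enat (length p - 1))"

definition tsize :: "'a tgraph \<Rightarrow> enat" where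
  "tsize G = (\<Sum>e\<in>edges G. if finite (labels G e) then enat (card (labels G e)) else \<infinity>)"

definition temporal_spanner :: "nat \<Rightarrow> 'a tgraph \<Rightarrow> 'a tgraph \<Rightarrow> bool" where
  "temporal_spanner \<alpha> G H \<longleftrightarrow>
     temporal_graph H \<and> verts H = verts G \<and> edges H \<subseteq> edges G \<and>
     (\<forall>e\<in>edges H. labels H e \<subseteq> labels G e) \<and>
     (\<forall>u\<in>verts G. \<forall>v\<in>verts G. tdist H u v \<le> enat \<alpha> * tdist G u v)"

lemma tdist_le_iff:
  "tdist G u v \<le> enat k \<longleftrightarrow> (\<exists>p. temporal_path G u v p \<and> length p - 1 \<le> k)"
proof
  assume a: "tdist G u v \<le> enat k"
  define S where "S = (\<lambda>p. enat (length p - 1)) ` {p. temporal_path G u v p}"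
  have "tdist G u v = Inf S" by (simp only: tdist_def S_def)
  with a have "S \<noteq> {}" by (auto simp: top_enat_def)
  then have "Inf S \<in> S" unfolding Inf_enat_def by (auto intro: LeastI)
  then show "\<exists>p. temporal_path G u v p \<and> length p - 1 \<le> k"
    using a by (auto simp: tdist_def S_def)
next
  assume "\<exists>p. temporal_path G u v p \<and> length p - 1 \<le> k"
  then obtain p where "temporal_path G u v p" "length p - 1 \<le> k" by blast
  then show "tdist G u v \<le> enat k" unfolding tdist_def by (intro INF_lower2[of p]) auto
qed

lemma tdist_self: "u \<in> verts G \<Longrightarrow> tdist G u u = 0"
proof -
  assume "u \<in> verts G"
  then have "temporal_path G u u [u]" by (auto simp: temporal_path_def)
  then have "tdist G u u \<le> enat 0" unfolding tdist_le_iff by (intro exI[of _ "[u]"]) auto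
  then show ?thesis by (simp add: zero_enat_def[symmetric])
qed

lemma tdist_clique:
  assumes "temporal_clique G" "u \<in> verts G" "v \<in> verts G" "u \<noteq> v"
  shows "tdist G u v = 1"
proof (rule antisym)
  have "{u, v} \<in> edges G" using assms by (auto simp: temporal_clique_def nsets_def)
  moreover from this assms have "labels G {u, v} \<noteq> {}"
    unfolding temporal_clique_def temporal_graph_def by blast
  then obtain l where "l \<in> labels G {u, v}" by blast
  ultimately have "temporal_path G u v [u, v]"
    using assms by (auto simp: temporal_path_def intro!: exI[of _ "[l]"])
  then have "tdist G u v \<le> enat 1" unfolding tdist_le_iff by (intro exI[of _ "[u, v]"]) auto
  then show "tdist G u v \<le> 1" by (simp add: one_enat_def)
  have "\<not> tdist G u v \<le> enat 0"
  proof
    assume "tdist G u v \<le> enat 0"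
    then obtain p where p: "temporal_path G u v p" "length p - 1 \<le> 0"
      unfolding tdist_le_iff by blast
    then obtain x where "p = [x]" by (cases p) (auto simp: temporal_path_def)
    with p assms show False by (auto simp: temporal_path_def)
  qed
  then show "1 \<le> tdist G u v" by (cases "tdist G u v") (auto simp: one_enat_def)
qed

lemma temporal_spanner_clique_iff:
  assumes "temporal_clique G"
  shows "temporal_spanner \<alpha> G H \<longleftrightarrow>
     temporal_graph H \<and> verts H = verts G \<and> edges H \<subseteq> edges G \<and>
     (\<forall>e\<in>edges H. labels H e \<subseteq> labels G e) \<and>
     (\<forall>u\<in>verts G. \<forall>v\<in>verts G. u \<noteq> v \<longrightarrow>
        (\<exists>p. temporal_path H u v p \<and> length p - 1 \<le> \<alpha>))"
proof -
  have "tdist H u v \<le> enat \<alpha> * tdist G u v \<longleftrightarrow>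
      (u \<noteq> v \<longrightarrow> (\<exists>p. temporal_path H u v p \<and> length p - 1 \<le> \<alpha>))"
    if "u \<in> verts G" "v \<in> verts G" "verts H = verts G" for u v
  proof (cases "u = v")
    case True
    then show ?thesis using that by (simp add: tdist_self)
  next
    case False
    with assms that have "tdist G u v = 1" by (simp add: tdist_clique)
    then show ?thesis using False by (simp add: tdist_le_iff)
  qed
  then show ?thesis unfolding temporal_spanner_def by (auto simp del: One_nat_def)
qed


section \<open>A word RAM\<close>

text \<open>Running times refer to structured programs on a word RAM. A state consists of registers
  and a memory, each indexed by \<open>nat\<close>; a program mentions only finitely many registers.
  Every operation and every memory access costs one unit, in the sense that an expression
  costs its number of nodes. Words are the numbers \<open>0, \<dots>, W\<close>: \<open>run W\<close> below
  has no derivation for a computation in which an intermediate value, an address, or a program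
  constant exceeds \<open>W\<close>, so large numbers cannot be abused to save time.
  \<open>Monus\<close> is truncated subtraction; a guard holds iff its value is nonzero, thus
  \<open>Monus b a\<close> tests \<open>a < b\<close>.\<close>

datatype expr =
    Const nat
  | Reg nat
  | Mem expr
  | Plus expr expr
  | Monus expr expr
  | Times expr expr
  | Div expr expr

datatype com =
    Skip
  | Assign nat expr
  | Store expr expr
  | Seq com com
  | Cond expr com com
  | While expr com

type_synonym state = "(nat \<Rightarrow> nat) \<times> (nat \<Rightarrow> nat)"

primrec val :: "expr \<Rightarrow> state \<Rightarrow> nat" where
  "val (Const k) s = k"
| "val (Reg x) s = fst s x"
| "val (Mem a) s = snd s (val a s)"
| "val (Plus a b) s = val a s + val b s"
| "val (Monus a b) s = val a s - val b s"
| "val (Times a b) s = val a s * val b s"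
| "val (Div a b) s = val a s div val b s"

primrec cost :: "expr \<Rightarrow> nat" where
  "cost (Const k) = 1"
| "cost (Reg x) = 1"
| "cost (Mem a) = 1 + cost a"
| "cost (Plus a b) = 1 + cost a + cost b"
| "cost (Monus a b) = 1 + cost a + cost b"
| "cost (Times a b) = 1 + cost a + cost b"
| "cost (Div a b) = 1 + cost a + cost b"

primrec fits :: "nat \<Rightarrow> expr \<Rightarrow> state \<Rightarrow> bool" where
  "fits W (Const k) s \<longleftrightarrow> k \<le> W"
| "fits W (Reg x) s \<longleftrightarrow> fst s x \<le> W"
| "fits W (Mem a) s \<longleftrightarrow> fits W a s \<and> val (Mem a) s \<le> W"
| "fits W (Plus a b) s \<longleftrightarrow> fits W a s \<and> fits W b s \<and> val (Plus a b) s \<le> W"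
| "fits W (Monus a b) s \<longleftrightarrow> fits W a s \<and> fits W b s \<and> val (Monus a b) s \<le> W"
| "fits W (Times a b) s \<longleftrightarrow> fits W a s \<and> fits W b s \<and> val (Times a b) s \<le> W"
| "fits W (Div a b) s \<longleftrightarrow> fits W a s \<and> fits W b s \<and> val (Div a b) s \<le> W"

text \<open>\<open>run W c s t s'\<close>: on a machine with words \<open>0, \<dots>, W\<close>, program \<open>c\<close>
  started in \<open>s\<close> halts in \<open>s'\<close> after exactly \<open>t\<close> units of time.\<close>

inductive run :: "nat \<Rightarrow> com \<Rightarrow> state \<Rightarrow> nat \<Rightarrow> state \<Rightarrow> bool" for W where
  Skip: "run W Skip s 1 s"
| Assign: "fits W e s \<Longrightarrow>
    run W (Assign x e) s (1 + cost e) ((fst s)(x := val e s), snd s)"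
| Store: "fits W a s \<Longrightarrow> fits W e s \<Longrightarrow>
    run W (Store a e) s (1 + cost a + cost e) (fst s, (snd s)(val a s := val e s))"
| Seq: "run W c s t s' \<Longrightarrow> run W d s' t' s'' \<Longrightarrow> run W (Seq c d) s (t + t') s''"
| CondTrue: "fits W b s \<Longrightarrow> val b s \<noteq> 0 \<Longrightarrow> run W c s t s' \<Longrightarrow>
    run W (Cond b c d) s (1 + cost b + t) s'"
| CondFalse: "fits W b s \<Longrightarrow> val b s = 0 \<Longrightarrow> run W d s t s' \<Longrightarrow>
    run W (Cond b c d) s (1 + cost b + t) s'"
| WhileFalse: "fits W b s \<Longrightarrow> val b s = 0 \<Longrightarrow>
    run W (While b c) s (1 + cost b) s"
| WhileTrue: "fits W b s \<Longrightarrow> val b s \<noteq> 0 \<Longrightarrow> run W c s t s' \<Longrightarrow>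
    run W (While b c) s' t' s'' \<Longrightarrow> run W (While b c) s (1 + cost b + t + t') s''"

inductive_cases run_elims:
  "run W Skip s t s'" "run W (Assign x e) s t s'" "run W (Store a e) s t s'"
  "run W (Seq c d) s t s'" "run W (Cond b c d) s t s'" "run W (While b c) s t s'"

lemma run_deterministic: "run W c s t s' \<Longrightarrow> run W c s u s'' \<Longrightarrow> t = u \<and> s' = s''"
proof (induction arbitrary: u s'' rule: run.induct)
  case Skip
  then show ?case by (rule run_elims(1)) simp
next
  case Assign
  from Assign.prems show ?case by (rule run_elims(2)) simp
next
  case Store
  from Store.prems show ?case by (rule run_elims(3)) simp
next
  case Seq
  from Seq.prems show ?case by (rule run_elims) (blast dest: Seq.IH)
next
  case CondTrue
  from CondTrue.prems CondTrue.hyps show ?case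
    by - (erule run_elims, auto dest: CondTrue.IH)
next
  case CondFalse
  from CondFalse.prems CondFalse.hyps show ?case
    by - (erule run_elims, auto dest: CondFalse.IH)
next
  case WhileFalse
  from WhileFalse.prems WhileFalse.hyps show ?case by - (erule run_elims, auto)
next
  case (WhileTrue b s c t s' t' s2)
  from WhileTrue.prems show ?case
  proof (rule run_elims)
    fix t1 s1 t2
    assume u: "u = Suc (cost b + t1 + t2)" and r: "run W c s t1 s1" "run W (While b c) s1 t2 s''"
    from WhileTrue.IH(1)[OF r(1)] r(2) have "t = t1" "run W (While b c) s' t2 s''" "s' = s1"
      by simp_all
    with WhileTrue.IH(2) u show ?thesis by fastforce
  qed (use WhileTrue.hyps in simp)
qed


section \<open>Input and output of programs\<close>

text \<open>A temporal graph with vertices \<open>0, \<dots>, n - 1\<close> is stored as an adjacency matrix of label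
  arrays. Cell 0 holds \<open>n\<close> and cell 1 holds the length of the input, i.e. the address of the
  first free cell. For \<open>u \<noteq> v\<close>, two consecutive cells starting at \<open>2 + 2 * (u * n + v)\<close> hold
  the address and the length of an array that lists the labels of \<open>{u, v}\<close>
  (in any order; empty if \<open>{u, v}\<close> is not an edge).\<close>

definition encodes :: "(nat \<Rightarrow> nat) \<Rightarrow> nat tgraph \<Rightarrow> bool" where
  "encodes m G \<longleftrightarrow>
     verts G = {..<m 0} \<and> 2 + 2 * (m 0)\<^sup>2 \<le> m 1 \<and> (\<forall>a\<ge>m 1. m a = 0) \<and>
     (\<forall>u<m 0. \<forall>v<m 0. u \<noteq> v \<longrightarrow>
        (let p = m (2 + 2 * (u * m 0 + v)); k = m (3 + 2 * (u * m 0 + v)) in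
           2 + 2 * (m 0)\<^sup>2 \<le> p \<and> p + k \<le> m 1 \<and>
           m ` {p..<p + k} = (if {u, v} \<in> edges G then labels G {u, v} else {})))"

text \<open>The output is an array of triples \<open>(u, v, l)\<close>, one for each label \<open>l\<close> of an edge \<open>{u, v}\<close>;
  on termination, cell 0 holds its address and cell 1 its number of triples.\<close>

definition output_triples :: "(nat \<Rightarrow> nat) \<Rightarrow> (nat \<times> nat \<times> nat) set" where
  "output_triples m =
     (\<lambda>i. (m (m 0 + 3 * i), m (m 0 + 3 * i + 1), m (m 0 + 3 * i + 2))) ` {..<m 1}"

definition output_graph :: "nat \<Rightarrow> (nat \<Rightarrow> nat) \<Rightarrow> nat tgraph" where
  "output_graph n m =
     \<lparr> verts = {..<n},
       edges = {{u, v} | u v l. (u, v, l) \<in> output_triples m},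
       labels = (\<lambda>e. {l. \<exists>u v. e = {u, v} \<and> (u, v, l) \<in> output_triples m}) \<rparr>"

lemma encoding_exists:
  assumes "temporal_graph G" "verts G = {..<n}" "\<forall>e\<in>edges G. finite (labels G e)"
  shows "\<exists>m. encodes m G"
proof -
  define L where "L j = sorted_list_of_set
    (if {j div n, j mod n} \<in> edges G then labels G {j div n, j mod n} else {})" for j
  have setL: "set (L j) =
    (if {j div n, j mod n} \<in> edges G then labels G {j div n, j mod n} else {})" for j
    using assms(3) by (auto simp: L_def)
  define K where "K = (\<Sum>j<n\<^sup>2. length (L j))"
  have K: "length (L j) \<le> K" if "j < n\<^sup>2" for j
    unfolding K_def by (rule member_le_sum) (use that in auto)
  define B where "B = 2 + 2 * n\<^sup>2"
  define m where "m a = (if a = 0 then n else if a = 1 then B + n\<^sup>2 * K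
    else if a < B then (if even a then B + ((a - 2) div 2) * K else length (L ((a - 3) div 2)))
    else if a < B + n\<^sup>2 * K then (if (a - B) mod K < length (L ((a - B) div K))
       then L ((a - B) div K) ! ((a - B) mod K) else 0) else 0)" for a
  have m0: "m 0 = n" and m1: "m 1 = B + n\<^sup>2 * K" by (auto simp: m_def)
  have "B \<le> p \<and> p + k \<le> B + n\<^sup>2 * K \<and>
      m ` {p..<p + k} = (if {u, v} \<in> edges G then labels G {u, v} else {})"
    if uv: "u < n" "v < n" and p: "p = m (2 + 2 * (u * n + v))" and k: "k = m (3 + 2 * (u * n + v))"
    for u v p k
  proof -
    define j where "j = u * n + v"
    have "u * n + v < u * n + n" using uv by simp
    also have "\<dots> = Suc u * n" by simp
    also have "\<dots> \<le> n * n" using uv by (intro mult_le_mono1) simp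
    finally have j: "j < n\<^sup>2" by (simp add: j_def power2_eq_square)
    have jd: "j div n = u" "j mod n = v" using uv by (auto simp: j_def)
    have p': "p = B + j * K" using j by (auto simp: p m_def B_def j_def[symmetric])
    have k': "k = length (L j)" using j by (auto simp: k m_def B_def j_def[symmetric])
    have "j * K + K = Suc j * K" by simp
    also have "\<dots> \<le> n\<^sup>2 * K" using j by (intro mult_le_mono1) simp
    finally have jK: "j * K + K \<le> n\<^sup>2 * K" .
    have kK: "k \<le> K" using K[OF j] k' by simp
    have mi: "m (p + i) = L j ! i" if "i < k" for i
    proof -
      have iK: "i < K" using that kK by simp
      have "(j * K + i) div K = j" "(j * K + i) mod K = i" using iK by auto
      moreover have "j * K + i < n\<^sup>2 * K" using iK jK by simp
      ultimately show ?thesis using that k'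
        unfolding m_def p' by (auto simp: B_def)
    qed
    have "m ` {p..<p + k} = (\<lambda>i. m (p + i)) ` {0..<k}"
      using image_add_atLeastLessThan[of p 0 k] by (metis add.right_neutral add.commute image_image)
    also have "\<dots> = (\<lambda>i. L j ! i) ` {0..<k}" using mi by (intro image_cong) auto
    also have "\<dots> = set (L j)" unfolding k' by (metis list.set_map map_nth set_upt)
    finally show ?thesis using setL[of j] jd kK jK p' by auto
  qed
  note block = this
  have arr: "B \<le> m (2 + 2 * (u * n + v)) \<and>
      m (2 + 2 * (u * n + v)) + m (3 + 2 * (u * n + v)) \<le> B + n\<^sup>2 * K \<and>
      m ` {m (2 + 2 * (u * n + v))..<m (2 + 2 * (u * n + v)) + m (3 + 2 * (u * n + v))} =
        (if {u, v} \<in> edges G then labels G {u, v} else {})" if "u < n" "v < n" for u v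
    using that by (rule block[OF _ _ refl refl])
  have "m a = 0" if "B + n\<^sup>2 * K \<le> a" for a
    using that by (auto simp: m_def B_def)
  moreover have "B \<le> B + n\<^sup>2 * K" by simp
  ultimately have "encodes m G"
    unfolding encodes_def m0 m1 Let_def B_def[symmetric]
    by (intro conjI[OF assms(2)] conjI allI impI) (assumption | simp only: arr)+
  then show ?thesis by blast
qed

end

theory Submission
  imports Defs "HOL-Real_Asymp.Real_Asymp"
begin

text \<open>Fix one label per edge. For a set \<open>X\<close> of sources and a set \<open>Y\<close> of targets with
  \<open>|Y| \<le> |X|\<close>, let \<open>F u\<close> consist of the \<open>|Y| / d\<close> earliest neighbours of \<open>u \<in> X\<close> in \<open>Y\<close>. By double
  counting, some \<open>a \<in> Y\<close> lies in \<open>F u\<close> for at least \<open>|X| / d\<close> sources \<open>u\<close>. Let \<open>U\<close> be a set of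
  \<open>|X| / d\<close> such sources and let \<open>b \<in> U\<close> have the latest edge to \<open>a\<close>. Every \<open>u \<in> U\<close> reaches \<open>b\<close> through
  \<open>a\<close>, and from there all of \<open>Y - F b\<close>, because \<open>a \<in> F b\<close> makes the edges from \<open>b\<close> to \<open>Y - F b\<close> later
  than the edge \<open>a b\<close>. So \<open>|X| / d + |Y|\<close> edges leave only the subproblems \<open>(U, F b)\<close> and \<open>(X - U, Y)\<close>.
  If \<open>|X| < |Y|\<close>, exchange sources and targets and reverse time. Since the two sides are cut down
  alternately, each level of the recursion at most doubles the total size of the subproblems; with
  \<open>d ^ k \<ge> n\<close> this amounts to about \<open>n d 2 ^ k\<close> edges, and \<open>k\<close> close to the square root of
  \<open>log 2 n\<close> gives the bound.

  The algorithm processes the subproblems from a stack and finds \<open>F u\<close> with a tournament tree; its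
  running time is controlled by the same potential as the number of edges.\<close>

section \<open>Walks with three edges\<close>

text \<open>With \<open>l = log 2 n\<close> and \<open>d\<close> close to the \<open>k\<close>-th
  root of \<open>n\<close>, the count \<open>n d 2 ^ k\<close> is \<open>n\<close> times 2 to the
  power \<open>k + l / k\<close>, and that exponent is about \<open>2 * sqrt l\<close> at best. The
  target factor is \<open>exp (2 * sqrt (ln n))\<close>, which is 2 to a power slightly above
  \<open>12 / 5 * sqrt l\<close>. The gap between 2 and \<open>12 / 5\<close> has to absorb every
  rounding and constant factor, since the bound is claimed for all \<open>n \<ge> 2\<close>; where
  \<open>n\<close> is too small for this, the number \<open>n choose 2\<close> of all edges is
  already below the target.

  The doubling comes from the removal of \<open>U\<close>: the source side loses \<open>|U|\<close>
  vertices, while \<open>(U, F b)\<close> has at most \<open>2 |U|\<close> vertices and is smaller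
  by a factor \<open>d\<close> on both sides. The subproblem \<open>(X - U, Y)\<close> need not
  descend a level, so the accounting is a potential and not a recurrence over levels.

  No set \<open>F u\<close> survives a step of the program: all are recomputed, at about
  \<open>n log n\<close> time per source. This is affordable because \<open>|X| \<le> d |U|\<close>,
  so that a step costs about \<open>n d log n\<close> per unit of potential it consumes.\<close>

definition adj :: "('a \<times> 'a) set \<Rightarrow> 'a \<Rightarrow> 'a \<Rightarrow> bool" where
  "adj S x y \<longleftrightarrow> (x, y) \<in> S \<or> (y, x) \<in> S"

lemma adj_sym: "adj S x y \<longleftrightarrow> adj S y x"
  by (auto simp: adj_def)

lemma adj_mono: "S \<subseteq> S' \<Longrightarrow> adj S x y \<Longrightarrow> adj S' x y"
  by (auto simp: adj_def)

text \<open>Vertices may repeat and loops may be marked, so a single edge already counts as a walk with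
  three edges.\<close>

definition reach :: "('a \<Rightarrow> 'a \<Rightarrow> 'b::linorder) \<Rightarrow> ('a \<times> 'a) set \<Rightarrow> 'a \<Rightarrow> 'a \<Rightarrow> bool" where
  "reach \<kappa> S u v \<longleftrightarrow>
     (\<exists>a b. adj S u a \<and> adj S a b \<and> adj S b v \<and> \<kappa> u a \<le> \<kappa> a b \<and> \<kappa> a b \<le> \<kappa> b v)"

definition sym_on :: "'a set \<Rightarrow> ('a \<Rightarrow> 'a \<Rightarrow> 'b) \<Rightarrow> bool" where
  "sym_on A \<kappa> \<longleftrightarrow> (\<forall>x\<in>A. \<forall>y\<in>A. \<kappa> x y = \<kappa> y x)"

lemma sym_onD: "sym_on A \<kappa> \<Longrightarrow> x \<in> A \<Longrightarrow> y \<in> A \<Longrightarrow> \<kappa> x y = \<kappa> y x"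
  by (simp add: sym_on_def)

lemma reach_mono: "reach \<kappa> S u v \<Longrightarrow> S \<subseteq> S' \<Longrightarrow> reach \<kappa> S' u v"
  unfolding reach_def using adj_mono by metis

lemma reach_edge: "adj S u v \<Longrightarrow> \<kappa> u v = \<kappa> v u \<Longrightarrow> reach \<kappa> S u v"
  unfolding reach_def by (metis adj_sym order_refl)

text \<open>Reading the walk backwards reverses the order of its keys. Only weak order reversal is
  asked of the keys, so that negated integers and differences from a maximum are both
  admissible.\<close>

lemma reach_reverse:
  assumes "reach \<kappa>' S u v" "S \<subseteq> A \<times> A" "sym_on A \<kappa>"
    and "\<And>x y x' y'. x \<in> A \<Longrightarrow> y \<in> A \<Longrightarrow> x' \<in> A \<Longrightarrow> y' \<in> A \<Longrightarrow>
      \<kappa>' x y \<le> \<kappa>' x' y' \<Longrightarrow> \<kappa> x' y' \<le> \<kappa> x y"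
  shows "reach \<kappa> S v u"
proof -
  obtain a b where ab: "adj S u a" "adj S a b" "adj S b v"
    "\<kappa>' u a \<le> \<kappa>' a b" "\<kappa>' a b \<le> \<kappa>' b v"
    using assms(1) unfolding reach_def by blast
  have A: "u \<in> A" "a \<in> A" "b \<in> A" "v \<in> A" using ab(1-3) assms(2) by (auto simp: adj_def)
  have "\<kappa> a b \<le> \<kappa> u a" "\<kappa> b v \<le> \<kappa> a b" using ab(4,5) A assms(4) by blast+
  then have "\<kappa> v b \<le> \<kappa> b a" "\<kappa> b a \<le> \<kappa> a u"
    using A assms(3) by (simp_all add: sym_on_def)
  then show ?thesis unfolding reach_def using ab adj_sym by metis
qed

lemma reach_star:
  assumes "sym_on A \<kappa>" "U \<subseteq> A" "a \<in> A" "b \<in> U"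
    and "\<And>u. u \<in> U \<Longrightarrow> adj S u a" "\<And>u. u \<in> U \<Longrightarrow> \<kappa> u a \<le> \<kappa> b a"
    and "adj S b v" "\<kappa> b a \<le> \<kappa> b v" "u \<in> U"
  shows "reach \<kappa> S u v"
  unfolding reach_def
proof (intro exI conjI)
  show "adj S u a" "adj S b v" using assms by auto
  show "adj S a b" using assms(4,5) adj_sym by metis
  have "\<kappa> a b = \<kappa> b a" using assms by (meson subsetD sym_onD)
  then show "\<kappa> u a \<le> \<kappa> a b" "\<kappa> a b \<le> \<kappa> b v" using assms by auto
qed

text \<open>Marks are ordered pairs, as in a matrix of cells, and may contain loops; loops are
  dropped here. The label set does not choose an orientation of the edge and is a singleton once
  \<open>L\<close> is symmetric.\<close>

definition mark_graph :: "'a set \<Rightarrow> ('a \<Rightarrow> 'a \<Rightarrow> nat) \<Rightarrow> ('a \<times> 'a) set \<Rightarrow> 'a tgraph" where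
  "mark_graph A L S = \<lparr> verts = A, edges = {{x, y} | x y. x \<noteq> y \<and> adj S x y},
     labels = (\<lambda>e. {L x y | x y. e = {x, y} \<and> x \<noteq> y \<and> adj S x y}) \<rparr>"

lemma mark_graph_edge:
  "x \<noteq> y \<Longrightarrow> adj S x y \<Longrightarrow> {x, y} \<in> edges (mark_graph A L S)
    \<and> L x y \<in> labels (mark_graph A L S) {x, y}"
  by (auto simp: mark_graph_def)

text \<open>Any coincidence among \<open>u, a, b, v\<close> allows loops and detours to be cut out.
  What remains is a subsequence of the edges of the walk, so its labels are still sorted.\<close>

lemma reach_temporal_path:
  assumes "reach L S u v" "u \<noteq> v" "S \<subseteq> A \<times> A"
  shows "\<exists>p. temporal_path (mark_graph A L S) u v p \<and> length p - 1 \<le> 3"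
proof -
  let ?H = "mark_graph A L S"
  obtain a b where ab: "adj S u a" "adj S a b" "adj S b v" "L u a \<le> L a b" "L a b \<le> L b v"
    using assms(1) unfolding reach_def by blast
  have A: "u \<in> A" "a \<in> A" "b \<in> A" "v \<in> A" using ab(1-3) assms(3) by (auto simp: adj_def)
  have vH: "verts ?H = A" by (simp add: mark_graph_def)
  have p1: "temporal_path ?H x y [x, y]" if "adj S x y" "x \<noteq> y" "x \<in> A" "y \<in> A" for x y
    using that mark_graph_edge[of x y S A L] unfolding temporal_path_def vH
    by (auto intro!: exI[of _ "[L x y]"])
  have p2: "temporal_path ?H x z [x, y, z]"
    if "adj S x y" "adj S y z" "L x y \<le> L y z" "distinct [x, y, z]" "{x, y, z} \<subseteq> A" for x y z
    using that mark_graph_edge[of x y S A L] mark_graph_edge[of y z S A L]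
    unfolding temporal_path_def vH
    by (auto intro!: exI[of _ "[L x y, L y z]"] simp: less_Suc_eq)
  have p3: "temporal_path ?H u v [u, a, b, v]" if "distinct [u, a, b, v]"
    using that ab A mark_graph_edge[of u a S A L] mark_graph_edge[of a b S A L]
      mark_graph_edge[of b v S A L]
    unfolding temporal_path_def vH
    by (auto intro!: exI[of _ "[L u a, L a b, L b v]"] simp: less_Suc_eq)
  consider "u = b" | "a = v" | "u = a" "u \<noteq> b" "b = v" | "u = a" "b \<noteq> u" "b \<noteq> v"
    | "u \<noteq> a" "a = b" "a \<noteq> v" | "u \<noteq> a" "a \<noteq> b" "a \<noteq> v" "b = v"
    | "distinct [u, a, b, v]" using assms(2) by auto
  then show ?thesis
  proof cases
    case 1 then show ?thesis using p1[of u v] ab A assms(2) by (intro exI[of _ "[u, v]"]) auto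
  next
    case 2 then show ?thesis using p1[of u v] ab A assms(2) by (intro exI[of _ "[u, v]"]) auto
  next
    case 3 then show ?thesis using p1[of u v] ab A assms(2) by (intro exI[of _ "[u, v]"]) auto
  next
    case 4 then show ?thesis using p2[of u b v] ab A assms(2) by (intro exI[of _ "[u, b, v]"]) auto
  next
    case 5 then show ?thesis using p2[of u a v] ab A assms(2) by (intro exI[of _ "[u, a, v]"]) auto
  next
    case 6 then show ?thesis using p2[of u a v] ab A assms(2) by (intro exI[of _ "[u, a, v]"]) auto
  next
    case 7 then show ?thesis using p3 by (intro exI[of _ "[u, a, b, v]"]) auto
  qed
qed

lemma mark_graph_labels:
  assumes "sym_on A L" "S \<subseteq> A \<times> A" "x \<noteq> y" "adj S x y"
  shows "labels (mark_graph A L S) {x, y} = {L x y}"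
proof -
  have "x \<in> A" "y \<in> A" using assms by (auto simp: adj_def)
  then have "L y x = L x y" using assms(1) by (simp add: sym_on_def)
  then show ?thesis using assms(3,4) by (auto simp: mark_graph_def doubleton_eq_iff)
qed

text \<open>The two size bounds serve different ranges of \<open>n\<close>: the number of marks is
  the asymptotic bound, and the number of all edges is the better one for small
  \<open>n\<close>.\<close>

lemma mark_graph_spanner:
  assumes G: "temporal_clique G" and fin: "S \<subseteq> verts G \<times> verts G"
    and L: "\<And>x y. x \<in> verts G \<Longrightarrow> y \<in> verts G \<Longrightarrow> x \<noteq> y \<Longrightarrow> L x y \<in> labels G {x, y}"
    and sym: "sym_on (verts G) L"
    and r: "\<And>u v. u \<in> verts G \<Longrightarrow> v \<in> verts G \<Longrightarrow> u \<noteq> v \<Longrightarrow> reach L S u v"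
  shows "temporal_spanner 3 G (mark_graph (verts G) L S)"
    and "tsize (mark_graph (verts G) L S) \<le> enat (card S)"
    and "tsize (mark_graph (verts G) L S) \<le> enat (card (verts G) choose 2)"
proof -
  let ?H = "mark_graph (verts G) L S"
  have finV: "finite (verts G)" and eG: "edges G = nsets (verts G) 2"
    and pos: "\<And>e. e \<in> edges G \<Longrightarrow> labels G e \<subseteq> {0<..}"
    using G by (auto simp: temporal_clique_def temporal_graph_def)
  have S: "finite S" using fin finV by (meson finite_SigmaI finite_subset)
  have inV: "x \<in> verts G \<and> y \<in> verts G" if "adj S x y" for x y
    using that fin by (auto simp: adj_def)
  have eH: "edges ?H = {{x, y} | x y. x \<noteq> y \<and> adj S x y}" by (simp add: mark_graph_def)
  have sub: "edges ?H \<subseteq> edges G"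
    unfolding eH eG nsets_def using inV by auto
  have lab: "labels ?H e \<noteq> {} \<and> labels ?H e \<subseteq> labels G e \<and> finite (labels ?H e)
      \<and> card (labels ?H e) = 1" if e: "e \<in> edges ?H" for e
  proof -
    obtain x y where xy: "e = {x, y}" "x \<noteq> y" "adj S x y" using e eH by auto
    then have "labels ?H e = {L x y}" using mark_graph_labels[OF sym fin] by simp
    then show ?thesis using L inV xy by auto
  qed
  have tg: "temporal_graph ?H"
    unfolding temporal_graph_def
  proof (intro conjI ballI)
    show "finite (verts ?H)" "edges ?H \<subseteq> nsets (verts ?H) 2"
      using finV sub eG by (simp_all add: mark_graph_def)
    show "labels ?H e \<noteq> {}" "labels ?H e \<subseteq> {0<..}" if "e \<in> edges ?H" for e
      using lab[OF that] pos[of e] sub that by blast+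
  qed
  show "temporal_spanner 3 G ?H"
    unfolding temporal_spanner_clique_iff[OF G]
    using tg sub lab reach_temporal_path[OF r _ fin] by (auto simp: mark_graph_def)
  have "tsize ?H = (\<Sum>e\<in>edges ?H. 1)"
    unfolding tsize_def by (rule sum.cong) (use lab in \<open>auto simp: one_enat_def\<close>)
  also have "\<dots> = enat (card (edges ?H))" by (simp add: of_nat_eq_enat)
  finally have ts: "tsize ?H = enat (card (edges ?H))" .
  have "edges ?H \<subseteq> (\<lambda>(x, y). {x, y}) ` S"
    unfolding eH adj_def by (auto simp: image_iff)
  then have "card (edges ?H) \<le> card S"
    using S by (meson card_image_le card_mono finite_imageI le_trans)
  then show "tsize ?H \<le> enat (card S)" unfolding ts by simp
  have "card (edges ?H) \<le> card (nsets (verts G) 2)"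
    using sub finV unfolding eG by (intro card_mono) (auto simp: finite_imp_finite_nsets)
  then show "tsize ?H \<le> enat (card (verts G) choose 2)"
    unfolding ts by (simp add: card_nsets)
qed

section \<open>The recursion and its potential\<close>

lemma initial_segment_exists:
  fixes \<kappa> :: "'a \<Rightarrow> 'b::linorder"
  assumes "finite Y" "q \<le> card Y"
  shows "\<exists>F\<subseteq>Y. card F = q \<and> (\<forall>v\<in>F. \<forall>w\<in>Y - F. \<kappa> v \<le> \<kappa> w)"
  using assms(2)
proof (induction q)
  case 0
  then show ?case by (intro exI[of _ "{}"]) auto
next
  case (Suc q)
  then obtain F where F: "F \<subseteq> Y" "card F = q" "\<forall>v\<in>F. \<forall>w\<in>Y - F. \<kappa> v \<le> \<kappa> w" by auto
  have ne: "Y - F \<noteq> {}" using F Suc.prems assms(1) by (metis Diff_eq_empty_iff card_mono not_less_eq_eq finite_subset)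
  define z where "z = arg_min_on \<kappa> (Y - F)"
  have z: "z \<in> Y - F" "\<And>w. w \<in> Y - F \<Longrightarrow> \<kappa> z \<le> \<kappa> w"
    unfolding z_def using arg_min_if_finite(1)[of "Y - F" \<kappa>] arg_min_least[of "Y - F" _ \<kappa>] ne assms(1)
    by auto
  have "finite F" using F assms(1) finite_subset by blast
  then show ?case using F z by (intro exI[of _ "insert z F"]) auto
qed

text \<open>The hypotheses say \<open>q \<ge> |Y| / d\<close> and \<open>s - 1 < |X| / d\<close> in
  multiplied form, which is exactly what rounding up provides; no divisibility is required.\<close>

lemma ex_popular:
  fixes d :: nat
  assumes "finite X" "finite Y" "Y \<noteq> {}" "\<And>u. u \<in> X \<Longrightarrow> F u \<subseteq> Y \<and> card (F u) = q"
    and "card Y \<le> q * d" "(s - 1) * d < card X"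
  shows "\<exists>a\<in>Y. s \<le> card {u\<in>X. a \<in> F u}"
proof (rule ccontr)
  assume "\<not> ?thesis"
  then have lt: "card {u\<in>X. a \<in> F u} \<le> s - 1" if "a \<in> Y" for a using that by force

  have "card X * q = (\<Sum>u\<in>X. card (F u))" using assms(4) by simp
  also have "\<dots> = (\<Sum>u\<in>X. \<Sum>a\<in>Y. of_bool (a \<in> F u))"
  proof (rule sum.cong[OF refl])
    fix u assume "u \<in> X"
    then have "Y \<inter> {a. a \<in> F u} = F u" using assms(4) by auto
    then show "card (F u) = (\<Sum>a\<in>Y. of_bool (a \<in> F u))" using assms(2) by simp
  qed
  also have "\<dots> = (\<Sum>a\<in>Y. \<Sum>u\<in>X. of_bool (a \<in> F u))" by (rule sum.swap)
  also have "\<dots> = (\<Sum>a\<in>Y. card {u\<in>X. a \<in> F u})"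
  proof (rule sum.cong[OF refl])
    fix a
    have "{u\<in>X. a \<in> F u} = X \<inter> {u. a \<in> F u}" by blast
    then show "(\<Sum>u\<in>X. of_bool (a \<in> F u)) = card {u\<in>X. a \<in> F u}" using assms(1) by simp
  qed
  also have "\<dots> \<le> card Y * (s - 1)" using sum_bounded_above[OF lt] by simp
  finally have 1: "card X * q \<le> card Y * (s - 1)" .
  \<comment> \<open>If every target had at most \<open>s - 1\<close> admirers, then
    \<open>|X| q \<le> |Y| (s - 1)\<close>. Multiplying by \<open>d\<close> and cancelling
    \<open>|Y|\<close> contradicts \<open>(s - 1) d < |X|\<close>.\<close>
  have "card X * card Y \<le> card X * q * d" using assms(5) by (simp add: mult.assoc)
  also have "\<dots> \<le> card Y * (s - 1) * d" using 1 by simp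
  finally have 2: "card X * card Y \<le> card Y * ((s - 1) * d)" by (simp add: mult.assoc)
  have "card Y > 0" using assms(2,3) by auto
  then have "card X \<le> (s - 1) * d" using 2 by (simp add: mult.commute)
  then show False using assms(6) by simp
qed

text \<open>Ceiling division, written with truncating operations that the machine can evaluate
  too.\<close>

definition cdiv :: "nat \<Rightarrow> nat \<Rightarrow> nat" where
  "cdiv x d = (x + d - 1) div d"

text \<open>The adjunction between ceiling division and multiplication, from which most facts below
  are read off.\<close>

lemma cdiv_le_iff: "d > 0 \<Longrightarrow> cdiv x d \<le> c \<longleftrightarrow> x \<le> c * d"
proof -
  assume d: "d > 0"
  have "cdiv x d \<le> c \<longleftrightarrow> x + d - 1 < (c + 1) * d"
    unfolding cdiv_def using d by (metis Suc_eq_plus1 less_Suc_eq_le div_less_iff_less_mult)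
  also have "\<dots> \<longleftrightarrow> x \<le> c * d" using d by (auto simp: algebra_simps)
  finally show ?thesis .
qed

lemma cdiv_mult_ge: "d > 0 \<Longrightarrow> x \<le> cdiv x d * d"
  using cdiv_le_iff by blast

lemma cdiv_pred_mult_less: "d > 0 \<Longrightarrow> x > 0 \<Longrightarrow> (cdiv x d - 1) * d < x"
  using cdiv_le_iff[of d x "cdiv x d - 1"] cdiv_mult_ge[of d x]
  by (cases "cdiv x d") auto

lemma cdiv_mono: "x \<le> y \<Longrightarrow> cdiv x d \<le> cdiv y d"
  unfolding cdiv_def by (intro div_le_mono) simp

lemma cdiv_pos: "d > 0 \<Longrightarrow> x > 0 \<Longrightarrow> cdiv x d > 0"
  using cdiv_mult_ge[of d x] by (cases "cdiv x d") auto

lemma cdiv_le: "d > 0 \<Longrightarrow> cdiv x d \<le> x"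
  by (simp add: cdiv_le_iff)

lemma cdiv_less: "d \<ge> 2 \<Longrightarrow> x \<ge> 2 \<Longrightarrow> cdiv x d < x"
proof -
  assume a: "d \<ge> 2" "x \<ge> 2"
  have "x \<le> (x - 1) * 2" using a by simp
  also have "\<dots> \<le> (x - 1) * d" using a by simp
  finally have "cdiv x d \<le> x - 1" using a by (simp add: cdiv_le_iff)
  then show ?thesis using a by simp
qed

text \<open>\<open>pot d x y\<close> bounds twice the number of edges spent on \<open>x\<close> sources and \<open>y\<close> targets; the rate
  per vertex doubles with each level.\<close>

primrec rate :: "nat \<Rightarrow> nat \<Rightarrow> nat" where
  "rate d 0 = d"
| "rate d (Suc j) = 2 * rate d j + 2 * (d + 1)"

text \<open>The exponent is shifted by one so that, for \<open>d \<ge> 2\<close>, level 0 means size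
  at most \<open>d\<close>, the size at which the recursion stops.\<close>

definition level :: "nat \<Rightarrow> nat \<Rightarrow> nat" where
  "level d M = (LEAST j. M \<le> d ^ Suc j)"

definition pot :: "nat \<Rightarrow> nat \<Rightarrow> nat \<Rightarrow> nat" where
  "pot d x y = rate d (level d (max x y)) * (x + y)"

lemma rate_mono: "i \<le> j \<Longrightarrow> rate d i \<le> rate d j"
  by (induction rule: dec_induct) auto

text \<open>Adding the constant \<open>2 * d + 2\<close> turns the recurrence into pure doubling,
  starting from \<open>3 * d + 2\<close>.\<close>

lemma rate_closed: "rate d j + 2 * d + 2 = 2 ^ j * (3 * d + 2)"
  by (induction j) (auto simp: algebra_simps)

lemma level_ge: "d \<ge> 2 \<Longrightarrow> M \<le> d ^ Suc (level d M)"
proof -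
  assume d: "d \<ge> 2"
  have "M < 2 ^ M" by simp
  also have "\<dots> \<le> d ^ M" using d by (simp add: power_mono)
  also have "\<dots> \<le> d ^ Suc M" using d by simp
  finally have "M \<le> d ^ Suc M" by simp
  then show ?thesis unfolding level_def by (rule LeastI[where P = "\<lambda>j. M \<le> d ^ Suc j"])
qed

lemma level_le: "M \<le> d ^ Suc j \<Longrightarrow> level d M \<le> j"
  unfolding level_def by (rule Least_le[where P = "\<lambda>j. M \<le> d ^ Suc j"])

lemma level_mono: "d \<ge> 2 \<Longrightarrow> M \<le> M' \<Longrightarrow> level d M \<le> level d M'"
  by (rule level_le, rule order.trans[OF _ level_ge])

text \<open>Adding \<open>x y \<le> d x\<close> and \<open>x y \<le> d y\<close> gives
  \<open>2 x y \<le> d (x + y)\<close>. Edges are counted twice in the potential to avoid halves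
  here.\<close>

lemma pot_base:
  assumes "d \<ge> 2" "max x y \<le> d"
  shows "2 * (x * y) \<le> pot d x y" "x + y \<le> pot d x y"
proof -
  have 1: "x * y \<le> d * x" "x * y \<le> d * y"
    using assms mult_le_mono1[of y d x] mult_le_mono1[of x d y] by (simp_all add: mult.commute)
  have "2 * (x * y) \<le> rate d 0 * (x + y)"
    using add_mono[OF 1] by (simp add: distrib_left mult_2)
  moreover have "rate d 0 * (x + y) \<le> pot d x y"
    unfolding pot_def by (intro mult_le_mono1 rate_mono) simp
  moreover have "x + y \<le> rate d 0 * (x + y)" using assms by simp
  ultimately show "2 * (x * y) \<le> pot d x y" "x + y \<le> pot d x y" by linarith+
qed

lemma pot_sym: "pot d x y = pot d y x"
  by (simp add: pot_def max.commute add.commute)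

text \<open>The \<open>s\<close> removed sources were paid at the rate of level
  \<open>j + 1\<close>. This must cover at most \<open>2 s\<close> vertices at the rate of level
  \<open>j\<close>, because \<open>q \<le> s\<close>, and \<open>2 (s + y)\<close> for the new
  edges, which is at most \<open>2 s (d + 1)\<close> because \<open>y \<le> x \<le> s d\<close>. The
  recurrence for \<open>rate\<close> is this balance with equality.\<close>

lemma pot_step:
  assumes "d \<ge> 2" "y \<le> x" "d < x"
  defines "s \<equiv> cdiv x d" and "q \<equiv> cdiv y d"
  shows "2 * (s + y) + pot d s q + pot d (x - s) y \<le> pot d x y"
proof -
  let ?l = "level d x"
  have "?l \<noteq> 0" using level_ge[OF assms(1), of x] assms(3) by (intro notI) auto
  then obtain j where j: "?l = Suc j" using not0_implies_Suc by blast
  have "s \<le> d ^ Suc j"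
    unfolding s_def using level_ge[OF assms(1), of x] j assms(1) by (simp add: cdiv_le_iff mult.commute)
  moreover have qs: "q \<le> s" unfolding q_def s_def by (rule cdiv_mono[OF assms(2)])
  ultimately have "level d (max s q) \<le> j" by (intro level_le) simp
  then have "pot d s q \<le> rate d j * (s + s)"
    unfolding pot_def using qs rate_mono by (intro mult_le_mono) auto
  moreover have "pot d (x - s) y \<le> rate d (Suc j) * (x - s + y)"
    unfolding pot_def using assms(1,2) unfolding j[symmetric] by (intro mult_le_mono1 rate_mono level_mono) auto
  moreover have "s \<le> x" unfolding s_def using assms by (intro cdiv_le) simp
  then have "x - s + y + s = x + y" by simp
  then have "rate d (Suc j) * (x - s + y) + rate d (Suc j) * s = rate d (Suc j) * (x + y)"
    by (metis add_mult_distrib2)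
  moreover have "rate d (Suc j) * (x + y) = pot d x y"
    unfolding pot_def using assms(2) j by (simp add: max_def)
  moreover have "y \<le> s * d" using cdiv_mult_ge[of d x] assms unfolding s_def by simp
  then have "2 * (s + y) + rate d j * (s + s) \<le> rate d (Suc j) * s"
    by (simp add: algebra_simps)
  ultimately show ?thesis by linarith
qed

lemma pot_pos: "d \<ge> 2 \<Longrightarrow> x + y > 0 \<Longrightarrow> pot d x y \<ge> x + y"
  using rate_mono[of 0 "level d (max x y)" d] unfolding pot_def by simp

text \<open>Keys are integers so that time can be reversed by negation, and the induction ranges
  over all keys because the exchanged subproblem is solved for the negated ones.\<close>

lemma exists_marks:
  fixes \<kappa> :: "'a \<Rightarrow> 'a \<Rightarrow> int"
  assumes "d \<ge> 2" "finite A" "X \<subseteq> A" "Y \<subseteq> A" "X \<noteq> {}" "Y \<noteq> {}" "sym_on A \<kappa>"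
  shows "\<exists>S\<subseteq>A \<times> A. 2 * card S \<le> pot d (card X) (card Y) \<and> (\<forall>u\<in>X. \<forall>v\<in>Y. reach \<kappa> S u v)"
  using assms(3-)
proof (induction "card X + card Y" arbitrary: X Y \<kappa> rule: less_induct)
  case less
  have IH: "\<exists>S\<subseteq>A \<times> A. 2 * card S \<le> pot d (card X') (card Y') \<and> (\<forall>u\<in>X'. \<forall>v\<in>Y'. reach \<kappa>' S u v)"
    if "card X' + card Y' < card X + card Y" "X' \<subseteq> A" "Y' \<subseteq> A" "X' \<noteq> {}" "Y' \<noteq> {}" "sym_on A \<kappa>'"
    for X' Y' and \<kappa>' :: "'a \<Rightarrow> 'a \<Rightarrow> int" using less.hyps that by blast
  \<comment> \<open>The case of at least as many sources as targets, stated for arbitrary keys and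
    sides of the same total size; the opposite case then follows by exchanging sides and negating
    keys.\<close>
  have main: "\<exists>S\<subseteq>A \<times> A. 2 * card S \<le> pot d (card P) (card Q) \<and> (\<forall>u\<in>P. \<forall>v\<in>Q. reach \<mu> S u v)"
    if pq: "card P + card Q = card X + card Y" "P \<subseteq> A" "Q \<subseteq> A" "P \<noteq> {}" "Q \<noteq> {}"
      and sym: "sym_on A \<mu>" and le: "card Q \<le> card P" for P Q and \<mu> :: "'a \<Rightarrow> 'a \<Rightarrow> int"
  proof (cases "card P \<le> d")
    case True
    have "reach \<mu> (P \<times> Q) u v" if "u \<in> P" "v \<in> Q" for u v
      using that sym pq by (intro reach_edge) (auto simp: adj_def sym_on_def)
    moreover have "2 * card (P \<times> Q) \<le> pot d (card P) (card Q)"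
      using pot_base(1)[OF assms(1), of "card P" "card Q"] True le by (simp add: card_cartesian_product)
    ultimately show ?thesis using pq by (intro exI[of _ "P \<times> Q"]) blast
  next
    case False
    have fin: "finite P" "finite Q" using pq assms(2) finite_subset by blast+
    define s q where "s = cdiv (card P) d" and "q = cdiv (card Q) d"
    have posQ: "card Q > 0" using fin pq by auto
    have qQ: "q \<le> card Q" "q > 0" "s > 0" "s < card P"
      unfolding q_def s_def using assms(1) False posQ by (auto intro!: cdiv_le cdiv_pos cdiv_less)
    have "\<forall>u. \<exists>F\<subseteq>Q. card F = q \<and> (\<forall>v\<in>F. \<forall>w\<in>Q - F. \<mu> u v \<le> \<mu> u w)"
      using initial_segment_exists[OF fin(2) qQ(1)] by blast
    then obtain F where F: "\<And>u. F u \<subseteq> Q" "\<And>u. card (F u) = q"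
      "\<And>u v w. v \<in> F u \<Longrightarrow> w \<in> Q - F u \<Longrightarrow> \<mu> u v \<le> \<mu> u w" by metis
    have "\<exists>a\<in>Q. s \<le> card {u\<in>P. a \<in> F u}"
    proof (rule ex_popular[OF fin pq(5)])
      show "card Q \<le> q * d" unfolding q_def using assms(1) by (intro cdiv_mult_ge) simp
      show "(s - 1) * d < card P" unfolding s_def using assms(1) False by (intro cdiv_pred_mult_less) auto
    qed (use F in auto)
    then obtain a where a: "a \<in> Q" "s \<le> card {u\<in>P. a \<in> F u}" by blast
    then obtain U where U: "U \<subseteq> {u\<in>P. a \<in> F u}" "card U = s"
      by (meson obtain_subset_with_card_n)
    have finU: "finite U" "U \<noteq> {}" using U fin(1) qQ finite_subset[of U P] by auto
    obtain b where b: "b \<in> U" "\<And>u. u \<in> U \<Longrightarrow> \<mu> u a \<le> \<mu> b a"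
    proof -
      have "Max ((\<lambda>u. \<mu> u a) ` U) \<in> (\<lambda>u. \<mu> u a) ` U" using finU by (intro Max_in) auto
      then obtain b where "b \<in> U" "\<mu> b a = Max ((\<lambda>u. \<mu> u a) ` U)" by auto
      then show ?thesis using that finU by auto
    qed
    define S0 where "S0 = U \<times> {a} \<union> {b} \<times> Q"
    have "card S0 \<le> card (U \<times> {a}) + card ({b} \<times> Q)" unfolding S0_def by (rule card_Un_le)
    then have S0: "card S0 \<le> s + card Q" using U by (simp add: card_cartesian_product)
    have S0A: "S0 \<subseteq> A \<times> A" unfolding S0_def using U a b pq by auto
    obtain S1 where S1: "S1 \<subseteq> A \<times> A" "2 * card S1 \<le> pot d s q" "\<forall>u\<in>U. \<forall>v\<in>F b. reach \<mu> S1 u v"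
      using IH[of U "F b" \<mu>] U F sym pq finU qQ by (smt (verit) add_less_le_mono card.empty less_not_refl mem_Collect_eq subset_iff)
    have card_diff: "card (P - U) = card P - s"
      using U finU by (subst card_Diff_subset) auto
    then obtain S2 where S2: "S2 \<subseteq> A \<times> A" "2 * card S2 \<le> pot d (card P - s) (card Q)"
        "\<forall>u\<in>P - U. \<forall>v\<in>Q. reach \<mu> S2 u v"
      using IH[of "P - U" Q \<mu>] U pq sym qQ by (smt (verit) Diff_subset add_less_mono1 card.empty diff_less less_le_trans subset_trans zero_less_diff less_irrefl less_trans)
    let ?S = "S0 \<union> S1 \<union> S2"
    have "card ?S \<le> card S0 + card S1 + card S2"
      by (meson add_le_mono card_Un_le le_refl le_trans)
    then have "2 * card ?S \<le> pot d (card P) (card Q)"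
      using S0 S1(2) S2(2) pot_step[OF assms(1) le] False unfolding s_def q_def by simp
    moreover have "reach \<mu> ?S u v" if uv: "u \<in> P" "v \<in> Q" for u v
    proof (cases "u \<in> U")
      case u: True
      show ?thesis
      proof (cases "v \<in> F b")
        case True
        then show ?thesis using u S1(3) reach_mono[of \<mu> S1 u v ?S] by auto
      next
        case False
        have "reach \<mu> S0 u v"
        proof (rule reach_star[OF sym _ _ b(1) _ b(2) _ _ u])
          show "\<mu> b a \<le> \<mu> b v" using F(3)[of a b v] False uv b(1) U by auto
        qed (use U pq a uv in \<open>auto simp: S0_def adj_def\<close>)
        then show ?thesis using reach_mono[of \<mu> S0 u v ?S] by auto
      qed
    next
      case False
      then show ?thesis using uv S2(3) reach_mono[of \<mu> S2 u v ?S] by auto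
    qed
    ultimately show ?thesis using S0A S1(1) S2(1) by (intro exI[of _ ?S]) auto
  qed
  show ?case
  proof (cases "card Y \<le> card X")
    case True
    then show ?thesis using main[of X Y \<kappa>] less.prems by simp
  next
    case False
    obtain S where S: "S\<subseteq>A \<times> A" "2 * card S \<le> pot d (card Y) (card X)"
      "\<forall>u\<in>Y. \<forall>v\<in>X. reach (\<lambda>x y. - \<kappa> x y) S u v"
      using main[of Y X "\<lambda>x y. - \<kappa> x y"] less.prems False by (auto simp: sym_on_def)
    have "reach \<kappa> S u v" if "u \<in> X" "v \<in> Y" for u v
      by (rule reach_reverse[OF S(3)[rule_format, of v u] S(1) less.prems(5)]) (use that in auto)
    then show ?thesis using S by (intro exI[of _ S]) (simp add: pot_sym)
  qed
qed

section \<open>Numerical estimates\<close>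

text \<open>\<open>kpar n\<close> is the integer \<open>k\<close> for which \<open>k + log 2 n / k\<close> is smallest.\<close>

definition kpar :: "nat \<Rightarrow> nat" where
  "kpar n = (LEAST k. 1 \<le> k \<and> n \<le> 2 ^ (k * (k + 1)))"

text \<open>The \<open>kpar n\<close>-th root of \<open>n\<close> rounded up, but at least
  2.\<close>

definition dpar :: "nat \<Rightarrow> nat" where
  "dpar n = (LEAST d. 2 \<le> d \<and> n \<le> d ^ kpar n)"

text \<open>With \<open>l = log 2 n\<close>, the inequality
  \<open>k + l / k \<le> (k + 1) + l / (k + 1)\<close> amounts to \<open>l \<le> k (k + 1)\<close>.
  This is the source of the exponent \<open>k * (k + 1)\<close>.\<close>

lemma kpar_props: "1 \<le> kpar n" "n \<le> 2 ^ (kpar n * (kpar n + 1))"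
proof -
  have "n < 2 ^ n" by simp
  also have "(2::nat) ^ n \<le> 2 ^ (Suc n * (Suc n + 1))" by (intro power_increasing) auto
  finally have "1 \<le> Suc n \<and> n \<le> 2 ^ (Suc n * (Suc n + 1))" by simp
  then have "1 \<le> kpar n \<and> n \<le> 2 ^ (kpar n * (kpar n + 1))"
    unfolding kpar_def by (rule LeastI)
  then show "1 \<le> kpar n" "n \<le> 2 ^ (kpar n * (kpar n + 1))" by simp_all
qed

lemma kpar_less: "1 < kpar n \<Longrightarrow> 2 ^ ((kpar n - 1) * kpar n) < n"
proof -
  assume a: "1 < kpar n"
  then have "\<not> (1 \<le> kpar n - 1 \<and> n \<le> 2 ^ ((kpar n - 1) * (kpar n - 1 + 1)))"
    using not_less_Least[of "kpar n - 1" "\<lambda>k. 1 \<le> k \<and> n \<le> 2 ^ (k * (k + 1))"]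
    unfolding kpar_def by linarith
  moreover have "1 \<le> kpar n - 1" "kpar n - 1 + 1 = kpar n" using a by linarith+
  ultimately show ?thesis by (metis not_less)
qed

text \<open>The third bound holds because \<open>2 ^ (k + 1)\<close> is itself a candidate: its
  \<open>k\<close>-th power is \<open>2 ^ (k * (k + 1))\<close>, which is at least
  \<open>n\<close>.\<close>

lemma dpar_props: "2 \<le> dpar n" "n \<le> dpar n ^ kpar n" "dpar n \<le> 2 ^ (kpar n + 1)"
proof -
  let ?P = "\<lambda>d. 2 \<le> d \<and> n \<le> d ^ kpar n"
  have "(2::nat) ^ 1 \<le> 2 ^ (kpar n + 1)" by (intro power_increasing) auto
  then have P: "?P (2 ^ (kpar n + 1))"
    using kpar_props(2)[of n] by (metis mult.commute power_mult power_one_right)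
  then have "?P (dpar n)" unfolding dpar_def by (rule LeastI)
  then show "2 \<le> dpar n" "n \<le> dpar n ^ kpar n" by simp_all
  show "dpar n \<le> 2 ^ (kpar n + 1)" unfolding dpar_def using P by (rule Least_le)
qed

lemma dpar_less: "2 < dpar n \<Longrightarrow> (dpar n - 1) ^ kpar n < n"
proof -
  assume a: "2 < dpar n"
  then have "\<not> (2 \<le> dpar n - 1 \<and> n \<le> (dpar n - 1) ^ kpar n)"
    using not_less_Least[of "dpar n - 1" "\<lambda>d. 2 \<le> d \<and> n \<le> d ^ kpar n"]
    unfolding dpar_def by linarith
  moreover have "2 \<le> dpar n - 1" using a by linarith
  ultimately show ?thesis by (metis not_less)
qed

text \<open>The constant is the square of \<open>5 / 6\<close>, and
  \<open>2 / (5 / 6) = 12 / 5\<close>. The proof raises the quadratic Taylor bound for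
  \<open>exp\<close> at one eighth of the constant to the eighth power.\<close>

lemma ln_2_le: "ln (2::real) \<le> 25 / 36"
proof -
  have "(2::real) \<le> (1 + 25 / 288 + (25 / 288)\<^sup>2 / 2) ^ 8"
    by (simp add: field_simps)
  also have "\<dots> \<le> exp (25 / 288) ^ 8"
    by (intro power_mono exp_lower_Taylor_quadratic) auto
  also have "\<dots> = exp (25 / 36)" by (simp flip: exp_of_nat_mult)
  finally show ?thesis using ln_mono[of 2 "exp (25 / 36)"] by simp
qed

lemma exp_sqrt_ln_ge:
  assumes "1 \<le> l"
  shows "2 powr (12 / 5 * sqrt l) \<le> exp (2 * sqrt (l * ln 2))"
proof -
  have "sqrt (ln 2) \<le> sqrt (25 / 36)"
    using ln_2_le by (intro real_sqrt_le_mono) simp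
  also have "\<dots> = 5 / 6" by (simp add: real_sqrt_divide)
  finally have h: "sqrt (ln 2) \<le> 5 / 6" .
  have "12 / 5 * sqrt l * ln 2 = 12 / 5 * sqrt l * (sqrt (ln 2) * sqrt (ln 2))" by simp
  also have "\<dots> \<le> 12 / 5 * sqrt l * (5 / 6 * sqrt (ln 2))"
    using h assms by (intro mult_left_mono mult_right_mono) auto
  also have "\<dots> = 2 * sqrt (l * ln 2)" by (simp add: real_sqrt_mult)
  finally show ?thesis by (simp add: powr_def mult.commute)
qed

text \<open>Let \<open>p = l / k\<close>, so that \<open>D = 2 powr p\<close> is the exact
  \<open>k\<close>-th root of \<open>n\<close>. The choice of \<open>k\<close> keeps
  \<open>p\<close> within distance 1 of \<open>k\<close>, and \<open>d \<le> D + 1\<close>. The rate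
  is then at most \<open>2 powr (1 + k + p)\<close>, and the last part compares
  \<open>1 + k + p\<close> with \<open>12 / 5 * sqrt l\<close>.\<close>

lemma rate_bound:
  assumes "2 \<le> n" "15 / 2 \<le> log 2 (real n)"
  shows "real (rate (dpar n) (kpar n - 1)) \<le> 2 powr (12 / 5 * sqrt (log 2 (real n)))"
proof -
  define k d l where "k = kpar n" and "d = dpar n" and "l = log 2 (real n)"
  define g p where "g = sqrt l" and "p = l / real k"
  define D where "D = 2 powr p"
  have l: "15 / 2 \<le> l" and n: "real n = 2 powr l" using assms by (auto simp: l_def)
  have k1: "1 \<le> k" using kpar_props unfolding k_def by simp
  have "2 powr l \<le> 2 powr real (k * (k + 1))"
    using kpar_props(2)[of n] unfolding n[symmetric] k_def
    by (metis of_nat_le_iff of_nat_numeral of_nat_power powr_realpow zero_less_numeral)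
  then have lk: "l \<le> k * (k + 1)" by simp
  \<comment> \<open>For \<open>k = 2\<close> the exponent is only \<open>6 < 15 / 2\<close>. The
    resulting \<open>2 ^ k \<ge> 8\<close> absorbs the lower-order terms below.\<close>
  have k3: "3 \<le> k"
  proof (rule ccontr)
    assume "\<not> 3 \<le> k"
    then have "k = 1 \<or> k = 2" using k1 by auto
    then show False using lk l by auto
  qed
  have "(2::nat) ^ ((k - 1) * k) < n" using kpar_less[of n] k3 unfolding k_def by linarith
  then have "(2::real) ^ ((k - 1) * k) < real n" by (metis of_nat_less_iff of_nat_numeral of_nat_power)
  then have "2 powr real ((k - 1) * k) < 2 powr l"
    unfolding n by (metis powr_realpow zero_less_numeral)
  then have kl: "(real k - 1) * k \<le> l" using k1 by (simp add: of_nat_diff)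
  have kp: "real k - 1 \<le> p" "p \<le> real k + 1" "p * k = l"
    using lk kl k1 unfolding p_def by (auto simp: field_simps)
  have D1: "1 \<le> D" unfolding D_def using kp k3 by (intro ge_one_powr_ge_zero) auto
  have dD: "real d \<le> D + 1"
  proof (cases "d = 2")
    case False
    then have "2 < d" using dpar_props(1)[of n] unfolding d_def by simp
    then have "(d - 1) ^ k < n" using dpar_less unfolding d_def k_def by simp
    then have "real ((d - 1) ^ k) < real n" by (simp only: of_nat_less_iff)
    then have "real (d - 1) ^ k < real n" by (simp only: of_nat_power)
    also have "real n = D powr real k" unfolding n D_def kp(3)[symmetric] powr_powr ..
    also have "\<dots> = D ^ k" using D1 by (intro powr_realpow) simp
    finally have "real (d - 1) < D" by (rule power_less_imp_less_base) (use D1 in simp)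
    then show ?thesis using \<open>2 < d\<close> by (simp add: of_nat_diff)
  qed (use D1 in simp)
  have kD: "2 ^ k \<le> 2 * D"
  proof -
    have "(2::real) ^ k = 2 powr (1 + (real k - 1))" by (simp add: powr_realpow)
    also have "\<dots> \<le> 2 powr (1 + p)" using kp by (intro powr_mono) auto
    finally show ?thesis by (simp add: powr_add D_def)
  qed
  have k8: "(8::real) \<le> 2 ^ k" using power_increasing[OF k3, of "2::real"] by simp
  have kk: "(2::real) ^ (k - 1) = 2 ^ k / 2" using k1 by (simp add: power_diff)
  have "real (rate d (k - 1) + 2 * d + 2) = real (2 ^ (k - 1) * (3 * d + 2))"
    by (simp only: rate_closed)
  then have "real (rate d (k - 1)) = 2 ^ (k - 1) * (3 * real d + 2) - 2 * real d - 2"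
    by (simp add: algebra_simps)
  then have "real (rate d (k - 1)) = 2 ^ k / 2 * (3 * real d + 2) - 2 * real d - 2"
    by (simp only: kk)
  also have "\<dots> = (3 / 2 * 2 ^ k - 2) * d + 2 ^ k - 2" by (simp add: field_simps)
  also have "\<dots> \<le> (3 / 2 * 2 ^ k - 2) * (D + 1) + 2 ^ k - 2"
    using dD k8 by (intro diff_right_mono add_right_mono mult_left_mono) auto
  also have "\<dots> = 3 / 2 * 2 ^ k * D + 5 / 2 * 2 ^ k - 2 * D - 4" by (simp add: field_simps)
  \<comment> \<open>From \<open>2 ^ k \<le> 2 * D\<close> the term \<open>5 / 2 * 2 ^ k\<close> is
    at most \<open>5 * D\<close>, of which \<open>2 * D\<close> cancels. The remaining
    \<open>3 * D\<close> fits into \<open>1 / 2 * 2 ^ k * D\<close>.\<close>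
  also have "\<dots> \<le> 3 / 2 * 2 ^ k * D + 3 * D" using kD by simp
  also have "\<dots> \<le> 3 / 2 * 2 ^ k * D + 1 / 2 * 2 ^ k * D"
    using k8 D1 by (intro add_left_mono mult_right_mono) auto
  finally have "real (rate d (k - 1)) \<le> 2 * 2 ^ k * D" by (simp add: mult.commute mult.left_commute)
  also have "\<dots> = 2 powr (1 + real k + p)" by (simp add: powr_add D_def powr_realpow)
  also have "\<dots> \<le> 2 powr (12 / 5 * g)"
  proof -
    have g2: "g * g = l" and g0: "0 \<le> g" using l by (simp_all add: g_def)
    \<comment> \<open>\<open>30 / 11\<close> is the positive root of
      \<open>44 / 25 * g * g = 24 / 5 * g\<close>, from which on \<open>1 + 4 * g * g\<close> is at
      most the square of \<open>12 / 5 * g - 1\<close>. Its square is just below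
      \<open>15 / 2\<close>, which explains the threshold on \<open>l\<close>.\<close>
    have gg: "30 / 11 \<le> g"
    proof (rule ccontr)
      assume "\<not> 30 / 11 \<le> g"
      then have "g * g \<le> 30 / 11 * (30 / 11)" using g0 by (intro mult_mono) auto
      then show False using g2 l by simp
    qed
    \<comment> \<open>The sum \<open>k + p\<close> is controlled through
      \<open>(k + p)^2 = (k - p)^2 + 4 k p\<close>, where \<open>k p = l\<close> and
      \<open>|k - p| \<le> 1\<close>.\<close>
    have "0 \<le> (1 + (real k - p)) * (1 - (real k - p))"
      using kp(1,2) by (intro mult_nonneg_nonneg) auto
    then have a1: "(real k - p) * (real k - p) \<le> 1" by (simp add: algebra_simps)
    have "(k + p) * (k + p) = (real k - p) * (real k - p) + 4 * (p * k)" by (simp add: algebra_simps)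
    also have "\<dots> \<le> 1 + 4 * (g * g)" using a1 unfolding kp(3) g2 by simp
    also have "\<dots> = (12 / 5 * g - 1) * (12 / 5 * g - 1) - (44 / 25 * g - 24 / 5) * g"
      by (simp add: algebra_simps)
    also have "\<dots> \<le> (12 / 5 * g - 1) * (12 / 5 * g - 1)"
      using gg g0 by simp
    finally have "(k + p)\<^sup>2 \<le> (12 / 5 * g - 1)\<^sup>2" by (simp only: power2_eq_square)
    then have "k + p \<le> 12 / 5 * g - 1" by (rule power2_le_imp_le) (use gg in simp)
    then have "1 + real k + p \<le> 12 / 5 * g" by simp
    then show ?thesis by (rule powr_mono) simp
  qed
  finally show ?thesis unfolding d_def k_def g_def l_def .
qed

text \<open>For \<open>l \<ge> 15 / 2\<close> the potential decides, with \<open>level\<close> at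
  most \<open>k - 1\<close> because \<open>n \<le> d ^ k\<close>. For smaller \<open>l\<close> the
  bound \<open>n (n - 1) / 2\<close> suffices, since there
  \<open>n \<le> 2 * 2 powr (12 / 5 * sqrt l)\<close>.\<close>

lemma spanner_size_bound:
  assumes "2 \<le> n" "2 * m \<le> pot (dpar n) n n" "m \<le> n choose 2"
  shows "real m \<le> real n powr (1 + 2 / sqrt (ln (real n)))"
proof -
  define l where "l = log 2 (real n)"
  have l1: "1 \<le> l" unfolding l_def using assms(1) by simp
  have ln: "ln (real n) = l * ln 2" unfolding l_def log_def by simp
  have lnp: "0 < ln (real n)" using assms(1) by simp
  have "2 / sqrt (ln (real n)) * ln (real n) = 2 * sqrt (ln (real n))"
    using lnp by (simp add: field_simps)
  then have e: "real n powr (1 + 2 / sqrt (ln (real n))) = real n * exp (2 * sqrt (ln (real n)))"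
    using assms(1) by (simp add: powr_add) (simp add: powr_def)
  have "real m \<le> real n * 2 powr (12 / 5 * sqrt l)"
  proof (cases "15 / 2 \<le> l")
    case True
    have "level (dpar n) n \<le> kpar n - 1"
      using dpar_props(2)[of n] kpar_props(1)[of n] by (intro level_le) simp
    then have "pot (dpar n) n n \<le> rate (dpar n) (kpar n - 1) * (n + n)"
      unfolding pot_def by (intro mult_le_mono rate_mono) auto
    also have "\<dots> = 2 * (n * rate (dpar n) (kpar n - 1))" by simp
    finally have "m \<le> n * rate (dpar n) (kpar n - 1)" using assms(2) by linarith
    then have "real m \<le> real n * real (rate (dpar n) (kpar n - 1))"
      by (metis of_nat_le_iff of_nat_mult)
    also have "\<dots> \<le> real n * 2 powr (12 / 5 * sqrt l)"
      using rate_bound[OF assms(1)] True unfolding l_def by (intro mult_left_mono) auto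
    finally show ?thesis .
  next
    case False
    define t where "t = sqrt l"
    have t2: "t * t = l" and t0: "0 \<le> t" using l1 by (auto simp: t_def)
    have t: "t \<le> 137 / 50"
      unfolding t_def by (rule real_le_lsqrt) (use False l1 in \<open>auto simp: power2_eq_square\<close>)
    \<comment> \<open>This is \<open>t (t - 12 / 5) \<le> 1\<close>. The bound
      \<open>137 / 50\<close> is slightly above the square root of \<open>15 / 2\<close>, and
      \<open>137 / 50 * (17 / 50)\<close> is still below 1.\<close>
    have "l \<le> 1 + 12 / 5 * t"
    proof (cases "t \<le> 12 / 5")
      case True
      then have "t * t \<le> 12 / 5 * t" using t0 by (intro mult_right_mono)
      then show ?thesis using t2 by simp
    next
      case False
      then have "t * (t - 12 / 5) \<le> 137 / 50 * (17 / 50)" using t t0 by (intro mult_mono) auto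
      then show ?thesis using t2 by (simp add: algebra_simps)
    qed
    then have "2 powr l \<le> 2 powr (1 + 12 / 5 * t)" by (intro powr_mono) auto
    moreover have "2 powr l = real n" unfolding l_def using assms(1) by simp
    ultimately have "real n - 1 \<le> 2 * 2 powr (12 / 5 * t)" by (simp add: powr_add)
    moreover have "real m \<le> real n * (real n - 1) / 2"
    proof -
      have "2 * m \<le> n * (n - 1)" using assms(3) by (simp add: choose_two)
      then have "real (2 * m) \<le> real (n * (n - 1))" by (rule of_nat_mono)
      then show ?thesis using assms(1) by (simp add: of_nat_diff)
    qed
    ultimately show ?thesis
      using mult_left_mono[of "real n - 1" "2 * 2 powr (12 / 5 * t)" "real n"] by (simp add: t_def)
  qed
  also have "\<dots> \<le> real n * exp (2 * sqrt (ln (real n)))"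
    unfolding ln using exp_sqrt_ln_ge[OF l1] by (intro mult_left_mono) auto
  finally show ?thesis unfolding e .
qed

text \<open>The exponent is chosen so that \<open>n powr \<epsilon> n\<close> is exactly
  \<open>2 ^ (A * kpar n + B)\<close> for \<open>n \<ge> 2\<close>. It tends to 0 because minimality
  of \<open>kpar n\<close> makes \<open>(kpar n - 1)^2\<close> at most \<open>log 2 n\<close>, so
  the numerator is only of the order of \<open>sqrt (log 2 n)\<close>.\<close>

lemma time_bound_asymptotics:
  fixes T :: "nat \<Rightarrow> nat"
  assumes "\<And>n. 2 \<le> n \<Longrightarrow> T n \<le> n\<^sup>2 * 2 ^ (A * kpar n + B)"
  shows "\<exists>\<epsilon> :: nat \<Rightarrow> real. \<epsilon> \<longlonglongrightarrow> 0 \<and> (\<lambda>n. real (T n)) \<in> O(\<lambda>n. real n powr (2 + \<epsilon> n))"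
proof -
  define \<epsilon> where "\<epsilon> n = (real A * kpar n + real B) / log 2 (real n)" for n
  have up: "\<epsilon> n \<le> (A * (1 + sqrt (log 2 (real n))) + B) / log 2 (real n)" if n: "2 \<le> n" for n
  proof -
    have l: "1 \<le> log 2 (real n)" using n by simp
    have "real (kpar n) \<le> 1 + sqrt (log 2 (real n))"
    proof (cases "kpar n = 1")
      case False
      then have k: "1 < kpar n" using kpar_props(1)[of n] by simp
      have "(kpar n - 1)\<^sup>2 \<le> (kpar n - 1) * kpar n" by (simp add: power2_eq_square)
      then have "(2::nat) ^ ((kpar n - 1)\<^sup>2) \<le> 2 ^ ((kpar n - 1) * kpar n)"
        by (intro power_increasing) auto
      then have "(2::nat) ^ ((kpar n - 1)\<^sup>2) < n" using kpar_less[OF k] by (rule le_less_trans)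
      then have "2 ^ ((kpar n - 1)\<^sup>2) < real n"
        by (metis of_nat_less_iff of_nat_numeral of_nat_power)
      then have "2 powr real ((kpar n - 1)\<^sup>2) \<le> real n"
        by (metis less_imp_le powr_realpow zero_less_numeral)
      then have "real ((kpar n - 1)\<^sup>2) \<le> log 2 (real n)" using n by (subst le_log_iff) simp_all
      then have "(real (kpar n - 1))\<^sup>2 \<le> log 2 (real n)" by simp
      then have "real (kpar n - 1) \<le> sqrt (log 2 (real n))" by (rule real_le_rsqrt)
      then show ?thesis using k by (simp add: of_nat_diff)
    qed (use l in simp)
    then show ?thesis unfolding \<epsilon>_def using l
      by (intro divide_right_mono add_right_mono mult_left_mono) auto
  qed
  have "\<epsilon> \<longlonglongrightarrow> 0"
  proof (rule tendsto_sandwich)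
    show "\<forall>\<^sub>F n in sequentially. 0 \<le> \<epsilon> n"
      using eventually_ge_at_top[of 2] by eventually_elim (simp add: \<epsilon>_def)
    show "\<forall>\<^sub>F n in sequentially. \<epsilon> n \<le> (A * (1 + sqrt (log 2 (real n))) + B) / log 2 (real n)"
      using eventually_ge_at_top[of 2] by eventually_elim (rule up)
    show "(\<lambda>n. (A * (1 + sqrt (log 2 (real n))) + B) / log 2 (real n)) \<longlonglongrightarrow> 0"
      unfolding log_def by real_asymp
  qed simp
  moreover have "(\<lambda>n. real (T n)) \<in> O(\<lambda>n. real n powr (2 + \<epsilon> n))"
  proof (rule bigoI[of _ 1])
    show "\<forall>\<^sub>F n in sequentially. norm (real (T n)) \<le> 1 * norm (real n powr (2 + \<epsilon> n))"
      using eventually_ge_at_top[of 2]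
    proof eventually_elim
      case (elim n)
      have l: "1 \<le> log 2 (real n)" using elim by simp
      have "real n powr \<epsilon> n = (2 powr log 2 (real n)) powr \<epsilon> n" using elim by simp
      also have "\<dots> = 2 powr (real A * kpar n + real B)"
        unfolding powr_powr \<epsilon>_def using l by simp
      also have "\<dots> = 2 ^ (A * kpar n + B)" by (simp flip: powr_realpow)
      finally have "real n powr (2 + \<epsilon> n) = (real n)\<^sup>2 * 2 ^ (A * kpar n + B)"
        using elim by (simp add: powr_add)
      moreover have "real (T n) \<le> real (n\<^sup>2 * 2 ^ (A * kpar n + B))"
        using assms[OF elim] by (rule of_nat_mono)
      ultimately show ?case by simp
    qed
  qed
  ultimately show ?thesis by blast
qed

section \<open>A program logic with elapsed time\<close>

type_synonym assertion = "(nat \<Rightarrow> nat) \<Rightarrow> (nat \<Rightarrow> nat) \<Rightarrow> nat \<Rightarrow> bool"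

text \<open>The constant 8 is the largest one written in the program; it marks the offset of the
  stack in the memory layout.\<close>

definition bnd :: "nat \<Rightarrow> (nat \<Rightarrow> nat) \<Rightarrow> (nat \<Rightarrow> nat) \<Rightarrow> bool" where
  "bnd V r m \<longleftrightarrow> 8 \<le> V \<and> (\<forall>x. r x \<le> V) \<and> (\<forall>a. m a \<le> V)"

lemma bndD: "bnd V r m \<Longrightarrow> 8 \<le> V" "bnd V r m \<Longrightarrow> r x \<le> V" "bnd V r m \<Longrightarrow> m a \<le> V"
  by (simp_all add: bnd_def)

primrec tame :: "expr \<Rightarrow> bool" where
  "tame (Const k) \<longleftrightarrow> k \<le> 8"
| "tame (Reg x) \<longleftrightarrow> True"
| "tame (Mem a) \<longleftrightarrow> tame a"
| "tame (Plus a b) \<longleftrightarrow> tame a \<and> tame b"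
| "tame (Monus a b) \<longleftrightarrow> tame a \<and> tame b"
| "tame (Times a b) \<longleftrightarrow> tame a \<and> tame b"
| "tame (Div a b) \<longleftrightarrow> tame a \<and> tame b"

definition simple :: "expr \<Rightarrow> bool" where
  "simple e \<longleftrightarrow> tame e \<and> cost e \<le> 32"

lemma fits_mono: "fits W e s \<Longrightarrow> W \<le> W' \<Longrightarrow> fits W' e s"
  by (induction e) auto

text \<open>Exponents add under multiplication, and the node of a sum contributes one more factor
  \<open>V\<close>, enough for \<open>V ^ a + V ^ b\<close>. Truncated subtraction and division do
  not exceed their first argument. The cost of an expression thus bounds the size of all its
  intermediate values.\<close>

lemma val_le_power:
  assumes "bnd V r m" "tame e"
  shows "val e (r, m) \<le> V ^ cost e \<and> fits (V ^ cost e) e (r, m)"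
  using assms(2)
proof (induction e)
  have V: "8 \<le> V" using bndD[OF assms(1)] by simp
  have up: "V \<le> V ^ Suc c" for c using V by simp
  have mono: "V ^ i \<le> V ^ j" if "i \<le> j" for i j using V that by (intro power_increasing) auto
  have add: "V ^ a + V ^ b \<le> V ^ (1 + a + b)" for a b
  proof -
    have "V ^ a + V ^ b \<le> V ^ (a + b) + V ^ (a + b)" by (intro add_mono mono) auto
    also have "\<dots> \<le> V * V ^ (a + b)" using mult_le_mono1[of 2 V "V ^ (a + b)"] V by linarith
    finally show ?thesis by simp
  qed
  {
    case (Const k)
    then show ?case using V by simp
  next
    case (Reg x)
    then show ?case using bndD(2)[OF assms(1)] by simp
  next
    case (Mem a)
    then have "fits (V ^ cost (Mem a)) a (r, m)" using fits_mono mono[of "cost a" "cost (Mem a)"] by auto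
    then show ?case using bndD(3)[OF assms(1), of "val a (r, m)"] up[of "cost a"]
      by (simp del: power_Suc)
  next
    case (Plus a b)
    then have "fits (V ^ cost (Plus a b)) a (r, m)" "fits (V ^ cost (Plus a b)) b (r, m)"
      using fits_mono mono[of "cost a" "cost (Plus a b)"] mono[of "cost b" "cost (Plus a b)"] by auto
    moreover have "val (Plus a b) (r, m) \<le> V ^ cost (Plus a b)"
      using Plus add[of "cost a" "cost b"] by (simp del: power_Suc)
    ultimately show ?case by (simp del: power_Suc)
  next
    case (Monus a b)
    then have "fits (V ^ cost (Monus a b)) a (r, m)" "fits (V ^ cost (Monus a b)) b (r, m)"
      using fits_mono mono[of "cost a" "cost (Monus a b)"] mono[of "cost b" "cost (Monus a b)"] by auto
    moreover have "val (Monus a b) (r, m) \<le> V ^ cost (Monus a b)"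
    proof -
      have "val (Monus a b) (r, m) \<le> val a (r, m)" by simp
      also have "\<dots> \<le> V ^ cost a" using Monus by simp
      also have "\<dots> \<le> V ^ cost (Monus a b)" by (rule mono) simp
      finally show ?thesis .
    qed
    ultimately show ?case by (simp del: power_Suc)
  next
    case (Times a b)
    then have "fits (V ^ cost (Times a b)) a (r, m)" "fits (V ^ cost (Times a b)) b (r, m)"
      using fits_mono mono[of "cost a" "cost (Times a b)"] mono[of "cost b" "cost (Times a b)"] by auto
    moreover have "val (Times a b) (r, m) \<le> V ^ cost (Times a b)"
    proof -
      have "val (Times a b) (r, m) \<le> V ^ cost a * V ^ cost b" using Times by (simp add: mult_le_mono)
      also have "\<dots> = V ^ (cost a + cost b)" by (simp only: power_add)
      also have "\<dots> \<le> V ^ cost (Times a b)" by (rule mono) simp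
      finally show ?thesis .
    qed
    ultimately show ?case by (simp del: power_Suc)
  next
    case (Div a b)
    then have "fits (V ^ cost (Div a b)) a (r, m)" "fits (V ^ cost (Div a b)) b (r, m)"
      using fits_mono mono[of "cost a" "cost (Div a b)"] mono[of "cost b" "cost (Div a b)"] by auto
    moreover have "val (Div a b) (r, m) \<le> V ^ cost (Div a b)"
    proof -
      have "val (Div a b) (r, m) \<le> val a (r, m)" by simp
      also have "\<dots> \<le> V ^ cost a" using Div by simp
      also have "\<dots> \<le> V ^ cost (Div a b)" by (rule mono) simp
      finally show ?thesis .
    qed
    ultimately show ?case by (simp del: power_Suc)
  }
qed

lemma simple_fits: "bnd V r m \<Longrightarrow> simple e \<Longrightarrow> fits (V ^ 32) e (r, m)"
proof -
  assume a: "bnd V r m" "simple e"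
  then have "fits (V ^ cost e) e (r, m)" using val_le_power simple_def by blast
  moreover have "V ^ cost e \<le> V ^ 32"
    using a bndD(1)[OF a(1)] unfolding simple_def by (intro power_increasing) auto
  ultimately show ?thesis by (rule fits_mono)
qed

text \<open>The third argument of an assertion is the time elapsed since the start of the whole program,
  so running times are bounded by ordinary invariants. Registers and cells are kept below \<open>V\<close>;
  intermediate values of expressions then fit into words of size \<open>V ^ 32\<close>.\<close>

definition wp :: "nat \<Rightarrow> com \<Rightarrow> assertion \<Rightarrow> assertion" where
  "wp V c Q r m \<tau> \<longleftrightarrow> (bnd V r m \<longrightarrow>
     (\<exists>t r' m'. run (V ^ 32) c (r, m) t (r', m') \<and> bnd V r' m' \<and> Q r' m' (\<tau> + t)))"

lemma wp_mono:
  "wp V c Q r m \<tau> \<Longrightarrow> (\<And>r m \<tau>. bnd V r m \<Longrightarrow> Q r m \<tau> \<Longrightarrow> Q' r m \<tau>) \<Longrightarrow> wp V c Q' r m \<tau>"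
  unfolding wp_def by blast

lemma wp_bnd: "(bnd V r m \<Longrightarrow> wp V c Q r m \<tau>) \<Longrightarrow> wp V c Q r m \<tau>"
  unfolding wp_def by blast

lemma wp_seq:
  assumes "wp V c (wp V d Q) r m \<tau>"
  shows "wp V (Seq c d) Q r m \<tau>"
  unfolding wp_def
proof
  assume "bnd V r m"
  then obtain t r1 m1 where 1: "run (V ^ 32) c (r, m) t (r1, m1)" "bnd V r1 m1"
      "wp V d Q r1 m1 (\<tau> + t)" using assms unfolding wp_def[of V c] by blast
  then obtain t' r2 m2 where 2: "run (V ^ 32) d (r1, m1) t' (r2, m2)" "bnd V r2 m2"
      "Q r2 m2 (\<tau> + t + t')" unfolding wp_def by blast
  show "\<exists>t r' m'. run (V ^ 32) (Seq c d) (r, m) t (r', m') \<and> bnd V r' m' \<and> Q r' m' (\<tau> + t)"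
    using run.Seq[OF 1(1) 2(1)] 2(2,3) by (metis add.assoc)
qed

lemma wp_assign:
  assumes "simple e" "bnd V r m \<Longrightarrow> val e (r, m) \<le> V"
    "bnd V r m \<Longrightarrow> Q (r(x := val e (r, m))) m (\<tau> + 1 + cost e)"
  shows "wp V (Assign x e) Q r m \<tau>"
  unfolding wp_def
proof
  assume b: "bnd V r m"
  have "run (V ^ 32) (Assign x e) (r, m) (1 + cost e) (r(x := val e (r, m)), m)"
    using run.Assign[OF simple_fits[OF b assms(1)], of x] by simp
  moreover have "bnd V (r(x := val e (r, m))) m" using b assms(2) by (simp add: bnd_def)
  ultimately show "\<exists>t r' m'. run (V ^ 32) (Assign x e) (r, m) t (r', m') \<and> bnd V r' m' \<and> Q r' m' (\<tau> + t)"
    using assms(3) b by (metis add.assoc)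
qed

lemma wp_store:
  assumes "simple a" "simple e" "bnd V r m \<Longrightarrow> val e (r, m) \<le> V"
    "bnd V r m \<Longrightarrow> Q r (m(val a (r, m) := val e (r, m))) (\<tau> + 1 + cost a + cost e)"
  shows "wp V (Store a e) Q r m \<tau>"
  unfolding wp_def
proof
  assume b: "bnd V r m"
  have "run (V ^ 32) (Store a e) (r, m) (1 + cost a + cost e) (r, m(val a (r, m) := val e (r, m)))"
    using run.Store[OF simple_fits[OF b assms(1)] simple_fits[OF b assms(2)]] by simp
  moreover have "bnd V r (m(val a (r, m) := val e (r, m)))" using b assms(3) by (simp add: bnd_def)
  ultimately show "\<exists>t r' m'. run (V ^ 32) (Store a e) (r, m) t (r', m') \<and> bnd V r' m' \<and> Q r' m' (\<tau> + t)"
    using assms(4) b by (metis add.assoc)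
qed

lemma wp_skip: "Q r m (\<tau> + 1) \<Longrightarrow> wp V Skip Q r m \<tau>"
  unfolding wp_def using run.Skip by blast

lemma wp_cond:
  assumes "simple b"
    "bnd V r m \<Longrightarrow> val b (r, m) \<noteq> 0 \<Longrightarrow> wp V c Q r m (\<tau> + 1 + cost b)"
    "bnd V r m \<Longrightarrow> val b (r, m) = 0 \<Longrightarrow> wp V d Q r m (\<tau> + 1 + cost b)"
  shows "wp V (Cond b c d) Q r m \<tau>"
  unfolding wp_def
proof
  assume bn: "bnd V r m"
  have f: "fits (V ^ 32) b (r, m)" using simple_fits[OF bn assms(1)] .
  show "\<exists>t r' m'. run (V ^ 32) (Cond b c d) (r, m) t (r', m') \<and> bnd V r' m' \<and> Q r' m' (\<tau> + t)"
  proof (cases "val b (r, m) = 0")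
    case True
    then obtain t r' m' where "run (V ^ 32) d (r, m) t (r', m')" "bnd V r' m'"
      "Q r' m' (\<tau> + 1 + cost b + t)" using assms(3)[OF bn] bn unfolding wp_def by blast
    then show ?thesis using run.CondFalse[OF f True] by (metis add.assoc)
  next
    case False
    then obtain t r' m' where "run (V ^ 32) c (r, m) t (r', m')" "bnd V r' m'"
      "Q r' m' (\<tau> + 1 + cost b + t)" using assms(2)[OF bn] bn unfolding wp_def by blast
    then show ?thesis using run.CondTrue[OF f False] by (metis add.assoc)
  qed
qed

text \<open>The index of the invariant is a termination measure. Invariants may tie the elapsed time
  to it; in the main loop it is the potential of the stack.\<close>

lemma wp_while:
  fixes I :: "nat \<Rightarrow> assertion"
  assumes "simple b" "I k r m \<tau>"
    and step: "\<And>k r m \<tau>. I k r m \<tau> \<Longrightarrow> bnd V r m \<Longrightarrow> val b (r, m) \<noteq> 0 \<Longrightarrow>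
      wp V c (\<lambda>r m \<tau>. \<exists>k'<k. I k' r m \<tau>) r m (\<tau> + 1 + cost b)"
    and fin: "\<And>k r m \<tau>. I k r m \<tau> \<Longrightarrow> bnd V r m \<Longrightarrow> val b (r, m) = 0 \<Longrightarrow> Q r m (\<tau> + 1 + cost b)"
  shows "wp V (While b c) Q r m \<tau>"
  using assms(2)
proof (induction k arbitrary: r m \<tau> rule: less_induct)
  case (less k)
  show ?case unfolding wp_def
  proof
    assume bn: "bnd V r m"
    have f: "fits (V ^ 32) b (r, m)" using simple_fits[OF bn assms(1)] .
    show "\<exists>t r' m'. run (V ^ 32) (While b c) (r, m) t (r', m') \<and> bnd V r' m' \<and> Q r' m' (\<tau> + t)"
    proof (cases "val b (r, m) = 0")
      case True
      then show ?thesis using run.WhileFalse[OF f True] fin[OF less.prems bn True] bn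
        by (metis add.assoc)
    next
      case False
      obtain t r1 m1 k' where 1: "run (V ^ 32) c (r, m) t (r1, m1)" "bnd V r1 m1" "k' < k"
          "I k' r1 m1 (\<tau> + 1 + cost b + t)"
        using step[OF less.prems bn False] bn unfolding wp_def by blast
      have "wp V (While b c) Q r1 m1 (\<tau> + 1 + cost b + t)" using less.IH 1 by blast
      then obtain t' r2 m2 where 2: "run (V ^ 32) (While b c) (r1, m1) t' (r2, m2)" "bnd V r2 m2"
          "Q r2 m2 (\<tau> + 1 + cost b + t + t')" using 1(2) unfolding wp_def by blast
      then show ?thesis using run.WhileTrue[OF f False 1(1) 2(1)] by (metis add.assoc)
    qed
  qed
qed

definition For :: "nat \<Rightarrow> nat \<Rightarrow> com \<Rightarrow> com" where
  "For i x c = Seq (Assign i (Const 0))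
     (While (Monus (Reg x) (Reg i)) (Seq c (Assign i (Plus (Reg i) (Const 1)))))"

text \<open>The offset 2 is the cost of the initial assignment, and each offset 4 that of one guard
  test or one increment. The invariant has to hold with the counter already advanced, and the body
  must leave the counter unchanged.\<close>

lemma wp_for:
  assumes init: "bnd V r m \<Longrightarrow> I 0 (r(i := 0)) m (\<tau> + 2)"
    and reg: "\<And>j r m \<tau>. I j r m \<tau> \<Longrightarrow> r i = j \<and> r x = N"
    and step: "\<And>j r m \<tau>. j < N \<Longrightarrow> I j r m \<tau> \<Longrightarrow> bnd V r m \<Longrightarrow>
      wp V c (\<lambda>r m \<tau>. r i = j \<and> I (Suc j) (r(i := Suc j)) m (\<tau> + 4)) r m (\<tau> + 4)"
    and fin: "\<And>r m \<tau>. I N r m \<tau> \<Longrightarrow> bnd V r m \<Longrightarrow> Q r m (\<tau> + 4)"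
    and "N < V"
  shows "wp V (For i x c) Q r m \<tau>"
  unfolding For_def
proof (rule wp_seq, rule wp_assign)
  let ?I = "\<lambda>k r m \<tau>. \<exists>j\<le>N. k = N - j \<and> I j r m \<tau>"
  assume b: "bnd V r m"
  show "wp V (While (Monus (Reg x) (Reg i)) (Seq c (Assign i (Plus (Reg i) (Const 1))))) Q
     (r(i := val (Const 0) (r, m))) m (\<tau> + 1 + cost (Const 0))"
  proof (rule wp_while[where I = ?I])
    show "?I N (r(i := val (Const 0) (r, m))) m (\<tau> + 1 + cost (Const 0))"
      using init[OF b] by (intro exI[of _ 0]) simp
  next
    fix k r m \<tau> assume "?I k r m \<tau>" "bnd V r m" "val (Monus (Reg x) (Reg i)) (r, m) \<noteq> 0"
    then obtain j where j: "j < N" "k = N - j" "I j r m \<tau>" "bnd V r m" using reg by fastforce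
    show "wp V (Seq c (Assign i (Plus (Reg i) (Const 1)))) (\<lambda>r m \<tau>. \<exists>k'<k. ?I k' r m \<tau>) r m
        (\<tau> + 1 + cost (Monus (Reg x) (Reg i)))"
    proof (rule wp_seq, rule wp_mono)
      show "wp V c (\<lambda>r m \<tau>. r i = j \<and> I (Suc j) (r(i := Suc j)) m (\<tau> + 4)) r m
        (\<tau> + 1 + cost (Monus (Reg x) (Reg i)))" using step[OF j(1,3,4)] by (simp add: numeral_eq_Suc)
    next
      fix r m \<tau> assume a: "r i = j \<and> I (Suc j) (r(i := Suc j)) m (\<tau> + 4)"
      show "wp V (Assign i (Plus (Reg i) (Const 1))) (\<lambda>r m \<tau>. \<exists>k'<k. ?I k' r m \<tau>) r m \<tau>"
      proof (rule wp_assign)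
        show "val (Plus (Reg i) (Const 1)) (r, m) \<le> V" using a j \<open>N < V\<close> by simp
        show "\<exists>k'<k. ?I k' (r(i := val (Plus (Reg i) (Const 1)) (r, m))) m
            (\<tau> + 1 + cost (Plus (Reg i) (Const 1)))"
        proof (rule exI[of _ "N - Suc j"], rule conjI)
          have "I (Suc j) (r(i := val (Plus (Reg i) (Const 1)) (r, m))) m
              (\<tau> + 1 + cost (Plus (Reg i) (Const 1)))" using a by (simp add: numeral_eq_Suc)
          then show "?I (N - Suc j) (r(i := val (Plus (Reg i) (Const 1)) (r, m))) m
              (\<tau> + 1 + cost (Plus (Reg i) (Const 1)))" using j(1) by (intro exI[of _ "Suc j"] conjI) auto
        qed (use j in simp)
      qed (simp add: simple_def)
    qed
  next
    fix k r m \<tau> assume "?I k r m \<tau>" "bnd V r m" "val (Monus (Reg x) (Reg i)) (r, m) = 0"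
    then obtain j where j: "j \<le> N" "I j r m \<tau>" "N \<le> j" "bnd V r m" using reg by fastforce
    then show "Q r m (\<tau> + 1 + cost (Monus (Reg x) (Reg i)))" using fin[of r m \<tau>] by (simp add: numeral_eq_Suc)
  qed (simp add: simple_def)
qed (simp_all add: simple_def bnd_def)

text \<open>Weakest preconditions of loop-free programs; the value for \<open>While\<close> is a dummy.\<close>

primrec pre :: "nat \<Rightarrow> com \<Rightarrow> assertion \<Rightarrow> assertion" where
  "pre V Skip Q = (\<lambda>r m \<tau>. Q r m (\<tau> + 1))"
| "pre V (Assign x e) Q = (\<lambda>r m \<tau>. simple e \<and> val e (r, m) \<le> V \<and>
     Q (r(x := val e (r, m))) m (\<tau> + 1 + cost e))"
| "pre V (Store a e) Q = (\<lambda>r m \<tau>. simple a \<and> simple e \<and> val e (r, m) \<le> V \<and>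
     Q r (m(val a (r, m) := val e (r, m))) (\<tau> + 1 + cost a + cost e))"
| "pre V (Seq c d) Q = pre V c (pre V d Q)"
| "pre V (Cond b c d) Q = (\<lambda>r m \<tau>. simple b \<and>
     (val b (r, m) \<noteq> 0 \<longrightarrow> pre V c Q r m (\<tau> + 1 + cost b)) \<and>
     (val b (r, m) = 0 \<longrightarrow> pre V d Q r m (\<tau> + 1 + cost b)))"
| "pre V (While b c) Q = (\<lambda>r m \<tau>. False)"

lemma pre_wp: "pre V c Q r m \<tau> \<Longrightarrow> wp V c Q r m \<tau>"
proof (induction c arbitrary: Q r m \<tau>)
  case (Seq c d)
  have "wp V c (pre V d Q) r m \<tau>" using Seq by simp
  then show ?case using Seq.IH(2) by (intro wp_seq) (rule wp_mono)
qed (auto intro: wp_skip wp_assign wp_store wp_cond)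

lemma wp_pre: "(bnd V r m \<Longrightarrow> pre V c Q r m \<tau>) \<Longrightarrow> wp V c Q r m \<tau>"
  by (rule wp_bnd) (rule pre_wp)

lemma wp_seq_pre: "(bnd V r m \<Longrightarrow> pre V c (wp V d Q) r m \<tau>) \<Longrightarrow> wp V (Seq c d) Q r m \<tau>"
  by (rule wp_seq, rule wp_pre)

text \<open>The frame condition of the program logic, used for registers and for memory
  alike.\<close>

definition same_off :: "nat set \<Rightarrow> (nat \<Rightarrow> nat) \<Rightarrow> (nat \<Rightarrow> nat) \<Rightarrow> bool" where
  "same_off M f g \<longleftrightarrow> (\<forall>x. x \<notin> M \<longrightarrow> g x = f x)"

lemma same_offD: "same_off M f g \<Longrightarrow> x \<notin> M \<Longrightarrow> g x = f x"
  by (simp add: same_off_def)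

lemma same_off_refl [simp]: "same_off M f f"
  by (simp add: same_off_def)

lemma same_off_upd [intro]: "same_off M f g \<Longrightarrow> x \<in> M \<Longrightarrow> same_off M f (g(x := v))"
  by (auto simp: same_off_def)

lemma same_off_trans: "same_off M f g \<Longrightarrow> same_off M' g h \<Longrightarrow> M \<subseteq> N \<Longrightarrow> M' \<subseteq> N \<Longrightarrow> same_off N f h"
  unfolding same_off_def by (metis subsetD)

section \<open>Tournament trees\<close>

text \<open>Keeps elapsed times in the form of sums of numerals.\<close>

declare One_nat_def [simp del] add_2_eq_Suc [simp del] add_2_eq_Suc' [simp del]

text \<open>The leaves of the tree are the nodes \<open>n, \<dots>, 2 n - 1\<close>; the value \<open>n\<close> stands for an absent
  competitor.\<close>

definition better :: "nat \<Rightarrow> (nat \<Rightarrow> nat) \<Rightarrow> nat \<Rightarrow> nat \<Rightarrow> nat" where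
  "better n \<kappa> x y = (if x < n then if y < n then if \<kappa> y < \<kappa> x then y else x else x else y)"

text \<open>Heap addressing: node \<open>i\<close> has the children \<open>2 * i\<close> and
  \<open>2 * i + 1\<close>. This works for every \<open>n\<close>, not only for powers of two; the
  leaves may then lie at two different depths.\<close>

definition node_ok :: "nat \<Rightarrow> (nat \<Rightarrow> nat) \<Rightarrow> nat \<Rightarrow> (nat \<Rightarrow> nat) \<Rightarrow> nat \<Rightarrow> bool" where
  "node_ok n \<kappa> T m i \<longleftrightarrow> m (T + i) = better n \<kappa> (m (T + 2 * i)) (m (T + (2 * i + 1)))"

definition leaves :: "nat \<Rightarrow> nat set \<Rightarrow> nat \<Rightarrow> (nat \<Rightarrow> nat) \<Rightarrow> bool" where
  "leaves n A T m \<longleftrightarrow> (\<forall>v<n. m (T + (n + v)) = (if v \<in> A then v else n))"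

lemma tree_values:
  assumes "leaves n A T m" "\<And>i. 1 \<le> i \<Longrightarrow> i < n \<Longrightarrow> node_ok n \<kappa> T m i" "1 \<le> i" "i < 2 * n"
  shows "m (T + i) \<in> insert n A"
  using assms(3,4)
proof (induction "2 * n - i" arbitrary: i rule: less_induct)
  case less
  show ?case
  proof (cases "i < n")
    case True
    have "m (T + 2 * i) \<in> insert n A" "m (T + (2 * i + 1)) \<in> insert n A"
      using less.hyps[of "2 * i"] less.hyps[of "2 * i + 1"] less.prems True by (auto simp: add.assoc)
    then show ?thesis using assms(2)[OF less.prems(1) True] unfolding node_ok_def better_def by auto
  next
    case False
    then obtain v where "i = n + v" by (metis le_add_diff_inverse not_less)
    then show ?thesis using assms(1) less.prems unfolding leaves_def by simp
  qed
qed

text \<open>The ancestors of the leaf \<open>n + v\<close> are the nodes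
  \<open>(n + v) div 2 ^ t\<close>. Along this chain the stored competitor is always present and its
  key never exceeds that of \<open>v\<close>; the chain ends at node 1.\<close>

lemma tree_root:
  assumes "leaves n A T m" "\<And>i. 1 \<le> i \<Longrightarrow> i < n \<Longrightarrow> node_ok n \<kappa> T m i" "2 \<le> n"
    and "A \<subseteq> {..<n}" "A \<noteq> {}"
  shows "m (T + 1) \<in> A" "\<And>v. v \<in> A \<Longrightarrow> \<kappa> (m (T + 1)) \<le> \<kappa> v"
proof -
  have up: "m (T + (n + v) div 2 ^ t) < n \<and> \<kappa> (m (T + (n + v) div 2 ^ t)) \<le> \<kappa> v"
    if v: "v \<in> A" and "1 \<le> (n + v) div 2 ^ t" for v t
    using that(2)
  proof (induction t)
    case 0
    have "v < n" using v assms(4) by auto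
    then show ?case using assms(1) v unfolding leaves_def by simp
  next
    case (Suc t)
    define c p where "c = (n + v) div 2 ^ t" and "p = (n + v) div 2 ^ Suc t"
    have pc: "p = c div 2" unfolding p_def c_def power_Suc2 div_mult2_eq ..
    have p1: "1 \<le> p" using Suc.prems unfolding p_def by simp
    have c1: "1 \<le> c" using p1 pc by linarith
    have c: "m (T + c) < n" "\<kappa> (m (T + c)) \<le> \<kappa> v" using Suc.IH c1 unfolding c_def by auto
    have "c \<le> n + v" unfolding c_def by simp
    then have "p < n" using pc v assms(4) by auto
    then have ok: "node_ok n \<kappa> T m p" using assms(2) p1 by simp
    have "c = 2 * p \<or> c = 2 * p + 1" using pc by linarith
    then show ?case
    proof
      assume "c = 2 * p"
      then show ?thesis using ok c unfolding node_ok_def p_def[symmetric] better_def by auto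
    next
      assume "c = 2 * p + 1"
      then show ?thesis using ok c unfolding node_ok_def p_def[symmetric] better_def by auto
    qed
  qed
  have top: "\<exists>t. (x::nat) div 2 ^ t = 1" if "1 \<le> x" for x
    using that
  proof (induction x rule: less_induct)
    case (less x)
    show ?case
    proof (cases "x = 1")
      case True
      then show ?thesis by (intro exI[of _ 0]) simp
    next
      case False
      then obtain t where "x div 2 div 2 ^ t = 1"
        using less.IH[of "x div 2"] less.prems by fastforce
      then show ?thesis by (intro exI[of _ "Suc t"]) (simp add: div_mult2_eq mult.commute)
    qed
  qed
  have all: "m (T + 1) < n \<and> \<kappa> (m (T + 1)) \<le> \<kappa> v" if "v \<in> A" for v
  proof -
    obtain t where "(n + v) div 2 ^ t = 1" using top[of "n + v"] assms(3) by auto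
    then show ?thesis using up[OF that, of t] by simp
  qed
  then show "\<And>v. v \<in> A \<Longrightarrow> \<kappa> (m (T + 1)) \<le> \<kappa> v" by blast
  have "m (T + 1) < n" using all assms(5) by blast
  moreover have "m (T + 1) \<in> insert n A" by (rule tree_values[OF assms(1,2)]) (use assms(3) in auto)
  ultimately show "m (T + 1) \<in> A" by auto
qed

definition key :: "nat \<Rightarrow> nat \<Rightarrow> expr" where
  "key x y = Mem (Plus (Plus (Reg 14) (Times (Reg x) (Reg 0))) (Reg y))"

definition fix_node :: com where
  "fix_node =
     Seq (Assign 25 (Mem (Plus (Reg 31) (Times (Const 2) (Reg 19)))))
    (Seq (Assign 26 (Mem (Plus (Reg 31) (Plus (Times (Const 2) (Reg 19)) (Const 1)))))
    (Cond (Monus (Reg 0) (Reg 25))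
      (Cond (Monus (Reg 0) (Reg 26))
        (Cond (Monus (key 17 25) (key 17 26))
          (Store (Plus (Reg 31) (Reg 19)) (Reg 26))
          (Store (Plus (Reg 31) (Reg 19)) (Reg 25)))
        (Store (Plus (Reg 31) (Reg 19)) (Reg 25)))
      (Store (Plus (Reg 31) (Reg 19)) (Reg 26))))"

lemma wp_fix_node:
  assumes "r 0 = n" "r 31 = T" "r 19 = i" "\<And>v. v < n \<Longrightarrow> m (r 14 + r 17 * n + v) = \<kappa> v"
    and "\<And>\<tau>'. \<tau>' \<le> \<tau> + 60 \<Longrightarrow> Q (r(25 := m (T + 2 * i), 26 := m (T + (2 * i + 1))))
      (m(T + i := better n \<kappa> (m (T + 2 * i)) (m (T + (2 * i + 1))))) \<tau>'"
  shows "wp V fix_node Q r m \<tau>"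
  unfolding fix_node_def
  apply (rule wp_pre)
  using assms
  apply (auto simp: simple_def key_def better_def bndD)
  done

definition build :: com where
  "build = Seq (Assign 19 (Reg 0)) (While (Monus (Reg 19) (Const 1))
     (Seq (Assign 19 (Monus (Reg 19) (Const 1))) fix_node))"

lemma wp_build:
  assumes r: "r 0 = n" "r 31 = T" and keys: "\<And>v. v < n \<Longrightarrow> m (r 14 + r 17 * n + v) = \<kappa> v"
    and lay: "r 14 + r 17 * n + n \<le> T" and n: "1 \<le> n"
    and Q: "\<And>r' m' \<tau>'. same_off {19, 25, 26} r r' \<Longrightarrow> same_off {T + 1..<T + n} m m' \<Longrightarrow>
      (\<And>i. 1 \<le> i \<Longrightarrow> i < n \<Longrightarrow> node_ok n \<kappa> T m' i) \<Longrightarrow> \<tau>' \<le> \<tau> + 80 * n + 10 \<Longrightarrow> Q r' m' \<tau>'"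
  shows "wp V build Q r m \<tau>"
proof -
  let ?I = "\<lambda>k r' m' \<tau>'. r' 19 = k \<and> 1 \<le> k \<and> k \<le> n \<and> same_off {19, 25, 26} r r' \<and>
    same_off {T + 1..<T + n} m m' \<and> (\<forall>i. k \<le> i \<longrightarrow> i < n \<longrightarrow> node_ok n \<kappa> T m' i) \<and>
    \<tau>' + 80 * k \<le> \<tau> + 80 * n + 5"
  show ?thesis unfolding build_def
  proof (rule wp_seq_pre)
    assume b: "bnd V r m"
    have "wp V (While (Monus (Reg 19) (Const 1)) (Seq (Assign 19 (Monus (Reg 19) (Const 1))) fix_node))
       Q (r(19 := n)) m (\<tau> + 2)"
    proof (rule wp_while[where I = ?I and k = n])
      show "?I n (r(19 := n)) m (\<tau> + 2)" using n by (auto intro: same_off_upd)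
    next
      fix k r1 m1 \<tau>1 assume I: "?I k r1 m1 \<tau>1" and b1: "bnd V r1 m1"
        and "val (Monus (Reg 19) (Const 1)) (r1, m1) \<noteq> 0"
      then have k: "2 \<le> k" by auto
      have r1: "r1 0 = n" "r1 31 = T" "r1 14 = r 14" "r1 17 = r 17"
        using I r same_offD[of "{19, 25, 26}" r r1] by auto
      have keys1: "m1 (r 14 + r 17 * n + v) = \<kappa> v" if "v < n" for v
        using I keys[OF that] same_offD[of "{T + 1..<T + n}" m m1] lay that by auto
      obtain j where j: "k = Suc j" "1 \<le> j" using k by (cases k) auto
      let ?i = j
      show "wp V (Seq (Assign 19 (Monus (Reg 19) (Const 1))) fix_node)
          (\<lambda>r m \<tau>. \<exists>k'<k. ?I k' r m \<tau>) r1 m1 (\<tau>1 + 1 + cost (Monus (Reg 19) (Const 1)))"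
      proof (rule wp_seq_pre)
        have "wp V fix_node (\<lambda>r m \<tau>. \<exists>k'<k. ?I k' r m \<tau>) (r1(19 := ?i)) m1 (\<tau>1 + 8)"
        proof (rule wp_fix_node[where \<kappa> = \<kappa> and n = n and T = T and i = ?i])
          fix \<tau>2 assume t2: "\<tau>2 \<le> \<tau>1 + 8 + 60"
          let ?r = "r1(19 := ?i, 25 := m1 (T + 2 * ?i), 26 := m1 (T + (2 * ?i + 1)))"
          let ?m = "m1(T + ?i := better n \<kappa> (m1 (T + 2 * ?i)) (m1 (T + (2 * ?i + 1))))"
          have "node_ok n \<kappa> T ?m i" if "?i \<le> i" "i < n" for i
          proof (cases "i = ?i")
            case True
            then show ?thesis using j by (simp add: node_ok_def)
          next
            case False
            then have "node_ok n \<kappa> T m1 i" using I that j by auto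
            then show ?thesis using False that j by (simp add: node_ok_def)
          qed
          moreover have "same_off {T + 1..<T + n} m ?m" using I j by (intro same_off_upd) auto
          moreover have "same_off {19, 25, 26} r ?r" using I by (intro same_off_upd) auto
          ultimately show "\<exists>k'<k. ?I k' ?r ?m \<tau>2"
            using I j t2 by (intro exI[of _ ?i]) auto
        qed (use r1 keys1 in auto)
        then show "pre V (Assign 19 (Monus (Reg 19) (Const 1)))
           (wp V fix_node (\<lambda>r m \<tau>. \<exists>k'<k. ?I k' r m \<tau>)) r1 m1
           (\<tau>1 + 1 + cost (Monus (Reg 19) (Const 1)))"
          using I j bndD(2)[OF b1, of 19] by (simp add: simple_def add.commute)
      qed
    next
      fix k r1 m1 \<tau>1 assume I: "?I k r1 m1 \<tau>1" "val (Monus (Reg 19) (Const 1)) (r1, m1) = 0"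
      then have "k = 1" by auto
      then show "Q r1 m1 (\<tau>1 + 1 + cost (Monus (Reg 19) (Const 1)))" using I by (intro Q) auto
    qed (simp add: simple_def)
    then show "pre V (Assign 19 (Reg 0)) (wp V (While (Monus (Reg 19) (Const 1))
        (Seq (Assign 19 (Monus (Reg 19) (Const 1))) fix_node)) Q) r m \<tau>"
      using r bndD(2)[OF b, of 0] by (simp add: simple_def add.assoc)
  qed
qed

definition climb :: com where
  "climb = While (Monus (Reg 19) (Const 1)) (Seq (Assign 19 (Div (Reg 19) (Const 2))) fix_node)"

text \<open>Only proper ancestors of the current node may be wrong, and each round moves to the
  parent and repairs it. Since the node index is halved, \<open>h\<close> bounds the number of
  rounds.\<close>

lemma wp_climb:
  assumes r: "r 0 = n" "r 31 = T" and keys: "\<And>v. v < n \<Longrightarrow> m (r 14 + r 17 * n + v) = \<kappa> v"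
    and lay: "r 14 + r 17 * n + n \<le> T" and p: "1 \<le> r 19" "r 19 < 2 * n" "r 19 < 2 ^ h"
    and ok: "\<And>i. 1 \<le> i \<Longrightarrow> i < n \<Longrightarrow> node_ok n \<kappa> T m i \<or> (\<exists>t\<ge>1. i = r 19 div 2 ^ t)"
    and Q: "\<And>r' m' \<tau>'. same_off {19, 25, 26} r r' \<Longrightarrow> same_off {T + 1..<T + n} m m' \<Longrightarrow>
      (\<And>i. 1 \<le> i \<Longrightarrow> i < n \<Longrightarrow> node_ok n \<kappa> T m' i) \<Longrightarrow> \<tau>' \<le> \<tau> + 80 * h + 10 \<Longrightarrow> Q r' m' \<tau>'"
  shows "wp V climb Q r m \<tau>"
proof -
  let ?I = "\<lambda>k r' m' \<tau>'. r' 19 = k \<and> 1 \<le> k \<and> k < 2 * n \<and> same_off {19, 25, 26} r r' \<and>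
    same_off {T + 1..<T + n} m m' \<and>
    (\<forall>i. 1 \<le> i \<longrightarrow> i < n \<longrightarrow> node_ok n \<kappa> T m' i \<or> (\<exists>t\<ge>1. i = k div 2 ^ t)) \<and>
    (\<exists>h'. k < 2 ^ h' \<and> \<tau>' + 80 * h' \<le> \<tau> + 80 * h)"
  show ?thesis unfolding climb_def
  proof (rule wp_while[where I = ?I and k = "r 19"])
    show "?I (r 19) r m \<tau>" using p ok by auto
  next
    fix k r1 m1 \<tau>1 assume I: "?I k r1 m1 \<tau>1" and b1: "bnd V r1 m1"
      and "val (Monus (Reg 19) (Const 1)) (r1, m1) \<noteq> 0"
    then have k: "2 \<le> k" by auto
    have r1: "r1 0 = n" "r1 31 = T" "r1 14 = r 14" "r1 17 = r 17"
      using I r same_offD[of "{19, 25, 26}" r r1] by auto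
    have keys1: "m1 (r 14 + r 17 * n + v) = \<kappa> v" if "v < n" for v
      using I keys[OF that] same_offD[of "{T + 1..<T + n}" m m1] lay that by auto
    obtain h' where h': "k < 2 ^ h'" "\<tau>1 + 80 * h' \<le> \<tau> + 80 * h" using I by auto
    then obtain h2 where h2: "h' = Suc h2" using k by (cases h') auto
    let ?p = "k div 2"
    have p1: "1 \<le> ?p" "?p < n" "?p < k" "?p < 2 ^ h2" using k I h' h2 by auto
    show "wp V (Seq (Assign 19 (Div (Reg 19) (Const 2))) fix_node)
        (\<lambda>r m \<tau>. \<exists>k'<k. ?I k' r m \<tau>) r1 m1 (\<tau>1 + 1 + cost (Monus (Reg 19) (Const 1)))"
    proof (rule wp_seq_pre)
      have "wp V fix_node (\<lambda>r m \<tau>. \<exists>k'<k. ?I k' r m \<tau>) (r1(19 := ?p)) m1 (\<tau>1 + 8)"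
      proof (rule wp_fix_node[where \<kappa> = \<kappa> and n = n and T = T and i = ?p])
        fix \<tau>2 assume t2: "\<tau>2 \<le> \<tau>1 + 8 + 60"
        let ?r = "r1(19 := ?p, 25 := m1 (T + 2 * ?p), 26 := m1 (T + (2 * ?p + 1)))"
        let ?m = "m1(T + ?p := better n \<kappa> (m1 (T + 2 * ?p)) (m1 (T + (2 * ?p + 1))))"
        \<comment> \<open>Writing node \<open>?p\<close> can falsify only the condition at its
          parent, which is now exempt as the first proper ancestor of the new current node;
          \<open>?p\<close> itself has just become correct.\<close>
        have "node_ok n \<kappa> T ?m i \<or> (\<exists>t\<ge>1. i = ?p div 2 ^ t)" if i: "1 \<le> i" "i < n" for i
        proof (cases "i = ?p")
          case True
          then show ?thesis using p1 by (auto simp: node_ok_def)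
        next
          case False
          consider "node_ok n \<kappa> T m1 i" | t where "t \<ge> 1" "i = k div 2 ^ t" using I i by blast
          then show ?thesis
          proof cases
            case 1
            show ?thesis
            proof (cases "i = ?p div 2")
              case True
              then show ?thesis by (intro disjI2 exI[of _ 1]) simp
            next
              case ne: False
              then have "2 * i \<noteq> ?p" "2 * i + 1 \<noteq> ?p" by presburger+
              then show ?thesis using 1 False by (simp add: node_ok_def)
            qed
          next
            case 2
            then obtain s where s: "t = Suc s" using not0_implies_Suc by force
            have "s \<noteq> 0" using False 2 s by (cases s) auto
            moreover have "i = ?p div 2 ^ s" using 2 s by (simp add: div_mult2_eq)
            ultimately show ?thesis by (metis One_nat_def Suc_leI neq0_conv)
          qed
        qed
        moreover have "same_off {T + 1..<T + n} m ?m" using I p1 by (intro same_off_upd) auto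
        moreover have "same_off {19, 25, 26} r ?r" using I by (intro same_off_upd) auto
        moreover have "\<tau>2 + 80 * h2 \<le> \<tau> + 80 * h" using h' h2 t2 by simp
        ultimately show "\<exists>k'<k. ?I k' ?r ?m \<tau>2"
          using I p1 by (intro exI[of _ ?p]) auto
      qed (use r1 keys1 in auto)
      then show "pre V (Assign 19 (Div (Reg 19) (Const 2)))
         (wp V fix_node (\<lambda>r m \<tau>. \<exists>k'<k. ?I k' r m \<tau>)) r1 m1
         (\<tau>1 + 1 + cost (Monus (Reg 19) (Const 1)))"
        using I bndD(2)[OF b1, of 19] by (simp add: simple_def add.commute)
    qed
  next
    fix k r1 m1 \<tau>1 assume I: "?I k r1 m1 \<tau>1" "val (Monus (Reg 19) (Const 1)) (r1, m1) = 0"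
    then have "k = 1" by auto
    \<comment> \<open>At the root all exempt indices are 0, outside the tree, so every node is
      correct.\<close>
    moreover have "1 div 2 ^ t = (0::nat)" if "t \<ge> 1" for t
      using that by (intro div_less one_less_power) auto
    ultimately show "Q r1 m1 (\<tau>1 + 1 + cost (Monus (Reg 19) (Const 1)))" using I by (intro Q) fastforce+
  qed (simp add: simple_def)
qed

section \<open>Selecting the earliest targets of one source\<close>

definition cell :: "nat \<Rightarrow> nat \<Rightarrow> nat \<Rightarrow> expr" where
  "cell p x y = Plus (Plus (Reg p) (Times (Reg x) (Reg 0))) (Reg y)"

definition row_init_cell :: com where
  "row_init_cell = Seq (Store (cell 30 17 18) (Const 0)) (Cond (Mem (Plus (Reg 12) (Reg 18)))
     (Store (Plus (Reg 31) (Plus (Reg 0) (Reg 18))) (Reg 18)) (Store (Plus (Reg 31) (Plus (Reg 0)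
     (Reg 18))) (Reg 0)))"

definition row_init :: com where
  "row_init = For 18 0 row_init_cell"

text \<open>The minimum is removed by writing the absent value \<open>n\<close> into its leaf. Only
  the ancestors of this leaf can become wrong, hence one climb per extracted target.\<close>

definition pop_min :: com where
  "pop_min = Seq (Seq (Assign 27 (Mem (Plus (Reg 31) (Const 1))))
    (Seq (Store (cell 30 17 27) (Const 1))
    (Seq (Assign 19 (Plus (Reg 0) (Reg 27)))
    (Store (Plus (Reg 31) (Reg 19)) (Reg 0))))) climb"

definition row :: com where
  "row = Seq row_init (Seq build (For 20 15 pop_min))"

lemma wp_row_init:
  assumes r: "r 0 = n" "r 31 = T" "r 30 + r 17 * n = f" "r 12 = py"
    and lay: "f + n \<le> T" "T + 2 * n \<le> py"
    and Y: "\<And>v. v < n \<Longrightarrow> m (py + v) = of_bool (v \<in> Y)" and n: "n < V"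
    and Q: "\<And>r' m' \<tau>'. same_off {18} r r' \<Longrightarrow> same_off ({f..<f + n} \<union> {T..<T + 2 * n}) m m' \<Longrightarrow>
      (\<And>v. v < n \<Longrightarrow> m' (f + v) = 0) \<Longrightarrow> leaves n Y T m' \<Longrightarrow> \<tau>' \<le> \<tau> + 50 * n + 10 \<Longrightarrow> Q r' m' \<tau>'"
  shows "wp V row_init Q r m \<tau>"
proof -
  let ?I = "\<lambda>j r' m' \<tau>'. r' 18 = j \<and> same_off {18} r r' \<and>
    same_off ({f..<f + n} \<union> {T..<T + 2 * n}) m m' \<and> (\<forall>v<j. m' (f + v) = 0 \<and>
    m' (T + (n + v)) = (if v \<in> Y then v else n)) \<and> \<tau>' \<le> \<tau> + 50 * j + 2"
  show ?thesis
    unfolding row_init_def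
  proof (rule wp_for[where N = n and I = ?I])
    fix j r1 m1 \<tau>1
    assume j: "j < n" and I: "?I j r1 m1 \<tau>1"
      and b: "bnd V r1 m1"
    have r1: "r1 0 = n" "r1 31 = T" "r1 30 + r1 17 * n = f" "r1 12 = py" "r1 18 = j"
      using I r same_offD[of "{18}" r r1] by auto
    have fl: "m1 (py + j) = of_bool (j \<in> Y)"
      using I Y[OF j] same_offD[of _ m m1 "py + j"] lay by auto
    show "wp V row_init_cell
       (\<lambda>r' m' \<tau>'. r' 18 = j \<and> ?I (Suc j) (r'(18 := Suc j)) m' (\<tau>' + 4)) r1 m1 (\<tau>1 + 4)"
    proof (rule wp_pre)
      assume b: "bnd V r1 m1"
      show "pre V row_init_cell
       (\<lambda>r' m' \<tau>'. r' 18 = j \<and> ?I (Suc j) (r'(18 := Suc j)) m' (\<tau>' + 4)) r1 m1 (\<tau>1 + 4)"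
        using I j r1 fl lay n
        by (auto simp: simple_def cell_def row_init_cell_def less_Suc_eq intro!: same_off_upd)
    qed
  next
    fix r1 m1 \<tau>1
    assume I: "?I n r1 m1 \<tau>1"
    then show "Q r1 m1 (\<tau>1 + 4)" by (intro Q) (auto simp: leaves_def)
  qed (use r n in \<open>auto simp: same_off_def\<close>)
qed

lemma wp_pop_min:
  assumes r: "r 0 = n" "r 31 = T" "r 30 + r 17 * n = f"
    and keys: "\<And>v. v < n \<Longrightarrow> m (r 14 + r 17 * n + v) = \<kappa> v"
    and lay: "r 14 + r 17 * n + n \<le> f" "f + n \<le> T" and n: "2 \<le> n" "2 * n \<le> V" "2 * n \<le> 2 ^ h"
    and A: "A \<subseteq> {..<n}" "A \<noteq> {}" "leaves n A T m"
      "\<And>i. 1 \<le> i \<Longrightarrow> i < n \<Longrightarrow> node_ok n \<kappa> T m i"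
    and Q: "\<And>r' m' \<tau>' w. same_off {19, 25, 26, 27} r r' \<Longrightarrow>
      same_off (insert (f + w) {T..<T + 2 * n}) m m' \<Longrightarrow> w \<in> A \<Longrightarrow> (\<And>v. v \<in> A \<Longrightarrow> \<kappa> w \<le> \<kappa> v) \<Longrightarrow>
      m' (f + w) = 1 \<Longrightarrow> leaves n (A - {w}) T m' \<Longrightarrow>
      (\<And>i. 1 \<le> i \<Longrightarrow> i < n \<Longrightarrow> node_ok n \<kappa> T m' i) \<Longrightarrow> \<tau>' \<le> \<tau> + 80 * h + 50 \<Longrightarrow> Q r' m' \<tau>'"
  shows "wp V pop_min Q r m \<tau>"
proof -
  define w where "w = m (T + 1)"
  have w: "w \<in> A" "\<And>v. v \<in> A \<Longrightarrow> \<kappa> w \<le> \<kappa> v" "w < n"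
    using tree_root[OF A(3,4) n(1) A(1,2)] A(1) unfolding w_def by auto
  let ?m = "m(f + w := 1, T + (n + w) := n)"
  let ?r = "r(27 := w, 19 := n + w)"
  have "wp V climb Q ?r ?m \<tau>'" if t: "\<tau>' \<le> \<tau> + 30" for \<tau>'
  proof (rule wp_climb[where n = n and T = T and \<kappa> = \<kappa> and h = h])
    show "?m (?r 14 + ?r 17 * n + v) = \<kappa> v" if "v < n" for v
      using keys[OF that] lay that by auto
    show "node_ok n \<kappa> T ?m i \<or> (\<exists>t\<ge>1. i = ?r 19 div 2 ^ t)" if i: "1 \<le> i" "i < n" for i
    proof (cases "i = (n + w) div 2")
      case True
      then show ?thesis by (intro disjI2 exI[of _ 1]) simp
    next
      case False
      then have "2 * i \<noteq> n + w" "2 * i + 1 \<noteq> n + w" by presburger+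
      then show ?thesis using A(4)[OF i] i lay w(3) by (auto simp: node_ok_def)
    qed
    fix r2 m2 \<tau>2
    assume 2: "same_off {19, 25, 26} ?r r2" "same_off {T + 1..<T + n} ?m m2"
      "\<And>i. 1 \<le> i \<Longrightarrow> i < n \<Longrightarrow> node_ok n \<kappa> T m2 i" "\<tau>2 \<le> \<tau>' + 80 * h + 10"
    show "Q r2 m2 \<tau>2"
    proof (rule Q[OF _ _ w(1,2) _ _ 2(3)])
      show "same_off {19, 25, 26, 27} r r2" using 2(1) by (auto simp: same_off_def)
      show "same_off (insert (f + w) {T..<T + 2 * n}) m m2"
        using 2(2) w(3) unfolding same_off_def by auto
      show "m2 (f + w) = 1" using same_offD[OF 2(2), of "f + w"] lay w(3) by auto
      show "leaves n (A - {w}) T m2"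
        using A(3) same_offD[OF 2(2)] lay w(3) unfolding leaves_def by auto
    qed (use 2 t in auto)
  qed (use r lay n w(3) in auto)
  then show ?thesis unfolding pop_min_def
    apply (intro wp_seq_pre)
    using r w_def[symmetric] w(3) n
    apply (auto simp: simple_def cell_def bndD add.assoc)
    done
qed

definition segment :: "nat set \<Rightarrow> nat \<Rightarrow> (nat \<Rightarrow> nat) \<Rightarrow> nat set \<Rightarrow> bool" where
  "segment Y q \<kappa> F \<longleftrightarrow> F \<subseteq> Y \<and> card F = q \<and> (\<forall>v\<in>F. \<forall>w\<in>Y - F. \<kappa> v \<le> \<kappa> w)"

lemma wp_row:
  assumes r: "r 0 = n" "r 31 = T" "r 30 + r 17 * n = f" "r 12 = py" "r 15 = q"
    and keys: "\<And>v. v < n \<Longrightarrow> m (r 14 + r 17 * n + v) = \<kappa> v"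
    and lay: "r 14 + r 17 * n + n \<le> f" "f + n \<le> T" "T + 2 * n \<le> py"
    and n: "2 \<le> n" "2 * n \<le> V" "2 * n \<le> 2 ^ h"
    and Y: "\<And>v. v < n \<Longrightarrow> m (py + v) = of_bool (v \<in> Y)" "Y \<subseteq> {..<n}" "q \<le> card Y"
    and Q: "\<And>r' m' \<tau>' F. same_off {18, 19, 20, 25, 26, 27} r r' \<Longrightarrow>
      same_off ({f..<f + n} \<union> {T..<T + 2 * n}) m m' \<Longrightarrow> segment Y q \<kappa> F \<Longrightarrow>
      (\<And>v. v < n \<Longrightarrow> m' (f + v) = of_bool (v \<in> F)) \<Longrightarrow> \<tau>' \<le> \<tau> + 200 * n * (h + 1) \<Longrightarrow> Q r' m' \<tau>'"
  shows "wp V row Q r m \<tau>"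
  unfolding row_def
proof (rule wp_seq, rule wp_row_init[OF r(1-4) lay(2,3) Y(1)])
  let ?S = "{f..<f + n} \<union> {T..<T + 2 * n}"
  show "n < V" using n by simp
  have finY: "finite Y" using Y(2) finite_subset by blast
  have "card Y \<le> n" using card_mono[OF _ Y(2)] by simp
  then have qn: "q \<le> n" using Y(3) by simp
  fix r1 m1 \<tau>1
  assume 1: "same_off {18} r r1" "same_off ?S m m1"
    "\<And>v. v < n \<Longrightarrow> m1 (f + v) = 0" "leaves n Y T m1" "\<tau>1 \<le> \<tau> + 50 * n + 10"
  have r1: "r1 0 = n" "r1 31 = T" "r1 30 + r1 17 * n = f" "r1 15 = q" "r1 14 = r 14" "r1 17 = r 17"
    using 1(1) r same_offD[of "{18}" r r1] by auto
  show "wp V (Seq build (For 20 15 pop_min)) Q r1 m1 \<tau>1"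
  proof (rule wp_seq, rule wp_build[where n = n and T = T and \<kappa> = \<kappa>])
    show "m1 (r1 14 + r1 17 * n + v) = \<kappa> v" if "v < n" for v
      using keys[OF that] same_offD[OF 1(2), of "r 14 + r 17 * n + v"] lay that r1 by auto
    fix r2 m2 \<tau>2
    assume 2: "same_off {19, 25, 26} r1 r2" "same_off {T + 1..<T + n} m1 m2"
      "\<And>i. 1 \<le> i \<Longrightarrow> i < n \<Longrightarrow> node_ok n \<kappa> T m2 i" "\<tau>2 \<le> \<tau>1 + 80 * n + 10"
    \<comment> \<open>After \<open>j\<close> extractions the flagged targets form an initial segment
      and the leaves hold exactly the others, so the next minimum extends the segment.\<close>
    let ?I = "\<lambda>j r' m' \<tau>'. r' 20 = j \<and> same_off {18, 19, 20, 25, 26, 27} r r' \<and> same_off ?S m m' \<and>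
      (\<exists>F. segment Y j \<kappa> F \<and> (\<forall>v<n. m' (f + v) = of_bool (v \<in> F)) \<and> leaves n (Y - F) T m') \<and>
      (\<forall>i. 1 \<le> i \<longrightarrow> i < n \<longrightarrow> node_ok n \<kappa> T m' i) \<and> \<tau>' \<le> \<tau>2 + j * (80 * h + 60) + 2"
    show "wp V (For 20 15 pop_min) Q r2 m2 \<tau>2"
    proof (rule wp_for[where N = q and I = ?I])
      have "same_off {18, 19, 20, 25, 26, 27} r (r2(20 := 0))"
        using 1(1) 2(1) by (auto simp: same_off_def)
      moreover have "same_off ?S m m2"
        by (rule same_off_trans[OF 1(2) 2(2)]) auto
      moreover have "m2 (f + v) = 0" if "v < n" for v
        using 1(3)[OF that] same_offD[OF 2(2), of "f + v"] lay that by auto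
      moreover have "leaves n (Y - {}) T m2"
        using 1(4) same_offD[OF 2(2)] unfolding leaves_def by auto
      ultimately show "?I 0 (r2(20 := 0)) m2 (\<tau>2 + 2)"
        using 2(3) by (auto simp: segment_def intro!: exI[of _ "{}"])
    next
      fix j r3 m3 \<tau>3 assume "?I j r3 m3 \<tau>3"
      then show "r3 20 = j \<and> r3 15 = q" using r same_offD[of _ r r3] by auto
    next
      fix j r3 m3 \<tau>3 assume j: "j < q" and I: "?I j r3 m3 \<tau>3" and b: "bnd V r3 m3"
      then obtain F where F: "segment Y j \<kappa> F" "\<And>v. v < n \<Longrightarrow> m3 (f + v) = of_bool (v \<in> F)"
        "leaves n (Y - F) T m3" by blast
      have r3: "r3 0 = n" "r3 31 = T" "r3 30 + r3 17 * n = f" "r3 15 = q" "r3 14 = r 14" "r3 17 = r 17"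
        using I r same_offD[of _ r r3] by auto
      have finF: "finite F" using F(1) finY finite_subset unfolding segment_def by blast
      show "wp V pop_min (\<lambda>r m \<tau>. r 20 = j \<and> ?I (Suc j) (r(20 := Suc j)) m (\<tau> + 4)) r3 m3 (\<tau>3 + 4)"
      proof (rule wp_pop_min[where n = n and T = T and \<kappa> = \<kappa> and f = f and h = h and A = "Y - F"])
        show "m3 (r3 14 + r3 17 * n + v) = \<kappa> v" if "v < n" for v
          using keys[OF that] I same_offD[of ?S m m3 "r 14 + r 17 * n + v"] lay that r3 by auto
        show "Y - F \<noteq> {}"
        proof
          assume "Y - F = {}"
          then have "card Y \<le> card F" using finF by (intro card_mono) auto
          then show False using j Y(3) F(1) unfolding segment_def by simp
        qed
        fix r4 m4 \<tau>4 w
        assume 4: "same_off {19, 25, 26, 27} r3 r4" "same_off (insert (f + w) {T..<T + 2 * n}) m3 m4"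
          "w \<in> Y - F" "\<And>v. v \<in> Y - F \<Longrightarrow> \<kappa> w \<le> \<kappa> v" "m4 (f + w) = 1" "leaves n (Y - F - {w}) T m4"
          "\<And>i. 1 \<le> i \<Longrightarrow> i < n \<Longrightarrow> node_ok n \<kappa> T m4 i" "\<tau>4 \<le> \<tau>3 + 4 + 80 * h + 50"
        have w: "w < n" using 4(3) Y(2) by auto
        have "segment Y (Suc j) \<kappa> (insert w F)"
          using F(1) 4(3,4) finF unfolding segment_def by auto
        moreover have "m4 (f + v) = of_bool (v \<in> insert w F)" if "v < n" for v
        proof (cases "v = w")
          case False
          then have "m4 (f + v) = m3 (f + v)" using lay that by (intro same_offD[OF 4(2)]) auto
          then show ?thesis using F(2)[OF that] False by simp
        qed (use 4 in simp)
        moreover have "leaves n (Y - insert w F) T m4" using 4(6) by (simp only: Diff_insert[of Y w F])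
        moreover have "same_off {18, 19, 20, 25, 26, 27} r (r4(20 := Suc j))"
          using I 4(1) by (auto simp: same_off_def)
        moreover have "same_off ?S m m4"
          by (rule same_off_trans[OF _ 4(2)]) (use I w in auto)
        moreover have "r4 20 = j" using same_offD[OF 4(1), of 20] I by simp
        moreover have "\<tau>4 + 4 \<le> \<tau>2 + Suc j * (80 * h + 60) + 2" using I 4(8) by simp
        ultimately show "r4 20 = j \<and> ?I (Suc j) (r4(20 := Suc j)) m4 (\<tau>4 + 4)"
          using 4(7) by (auto simp del: of_bool_eq)
      qed (use r3 lay n Y F I in auto)
    next
      fix r3 m3 \<tau>3 assume I: "?I q r3 m3 \<tau>3"
      have "q * (80 * h + 60) \<le> n * (80 * h + 60)" using qn by (intro mult_le_mono1)
      then have "\<tau>3 + 4 \<le> \<tau> + (50 * n + 10) + (80 * n + 10) + n * (80 * h + 60) + 6"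
        using I 1(5) 2(4) by linarith
      also have "\<dots> \<le> \<tau> + 200 * n * (h + 1)"
      proof -
        have "1 \<le> h" using n by (cases h) auto
        then have "n \<le> n * h" by simp
        then have "26 \<le> 10 * n + 120 * (n * h)" using n(1) by linarith
        then show ?thesis by (simp add: algebra_simps)
      qed
      finally show "Q r3 m3 (\<tau>3 + 4)" using I by (elim conjE exE) (rule Q, auto)
    qed (use qn n in auto)
  qed (use r1 lay n in auto)
qed (use r lay n Y in auto)

text \<open>Flags are numerically 0 or 1, so the program counts by adding them and forms
  conjunctions by multiplying them.\<close>

definition flags :: "nat \<Rightarrow> nat set \<Rightarrow> nat \<Rightarrow> (nat \<Rightarrow> nat) \<Rightarrow> bool" where
  "flags p A n m \<longleftrightarrow> (\<forall>v<n. m (p + v) = of_bool (v \<in> A))"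

definition marks :: "nat \<Rightarrow> (nat \<times> nat) set \<Rightarrow> nat \<Rightarrow> (nat \<Rightarrow> nat) \<Rightarrow> bool" where
  "marks p S n m \<longleftrightarrow> (\<forall>u<n. \<forall>v<n. m (p + u * n + v) = of_bool ((u, v) \<in> S))"

definition keys :: "nat \<Rightarrow> (nat \<Rightarrow> nat \<Rightarrow> nat) \<Rightarrow> nat \<Rightarrow> (nat \<Rightarrow> nat) \<Rightarrow> bool" where
  "keys p \<kappa> n m \<longleftrightarrow> (\<forall>u<n. \<forall>v<n. m (p + u * n + v) = \<kappa> u v)"

section \<open>Row-major indices of square matrices\<close>

lemma index_less: "u < n \<Longrightarrow> v < n \<Longrightarrow> u * n + v < n * (n::nat)"
proof -
  assume a: "u < n" "v < n"
  then have "u * n + v < Suc u * n" by simp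
  also have "\<dots> \<le> n * n" using a by (intro mult_le_mono1) simp
  finally show ?thesis .
qed

lemma row_le: "u < n \<Longrightarrow> u * n + n \<le> n * (n::nat)"
  using mult_le_mono1[of "Suc u" n n] by simp

lemma row_less: "u < w \<Longrightarrow> u * n + n \<le> w * (n::nat)"
  using mult_le_mono1[of "Suc u" w n] by simp

lemma index_inj: "v < n \<Longrightarrow> v' < n \<Longrightarrow> u * n + v = u' * n + v' \<longleftrightarrow> u = u' \<and> v = (v'::nat)"
  by (metis add.commute div_mult_self3 div_less add_cancel_right_left add_left_cancel not_less0)

lemma flags_same: "flags p A n m \<Longrightarrow> same_off M m m' \<Longrightarrow> (\<And>v. v < n \<Longrightarrow> p + v \<notin> M) \<Longrightarrow> flags p A n m'"
  by (simp add: flags_def same_off_def)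

lemma marks_same:
  "marks p S n m \<Longrightarrow> same_off M m m' \<Longrightarrow> (\<And>i. i < n * n \<Longrightarrow> p + i \<notin> M) \<Longrightarrow> marks p S n m'"
  using index_less by (auto simp: marks_def same_off_def add.assoc)

lemma keys_same:
  "keys p \<kappa> n m \<Longrightarrow> same_off M m m' \<Longrightarrow> (\<And>i. i < n * n \<Longrightarrow> p + i \<notin> M) \<Longrightarrow> keys p \<kappa> n m'"
  using index_less by (auto simp: keys_def same_off_def add.assoc)

lemma marks_insert:
  assumes "marks p S n m" "u < n" "v < n"
  shows "marks p (insert (u, v) S) n (m(p + u * n + v := 1))"
  unfolding marks_def
proof (intro allI impI)
  fix u' v' assume a: "u' < n" "v' < n"
  have "p + u' * n + v' = p + u * n + v \<longleftrightarrow> u' = u \<and> v' = v"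
    using index_inj[OF a(2) assms(3), of u' u] by auto
  then show "(m(p + u * n + v := 1)) (p + u' * n + v') = of_bool ((u', v') \<in> insert (u, v) S)"
    using assms(1) a by (auto simp: marks_def)
qed

section \<open>The program\<close>

text \<open>Registers: 0, 1, 2 and 3 hold \<open>n\<close>, the first free address, \<open>n * n\<close> and \<open>d\<close>; 7 and 8 the
  number of frames on the stack and the address of the top frame; 9 to 12 the sizes and the addresses
  of \<open>X\<close> and \<open>Y\<close>; 13 and 14 the role and the address of its key matrix; 15 and 16 the sizes of \<open>F u\<close>
  and \<open>U\<close>; 21, 22 and 23 the vertices \<open>a\<close> and \<open>b\<close> and the key of their edge; 28 first \<open>k\<close>, then the
  address of the new frame; 29 to 33 the addresses of the memory regions. In role 0 the keys are the
  labels; role 1 stands for exchanged sources and targets, and its keys are decreasing in the labels.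
  Powers are computed only until they reach \<open>n\<close>, so that they fit into words. The diagonal of the key
  matrix holds whatever the unused cells of the encoding point to.\<close>

definition capped_power :: com where
  "capped_power = For 17 28 (Cond (Monus (Reg 0) (Reg 5)) (Assign 5 (Times (Reg 5) (Reg 3)))
     Skip)"

definition find_d :: com where
  "find_d = Seq (Seq (Assign 3 (Const 1)) (Assign 5 (Const 0)))
     (While (Monus (Reg 0) (Reg 5)) (Seq (Seq (Assign 3 (Plus (Reg 3) (Const 1))) (Assign 5 (Const 1)))
       capped_power))"

definition find_k_body :: com where
  "find_k_body = Seq (Assign 28 (Plus (Reg 28) (Const 1))) (Seq (Assign 4 (Times (Const 4) (Reg
     4))) (Assign 5 (Times (Reg 5) (Reg 4))))"

definition find_k :: com where
  "find_k = Seq (Seq (Assign 28 (Const 1)) (Seq (Assign 4 (Const 4)) (Assign 5 (Const 4))))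
     (While (Monus (Reg 0) (Reg 5)) find_k_body)"

definition select :: com where
  "select = For 17 0 (Cond (Mem (Plus (Reg 11) (Reg 17))) row Skip)"

definition tally :: com where
  "tally = For 17 0 (Assign 24 (Plus (Reg 24) (Times (Mem (Plus (Reg 11) (Reg 17))) (Mem (cell
     30 17 18)))))"

text \<open>Adding 1 before the truncated subtraction turns the strict comparison into
  \<open>s \<le>\<close> count. A later popular target overwrites an earlier one.\<close>

definition popular_cell :: com where
  "popular_cell = Cond (Mem (Plus (Reg 12) (Reg 18))) (Seq (Assign 24 (Const 0)) (Seq tally
     (Cond (Monus (Plus (Reg 24) (Const 1)) (Reg 16)) (Assign 21 (Reg 18)) Skip))) Skip"

definition popular :: com where
  "popular = For 18 0 popular_cell"

text \<open>One pass does three things: it deletes \<open>U\<close> from the top frame, which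
  thereby becomes \<open>(X - U, Y)\<close>; it writes \<open>U\<close> into the new frame above;
  and it keeps track of the latest edge to \<open>a\<close>. The guard on register 24 stops the
  choice after \<open>s\<close> sources.\<close>

definition split_body :: com where
  "split_body = Seq (Store (Plus (Reg 28) (Plus (Const 1) (Reg 17))) (Const 0))
     (Cond (Times (Mem (Plus (Reg 11) (Reg 17))) (Mem (cell 30 17 21)))
       (Cond (Monus (Reg 16) (Reg 24))
         (Seq (Store (Plus (Reg 28) (Plus (Const 1) (Reg 17))) (Const 1))
         (Seq (Store (Plus (Reg 11) (Reg 17)) (Const 0))
         (Seq (Store (cell 29 17 21) (Const 1))
         (Seq (Assign 24 (Plus (Reg 24) (Const 1)))
         (Cond (Monus (Reg 23) (key 17 21)) Skip
           (Seq (Assign 22 (Reg 17)) (Assign 23 (key 17 21)))))))) Skip) Skip)"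

definition split :: com where
  "split = Seq (Seq (Assign 28 (Plus (Reg 8) (Plus (Const 1) (Times (Const 2) (Reg 0)))))
     (Seq (Store (Reg 28) (Reg 13)) (Seq (Assign 24 (Const 0)) (Assign 23 (Const 0)))))
     (For 17 0 split_body)"

definition spread_cell :: com where
  "spread_cell = Seq (Cond (Mem (Plus (Reg 12) (Reg 18))) (Store (cell 29 22 18) (Const 1))
     Skip) (Store (Plus (Reg 28) (Plus (Const 1) (Plus (Reg 0) (Reg 18)))) (Times (Mem (Plus (Reg
     12) (Reg 18))) (Mem (cell 30 22 18))))"

definition spread :: com where
  "spread = For 18 0 spread_cell"

definition step :: com where
  "step = Seq (Seq (Assign 15 (Div (Monus (Plus (Reg 10) (Reg 3)) (Const 1)) (Reg 3)))
       (Assign 16 (Div (Monus (Plus (Reg 9) (Reg 3)) (Const 1)) (Reg 3))))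
    (Seq select (Seq popular (Seq split (Seq spread (Assign 7 (Plus (Reg 7) (Const 1)))))))"

definition base_cell :: com where
  "base_cell = Cond (Mem (Plus (Reg 12) (Reg 18))) (Store (cell 29 17 18) (Const 1)) Skip"

definition base :: com where
  "base = Seq (For 17 0 (Cond (Mem (Plus (Reg 11) (Reg 17)))
       (For 18 0 base_cell) Skip))
     (Assign 7 (Monus (Reg 7) (Const 1)))"

definition count_cell :: com where
  "count_cell = Seq (Assign 9 (Plus (Reg 9) (Mem (Plus (Reg 8) (Plus (Const 1) (Reg 17))))))
     (Assign 10 (Plus (Reg 10) (Mem (Plus (Reg 8) (Plus (Const 1) (Plus (Reg 0) (Reg 17)))))))"

text \<open>Exchanging sources and targets moves no data: addresses and sizes are swapped in
  registers, the role is flipped, and with it the key matrix in use.\<close>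

definition orient :: com where
  "orient = Seq (Cond (Monus (Reg 10) (Reg 9)) (Seq (Assign 13 (Monus (Const 1) (Mem (Reg 8))))
     (Seq (Assign 11 (Plus (Reg 8) (Plus (Const 1) (Reg 0)))) (Seq (Assign 12 (Plus (Reg 8)
     (Const 1))) (Seq (Assign 27 (Reg 9)) (Seq (Assign 9 (Reg 10)) (Assign 10 (Reg 27))))))) (Seq
     (Assign 13 (Mem (Reg 8))) (Seq (Assign 11 (Plus (Reg 8) (Const 1))) (Assign 12 (Plus (Reg 8)
     (Plus (Const 1) (Reg 0))))))) (Assign 14 (Plus (Reg 1) (Times (Reg 13) (Reg 2))))"

definition prepare :: com where
  "prepare = Seq (Seq (Assign 8 (Plus (Reg 33) (Times (Monus (Reg 7) (Const 1)) (Plus (Const 1) (Times (Const 2) (Reg 0))))))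
       (Seq (Assign 9 (Const 0)) (Assign 10 (Const 0))))
    (Seq (For 17 0 count_cell)
    orient)"

definition body :: com where
  "body = Seq prepare (Cond (Monus (Reg 9) (Reg 3)) step base)"

definition main_loop :: com where
  "main_loop = While (Reg 7) body"

text \<open>The arrays stored for \<open>(u, v)\<close> and \<open>(v, u)\<close> list the same
  labels but possibly in different orders. Both entries are therefore read from the array of the
  pair with the smaller vertex first, which makes the keys symmetric. Register 6 collects the
  maximum of the matrix.\<close>

definition load_cell :: com where
  "load_cell = Seq (Cond (Monus (Reg 18) (Reg 17))
       (Assign 27 (Mem (Mem (Plus (Const 2) (Times (Const 2) (Plus (Times (Reg 17) (Reg 0)) (Reg 18)))))))
       (Assign 27 (Mem (Mem (Plus (Const 2) (Times (Const 2) (Plus (Times (Reg 18) (Reg 0)) (Reg 17))))))))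
     (Seq (Store (cell 1 17 18) (Reg 27)) (Cond (Monus (Reg 27) (Reg 6)) (Assign 6 (Reg 27)) Skip))"

definition load :: com where
  "load = Seq (Assign 6 (Const 0)) (For 17 0 (For 18 0 load_cell))"

text \<open>Subtracting from the maximum of all entries never truncates, so the order of the keys is
  reversed faithfully.\<close>

definition reverse :: com where
  "reverse = For 17 2 (Store (Plus (Plus (Reg 1) (Reg 2)) (Reg 17)) (Monus (Reg 6) (Mem (Plus
     (Reg 1) (Reg 17)))))"

definition frame_cell :: com where
  "frame_cell = Seq (Store (Plus (Reg 33) (Plus (Const 1) (Reg 17))) (Const 1)) (Store (Plus
     (Reg 33) (Plus (Const 1) (Plus (Reg 0) (Reg 17)))) (Const 1))"

definition first_frame :: com where
  "first_frame = Seq (Seq (Store (Reg 33) (Const 0)) (Assign 7 (Const 1)))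
     (For 17 0 frame_cell)"

text \<open>Both orientations are consulted because marks are ordered pairs; the inner loop of
  \<open>emit\<close> stops below the diagonal, so an edge is listed only once.\<close>

definition emit_cell :: com where
  "emit_cell = Cond (Plus (Mem (cell 29 17 18)) (Mem (cell 29 18 17)))
     (Seq (Store (Plus (Reg 32) (Times (Const 3) (Reg 24))) (Reg 17))
     (Seq (Store (Plus (Plus (Reg 32) (Times (Const 3) (Reg 24))) (Const 1)) (Reg 18))
     (Seq (Store (Plus (Plus (Reg 32) (Times (Const 3) (Reg 24))) (Const 2)) (Mem (cell 1 17 18)))
       (Assign 24 (Plus (Reg 24) (Const 1)))))) Skip"

definition emit :: com where
  "emit = Seq (Assign 24 (Const 0)) (Seq (For 17 0 (For 18 17 emit_cell))
     (Seq (Store (Const 0) (Reg 32)) (Store (Const 1) (Reg 24))))"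

definition set_regs :: com where
  "set_regs = Seq (Assign 0 (Mem (Const 0))) (Seq (Assign 1 (Mem (Const 1)))
     (Seq (Assign 2 (Times (Reg 0) (Reg 0)))
     (Seq (Assign 29 (Plus (Reg 1) (Times (Const 2) (Reg 2))))
     (Seq (Assign 30 (Plus (Reg 1) (Times (Const 3) (Reg 2))))
     (Seq (Assign 31 (Plus (Reg 1) (Times (Const 4) (Reg 2))))
     (Seq (Assign 32 (Plus (Reg 1) (Times (Const 5) (Reg 2))))
       (Assign 33 (Plus (Reg 1) (Times (Const 8) (Reg 2))))))))))"

definition program :: com where
  "program = Seq set_regs (Seq find_k (Seq find_d (Seq load (Seq reverse
     (Seq first_frame (Seq main_loop emit))))))"

section \<open>One step of the recursion\<close>

text \<open>From \<open>\<beta>\<close> on, the memory contains the two key matrices, the marked pairs (at \<open>pO\<close>), the flags of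
  the sets \<open>F u\<close> (at \<open>pF\<close>), the tournament tree (at \<open>pT\<close>), the output (at \<open>pOut\<close>) and the stack (at \<open>pS\<close>).\<close>

locale layout =
  fixes n \<beta> d h V :: nat
  assumes n: "2 \<le> n" and V: "2 * n \<le> V" and h: "2 * n \<le> 2 ^ h"
begin

abbreviation "pO \<equiv> \<beta> + 2 * (n * n)"
abbreviation "pF \<equiv> \<beta> + 3 * (n * n)"
abbreviation "pT \<equiv> \<beta> + 4 * (n * n)"
abbreviation "pOut \<equiv> \<beta> + 5 * (n * n)"
abbreviation "pS \<equiv> \<beta> + 8 * (n * n)"

definition regs :: "(nat \<Rightarrow> nat) \<Rightarrow> bool" where
  "regs r \<longleftrightarrow> r 0 = n \<and> r 1 = \<beta> \<and> r 2 = n * n \<and> r 3 = d \<and> r 29 = pO \<and> r 30 = pF \<and> r 31 = pT \<and>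
     r 32 = pOut \<and> r 33 = pS"

lemma regs_same: "regs r \<Longrightarrow> same_off M r r' \<Longrightarrow> M \<inter> {0, 1, 2, 3, 29, 30, 31, 32, 33} = {} \<Longrightarrow> regs r'"
  unfolding regs_def by (auto simp: same_off_def)

lemma nV: "n < V"
  using n V by simp

lemma nn: "2 * n \<le> n * n"
  using n by simp

lemma tree_region: "{pT..<pT + 2 * n} \<subseteq> {pT..<pOut}"
proof -
  have "pT + 2 * n \<le> pOut" using nn by linarith
  then show ?thesis by (meson atLeastLessThan_iff le_trans less_le_trans subsetI)
qed

lemma row_region: "u < n \<Longrightarrow> {pF + u * n..<pF + u * n + n} \<subseteq> {pF..<pT}"
  using row_le[of u n] by (auto simp: algebra_simps)

lemma card_inter_Suc:
  "finite X \<Longrightarrow> card (X \<inter> {..<Suc j}) = card (X \<inter> {..<j}) + of_bool (j \<in> X)"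
  by (auto simp: lessThan_Suc)

text \<open>The expensive row computation is charged per element of \<open>X\<close>, not per
  vertex; only such a bound can be paid by the drop of the potential.\<close>

lemma wp_select:
  assumes r: "regs r" "r 12 = py" "r 15 = q" "r 11 = px" "r 14 = pK"
    and K: "keys pK \<kappa> n m" "pK + n * n \<le> pO"
    and X: "flags px X n m" "X \<subseteq> {..<n}" "pS \<le> px"
    and Y: "flags py Y n m" "Y \<subseteq> {..<n}" "pS \<le> py" "q \<le> card Y"
    and Q: "\<And>r' m' \<tau>' F. same_off {17, 18, 19, 20, 25, 26, 27} r r' \<Longrightarrow>
      same_off ({pF..<pT} \<union> {pT..<pOut}) m m' \<Longrightarrow>
      (\<And>u. u \<in> X \<Longrightarrow> segment Y q (\<kappa> u) (F u) \<and> flags (pF + u * n) (F u) n m') \<Longrightarrow>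
      \<tau>' \<le> \<tau> + card X * (200 * n * (h + 1)) + 20 * n + 10 \<Longrightarrow> Q r' m' \<tau>'"
  shows "wp V select Q r m \<tau>"
proof -
  let ?I = "\<lambda>j r' m' \<tau>'. r' 17 = j \<and> same_off {17, 18, 19, 20, 25, 26, 27} r r' \<and>
    same_off ({pF..<pT} \<union> {pT..<pOut}) m m' \<and>
    (\<forall>u\<in>X. u < j \<longrightarrow> (\<exists>F. segment Y q (\<kappa> u) F \<and>
    flags (pF + u * n) F n m')) \<and>
    \<tau>' \<le> \<tau> + card (X \<inter> {..<j}) * (200 * n * (h + 1)) + 20 * j + 2"
  show ?thesis
    unfolding select_def
  proof (rule wp_for[where N = n and I = ?I])
    let ?S = "{pF..<pT} \<union> {pT..<pOut}"
    have finX: "finite X" using X(2) finite_subset by blast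
    fix j r1 m1 \<tau>1
    assume j: "j < n" and I: "?I j r1 m1 \<tau>1"
      and b: "bnd V r1 m1"
    have r1: "regs r1"
      by (rule regs_same[OF r(1), where M = "{17, 18, 19, 20, 25, 26, 27}"]) (use I in simp_all)
    have r1': "r1 12 = py" "r1 15 = q" "r1 11 = px" "r1 14 = pK" using I r same_offD[of _ r r1] by auto
    have so: "same_off ?S m m1" using I by simp
    have fX: "flags px X n m1" by (rule flags_same[OF X(1) so]) (use X in auto)
    have fY: "flags py Y n m1" by (rule flags_same[OF Y(1) so]) (use Y in auto)
    have kK: "keys pK \<kappa> n m1" by (rule keys_same[OF K(1) so]) (use K in auto)
    let ?Q = "\<lambda>r' m' \<tau>'. r' 17 = j \<and> ?I (Suc j) (r'(17 := Suc j)) m' (\<tau>' + 4)"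
    have "wp V (Cond (Mem (Plus (Reg 11) (Reg 17))) row Skip) ?Q r1 m1 (\<tau>1 + 4)"
    proof (rule wp_cond)
      assume "val (Mem (Plus (Reg 11) (Reg 17))) (r1, m1) \<noteq> 0"
      then have jX: "j \<in> X" using fX j I r1' unfolding flags_def by auto
      show "wp V row ?Q r1 m1 (\<tau>1 + 4 + 1 + cost (Mem (Plus (Reg 11) (Reg 17))))"
      proof (rule wp_row[where n = n and T = pT and f = "pF + j * n" and \<kappa> = "\<kappa> j" and h = h and q = q and py = py and Y = Y])
        show "m1 (r1 14 + r1 17 * n + v) = \<kappa> j v" if "v < n" for v
          using kK that j I r1' unfolding keys_def by auto
        show "r1 14 + r1 17 * n + n \<le> pF + j * n" "pF + j * n + n \<le> pT" "pT + 2 * n \<le> py"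
          using K(2) row_le[OF j] nn Y(3) I r1' by auto
        show "m1 (py + v) = of_bool (v \<in> Y)" if "v < n" for v
          using fY that unfolding flags_def by auto
        fix r2 m2 \<tau>2 F
        assume 2: "same_off {18, 19, 20, 25, 26, 27} r1 r2"
          "same_off ({pF + j * n..<pF + j * n + n} \<union> {pT..<pT + 2 * n}) m1 m2" "segment Y q (\<kappa> j) F"
          "\<And>v. v < n \<Longrightarrow> m2 (pF + j * n + v) = of_bool (v \<in> F)"
          "\<tau>2 \<le> \<tau>1 + 4 + 1 + cost (Mem (Plus (Reg 11) (Reg 17))) + 200 * n * (h + 1)"
        have "\<exists>F. segment Y q (\<kappa> u) F \<and> flags (pF + u * n) F n m2" if u: "u \<in> X" "u < Suc j" for u
        proof (cases "u = j")
          case True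
          then show ?thesis using 2(3,4) by (auto simp: flags_def)
        next
          case False
          then have uj: "u < j" using u by simp
          then obtain F' where F': "segment Y q (\<kappa> u) F'" "flags (pF + u * n) F' n m1" using I u by blast
          have "flags (pF + u * n) F' n m2"
            by (rule flags_same[OF F'(2) 2(2)]) (use row_less[OF uj, of n] row_le[of u n] uj j in auto)
          then show ?thesis using F' by blast
        qed
        moreover have "same_off ?S m m2"
          by (rule same_off_trans[OF so 2(2)]) (use row_region[OF j] tree_region in blast)+
        moreover have "same_off {17, 18, 19, 20, 25, 26, 27} r (r2(17 := Suc j))"
          using I 2(1) by (auto simp: same_off_def)
        moreover have "r2 17 = j" using same_offD[OF 2(1), of 17] I by simp
        moreover have "\<tau>2 + 4 \<le> \<tau> + card (X \<inter> {..<Suc j}) * (200 * n * (h + 1)) + 20 * Suc j + 2"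
          using I 2(5) jX card_inter_Suc[OF finX, of j] by (simp add: distrib_right)
        ultimately show "?Q r2 m2 \<tau>2" by auto
      qed (use r1 r1' I Y n V h in \<open>auto simp: regs_def\<close>)
    next
      assume "val (Mem (Plus (Reg 11) (Reg 17))) (r1, m1) = 0"
      then have "j \<notin> X" using fX j I r1' unfolding flags_def by auto
      then show "wp V Skip ?Q r1 m1 (\<tau>1 + 4 + 1 + cost (Mem (Plus (Reg 11) (Reg 17))))"
        using I card_inter_Suc[OF finX, of j] by (intro wp_skip) (auto simp: less_Suc_eq intro!: same_off_upd)
    qed (simp add: simple_def)
    then show "wp V (Cond (Mem (Plus (Reg 11) (Reg 17))) row Skip) ?Q r1 m1 (\<tau>1 + 4)" .
  next
    fix r1 m1 \<tau>1
    assume I: "?I n r1 m1 \<tau>1"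
    have "\<forall>u\<in>X. \<exists>F. segment Y q (\<kappa> u) F \<and> flags (pF + u * n) F n m1" using I X(2) by blast
    then obtain F where "\<And>u. u \<in> X \<Longrightarrow> segment Y q (\<kappa> u) (F u) \<and> flags (pF + u * n) (F u) n m1" by metis
    moreover have "X \<inter> {..<n} = X" using X(2) by blast
    ultimately show "Q r1 m1 (\<tau>1 + 4)" using I by (intro Q[where F = F]) auto
  qed (use r nV in \<open>auto simp: same_off_def regs_def\<close>)
qed

text \<open>Register 21 is not initialised, so the invariant speaks about it only if a popular
  target has been met. Hypothesis \<open>ex\<close> ensures that this has happened by the
  end.\<close>

lemma wp_popular:
  assumes r: "regs r" "r 12 = py" "r 16 = s" "r 11 = px"
    and X: "flags px X n m" "X \<subseteq> {..<n}" and Y: "flags py Y n m" "Y \<subseteq> {..<n}"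
    and F: "\<And>u. u \<in> X \<Longrightarrow> flags (pF + u * n) (F u) n m"
    and ex: "\<exists>a\<in>Y. s \<le> card {u\<in>X. a \<in> F u}"
    and Q: "\<And>r' \<tau>'. same_off {17, 18, 21, 24} r r' \<Longrightarrow> r' 21 \<in> Y \<Longrightarrow>
      s \<le> card {u\<in>X. r' 21 \<in> F u} \<Longrightarrow> \<tau>' \<le> \<tau> + card Y * (40 * n + 50) + 20 * n + 10 \<Longrightarrow> Q r' m \<tau>'"
  shows "wp V popular Q r m \<tau>"
proof -
  let ?I = "\<lambda>j r' m' \<tau>'. r' 18 = j \<and> m' = m \<and> same_off {17, 18, 21, 24} r r' \<and>
    ((\<exists>a\<in>Y. a < j \<and> s \<le> card {u\<in>X. a \<in> F u}) \<longrightarrow> r' 21 \<in> Y \<and>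
    s \<le> card {u\<in>X. r' 21 \<in> F u}) \<and>
    \<tau>' \<le> \<tau> + card (Y \<inter> {..<j}) * (40 * n + 50) + 20 * j + 2"
  show ?thesis
    unfolding popular_def
  proof (rule wp_for[where N = n and I = ?I])
    have finY: "finite Y" using Y(2) finite_subset by blast
    fix j r1 m1 \<tau>1
    assume j: "j < n" and I: "?I j r1 m1 \<tau>1"
    have m1: "m1 = m" using I by simp
    have r1: "regs r1"
      by (rule regs_same[OF r(1), where M = "{17, 18, 21, 24}"]) (use I in simp_all)
    have r1': "r1 12 = py" "r1 16 = s" "r1 11 = px" "r1 18 = j" "r1 0 = n" "r1 30 = pF"
      using I r r1 same_offD[of _ r r1] by (auto simp: regs_def)
    let ?c = "\<lambda>i. \<Sum>u<i. of_bool (u \<in> X \<and> j \<in> F u) :: nat"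
    have cn: "?c n = card {u\<in>X. j \<in> F u}"
    proof -
      have "{u\<in>X. j \<in> F u} = {..<n} \<inter> {u. u \<in> X \<and> j \<in> F u}" using X(2) by blast
      then show ?thesis by simp
    qed
    have ci: "?c i \<le> i" for i
      using sum_bounded_above[of "{..<i}" "\<lambda>u. of_bool (u \<in> X \<and> j \<in> F u) :: nat" 1] by simp
    have fl: "m (px + i) * m (pF + i * n + j) = of_bool (i \<in> X \<and> j \<in> F i)" if "i < n" for i
      using X(1) F[of i] that j by (auto simp: flags_def)
    let ?Q = "\<lambda>r' m' \<tau>'. r' 18 = j \<and> ?I (Suc j) (r'(18 := Suc j)) m' (\<tau>' + 4)"
    show "wp V popular_cell
      ?Q r1 m1 (\<tau>1 + 4)"
    unfolding popular_cell_def
    proof (rule wp_cond)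
      assume "val (Mem (Plus (Reg 12) (Reg 18))) (r1, m1) \<noteq> 0"
      then have jY: "j \<in> Y" using Y(1) j r1' m1 unfolding flags_def by auto
      let ?J = "\<lambda>i r' m' \<tau>'. r' 17 = i \<and> m' = m \<and> same_off {17, 24} r1 r' \<and> r' 24 = ?c i \<and>
        \<tau>' \<le> \<tau>1 + 20 + 30 * i"
      have "wp V (Seq tally
         (Cond (Monus (Plus (Reg 24) (Const 1)) (Reg 16)) (Assign 21 (Reg 18)) Skip)) ?Q
         (r1(24 := 0)) m \<tau>2" if t2: "\<tau>2 \<le> \<tau>1 + 18" for \<tau>2
      unfolding tally_def
      proof (rule wp_seq, rule wp_for[where N = n and I = ?J])
        show "?J 0 (r1(24 := 0, 17 := 0)) m (\<tau>2 + 2)" using t2 by (auto simp: same_off_def)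
      next
        fix i r2 m2 \<tau>2 assume i: "i < n" and J: "?J i r2 m2 \<tau>2"
        have r2: "r2 11 = px" "r2 18 = j" "r2 0 = n" "r2 30 = pF" "m2 = m"
          using J r1' same_offD[of _ r1 r2] by auto
        have "?c (Suc i) \<le> V" using ci[of "Suc i"] i nV by linarith
        then show "wp V (Assign 24 (Plus (Reg 24) (Times (Mem (Plus (Reg 11) (Reg 17))) (Mem (cell 30 17 18)))))
            (\<lambda>r' m' \<tau>'. r' 17 = i \<and> ?J (Suc i) (r'(17 := Suc i)) m' (\<tau>' + 4)) r2 m2 (\<tau>2 + 4)"
          using J r2 fl[OF i] by (intro wp_pre) (auto simp: simple_def cell_def same_off_def)
      next
        fix r2 m2 \<tau>2 assume J: "?J n r2 m2 \<tau>2" and b2: "bnd V r2 m2"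
        have r2: "r2 16 = s" "r2 18 = j" "m2 = m" "r2 24 = card {u\<in>X. j \<in> F u}" "r2 21 = r1 21"
          using J r1' cn same_offD[of _ r1 r2] by auto
        have so: "same_off {17, 18, 21, 24} r r2" using I J by (auto simp: same_off_def)
        have t: "\<tau>2 + 20 \<le> \<tau> + card (Y \<inter> {..<Suc j}) * (40 * n + 50) + 20 * Suc j"
          using I J jY card_inter_Suc[OF finY, of j] n by (simp add: distrib_right)
        show "wp V (Cond (Monus (Plus (Reg 24) (Const 1)) (Reg 16)) (Assign 21 (Reg 18)) Skip) ?Q r2 m2 (\<tau>2 + 4)"
        proof (cases "s \<le> card {u\<in>X. j \<in> F u}")
          case True
          then show ?thesis using r2 so jY t j nV
            by (intro wp_pre) (auto simp: simple_def same_off_def)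
        next
          case False
          then show ?thesis using r2 so jY t I
            by (intro wp_pre) (auto simp: simple_def same_off_def less_Suc_eq)
        qed
      next
        fix i r2 m2 \<tau>2 assume J: "?J i r2 m2 \<tau>2"
        then show "r2 17 = i \<and> r2 0 = n" using r1' same_offD[of _ r1 r2] by auto
      qed (use nV in auto)
      then show "wp V (Seq (Assign 24 (Const 0)) (Seq tally
         (Cond (Monus (Plus (Reg 24) (Const 1)) (Reg 16)) (Assign 21 (Reg 18)) Skip))) ?Q r1 m1
         (\<tau>1 + 4 + 1 + cost (Mem (Plus (Reg 12) (Reg 18))))"
        using m1 by (intro wp_seq_pre) (simp add: simple_def)
    next
      assume "val (Mem (Plus (Reg 12) (Reg 18))) (r1, m1) = 0"
      then have "j \<notin> Y" using Y(1) j r1' m1 unfolding flags_def by auto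
      then show "wp V Skip ?Q r1 m1 (\<tau>1 + 4 + 1 + cost (Mem (Plus (Reg 12) (Reg 18))))"
        using I card_inter_Suc[OF finY, of j] by (intro wp_skip) (auto simp: less_Suc_eq intro!: same_off_upd)
    qed (simp add: simple_def)
  next
    fix r1 m1 \<tau>1
    assume I: "?I n r1 m1 \<tau>1"
    moreover have "Y \<inter> {..<n} = Y" using Y(2) by blast
    moreover have "\<exists>a\<in>Y. a < n \<and> s \<le> card {u\<in>X. a \<in> F u}" using ex Y(2) by auto
    ultimately have "same_off {17, 18, 21, 24} r r1" "r1 21 \<in> Y" "s \<le> card {u\<in>X. r1 21 \<in> F u}"
      "\<tau>1 + 4 \<le> \<tau> + card Y * (40 * n + 50) + 20 * n + 10" "m1 = m" by auto
    then show "Q r1 m1 (\<tau>1 + 4)" using Q by simp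
  qed (use r nV in \<open>auto simp: same_off_def regs_def\<close>)
qed

end

context layout
begin

text \<open>Selection is greedy: either \<open>U\<close> is full, or it contains every candidate
  below \<open>j\<close>. The initial value 0 of register 23 makes the first comparison succeed, so
  register 22 is set as soon as \<open>U\<close> is nonempty.\<close>

definition split_inv :: "nat \<Rightarrow> nat \<Rightarrow> nat \<Rightarrow> nat \<Rightarrow> (nat \<Rightarrow> nat \<Rightarrow> nat) \<Rightarrow> nat set \<Rightarrow> (nat \<Rightarrow> nat set) \<Rightarrow>
    (nat \<times> nat) set \<Rightarrow> nat \<Rightarrow> nat set \<Rightarrow> (nat \<Rightarrow> nat) \<Rightarrow> (nat \<Rightarrow> nat) \<Rightarrow> bool" where
  "split_inv px Q a s \<kappa> X F S j U r' m' \<longleftrightarrow>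
     U \<subseteq> {u\<in>X. u < j \<and> a \<in> F u} \<and> card U \<le> s \<and> r' 24 = card U \<and>
     (card U = s \<or> U = {u\<in>X. u < j \<and> a \<in> F u}) \<and>
     (\<forall>u\<in>U. \<kappa> u a \<le> r' 23) \<and> (U \<noteq> {} \<longrightarrow> r' 22 \<in> U \<and> \<kappa> (r' 22) a = r' 23) \<and>
     (U = {} \<longrightarrow> r' 23 = 0) \<and>
     flags px (X - U) n m' \<and> (\<forall>v<j. m' (Q + (1 + v)) = of_bool (v \<in> U)) \<and>
     marks pO (S \<union> U \<times> {a}) n m'"

lemma wp_split_body:
  assumes r: "regs r" "r 11 = px" "r 14 = pK" "r 16 = s" "r 17 = j" "r 21 = a" "r 28 = Q"
    and K: "\<kappa> j a = m (pK + j * n + a)"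
    and j: "j < n" "a < n" "finite X"
    and lay: "pS \<le> px" "px + n \<le> Q" "pK + n * n \<le> pO"
    and F: "j \<in> X \<Longrightarrow> flags (pF + j * n) (F j) n m"
    and I: "split_inv px Q a s \<kappa> X F S j U r m"
    and T: "\<And>r' m' \<tau>' U'. same_off {22, 23, 24} r r' \<Longrightarrow>
      same_off ({px..<px + n} \<union> {pO..<pF} \<union> {Q + 1..<Q + (1 + n)}) m m' \<Longrightarrow>
      split_inv px Q a s \<kappa> X F S (Suc j) U' r' m' \<Longrightarrow> \<tau>' \<le> \<tau> + 90 \<Longrightarrow> R r' m' \<tau>'"
  shows "wp V split_body R r m \<tau>"
proof -
  let ?S = "{px..<px + n} \<union> {pO..<pF} \<union> {Q + 1..<Q + (1 + n)}"
  have r': "r 0 = n" "r 29 = pO" "r 30 = pF" using r(1) by (auto simp: regs_def)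
  have jU: "j \<notin> U" using I unfolding split_inv_def by auto
  have finU: "finite U" using I j(3) finite_subset[of U X] unfolding split_inv_def by auto
  have ji: "j * n + a < n * n" using index_less[OF j(1,2)] .
  have Iu: "flags px (X - U) n m" "marks pO (S \<union> U \<times> {a}) n m"
    "\<And>v. v < j \<Longrightarrow> m (Q + (1 + v)) = of_bool (v \<in> U)" using I unfolding split_inv_def by auto
  have pxj: "m (px + j) = of_bool (j \<in> X)" using Iu(1) j jU by (auto simp: flags_def)
  let ?m1 = "m(Q + (1 + j) := 0)"
  have so1: "same_off ?S m ?m1" using j by (intro same_off_upd) auto
  have skip: "split_inv px Q a s \<kappa> X F S (Suc j) U r ?m1"
    if "card U = s \<or> \<not> (j \<in> X \<and> a \<in> F j)"
  proof -
    have "flags px (X - U) n ?m1" using Iu(1) lay j by (auto simp: flags_def)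
    moreover have "marks pO (S \<union> U \<times> {a}) n ?m1"
      by (rule marks_same[OF Iu(2), of "{Q + (1 + j)}"]) (use lay in \<open>auto simp: same_off_def\<close>)
    moreover have "?m1 (Q + (1 + v)) = of_bool (v \<in> U)" if "v < Suc j" for v
      using Iu(3) that jU by (cases "v = j") auto
    ultimately show ?thesis using I that unfolding split_inv_def by (auto simp: less_Suc_eq)
  qed
  let ?m2 = "?m1(Q + (1 + j) := 1, px + j := 0, pO + j * n + a := 1)"
  have so2: "same_off ?S m ?m2" using j ji so1 by (intro same_off_upd) auto
  have ins: "split_inv px Q a s \<kappa> X F S (Suc j) (insert j U) r2 ?m2"
    if c: "card U < s" "j \<in> X" "a \<in> F j" and r2: "r2 24 = card U + 1"
      "(r 23 \<le> \<kappa> j a \<and> r2 22 = j \<and> r2 23 = \<kappa> j a) \<or> (\<kappa> j a < r 23 \<and> r2 22 = r 22 \<and> r2 23 = r 23)" for r2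
  proof -
    have "flags px (X - insert j U) n ?m2" using Iu(1) lay j ji by (auto simp: flags_def)
    moreover have "marks pO (insert (j, a) (S \<union> U \<times> {a})) n ?m2"
    proof (rule marks_insert[OF _ j(1,2)])
      show "marks pO (S \<union> U \<times> {a}) n (?m1(Q + (1 + j) := 1, px + j := 0))"
        by (rule marks_same[OF Iu(2), of "{Q + (1 + j), px + j}"]) (use lay in \<open>auto simp: same_off_def\<close>)
    qed
    moreover have "insert (j, a) (S \<union> U \<times> {a}) = S \<union> insert j U \<times> {a}" by auto
    moreover have "?m2 (Q + (1 + v)) = of_bool (v \<in> insert j U)" if "v < Suc j" for v
      using Iu(3) that lay j ji by (cases "v = j") auto
    moreover have "card (insert j U) = card U + 1" using finU jU by simp
    moreover have "U = {u\<in>X. u < j \<and> a \<in> F u}" using I c unfolding split_inv_def by auto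
    then have "insert j U = {u\<in>X. u < Suc j \<and> a \<in> F u}" using c by auto
    moreover have "\<kappa> u a \<le> r2 23" if "u \<in> insert j U" for u
      using I that r2(2) unfolding split_inv_def by (auto intro: order_trans)
    moreover have "r2 22 \<in> insert j U \<and> \<kappa> (r2 22) a = r2 23"
      using I r2(2) unfolding split_inv_def by auto
    moreover have "\<exists>x<Suc j. x \<in> X \<and> a \<in> F x" using c by auto
    ultimately show ?thesis using c r2(1) unfolding split_inv_def by simp blast
  qed
  show ?thesis
  proof (rule wp_pre)
    assume b: "bnd V r m"
    have V1: "1 \<le> V" "card U + 1 \<le> V" if "card U < s"
      using that bndD(2)[OF b, of 16] bndD(1)[OF b] r by auto
    show "pre V split_body R r m \<tau>"
    proof (cases "card U < s \<and> j \<in> X \<and> a \<in> F j")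
      case False
      have r24: "r 24 = card U" "card U \<le> s" using I unfolding split_inv_def by auto
      have skipR: "R r ?m1 \<tau>'" if "\<tau>' \<le> \<tau> + 90" for \<tau>'
        by (rule T[OF _ so1 skip that]) (use False r24 in auto)
      then show ?thesis
      proof (cases "j \<in> X")
        case True
        have "?m1 (px + j) = 1" "?m1 (pF + j * n + a) = of_bool (a \<in> F j)"
          using True pxj F[OF True] j lay ji by (auto simp: flags_def)
        moreover have "a \<in> F j \<Longrightarrow> s - card U = 0" using False True by auto
        ultimately show ?thesis using r r' r24 skipR bndD(1)[OF b]
          by (cases "a \<in> F j") (simp_all add: split_body_def simple_def cell_def key_def del: fun_upd_apply)
      next
        case jX: False
        have "?m1 (px + j) = 0" using jX pxj j lay ji by auto
        then show ?thesis using r r' r24 skipR bndD(1)[OF b]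
          by (simp add: split_body_def simple_def cell_def key_def del: fun_upd_apply)
      qed
    next
      case True
      then have rd1: "?m1 (px + j) = 1" "?m1 (pF + j * n + a) = 1"
        using pxj F j lay ji by (auto simp: flags_def)
      from True have t: "card U < s" "j \<in> X" "a \<in> F j" by auto
      have r24: "r 24 = card U" using I unfolding split_inv_def by auto
      have km: "?m2 (pK + j * n + a) = \<kappa> j a" using K lay ji by simp
      have e1: "R (r(24 := card U + 1)) ?m2 \<tau>'" if "\<tau>' \<le> \<tau> + 90" "\<kappa> j a < r 23" for \<tau>'
        by (rule T[OF _ so2 ins[OF t] that(1)]) (use that in \<open>auto simp: same_off_def\<close>)
      have e2: "R (r(24 := card U + 1, 22 := j, 23 := \<kappa> j a)) ?m2 \<tau>'"
        if "\<tau>' \<le> \<tau> + 90" "r 23 \<le> \<kappa> j a" for \<tau>'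
        by (rule T[OF _ so2 ins[OF t] that(1)]) (use that in \<open>auto simp: same_off_def\<close>)
      have k8: "\<kappa> j a \<le> V" using bndD(3)[OF b, of "pK + j * n + a"] K by simp
      have jV: "j \<le> V" using j nV by simp
      show ?thesis using t r r' r24 rd1 V1[OF t(1)] km e1 e2 k8 jV
        by (simp add: split_body_def simple_def cell_def key_def fun_upd_same fun_upd_other not_less del: fun_upd_apply)
    qed
  qed
qed

lemma wp_split:
  assumes r: "regs r" "r 11 = px" "r 14 = pK" "r 16 = s" "r 21 = a" "r 8 = P" "P + (1 + 2 * n) = Q"
    and bound: "Q \<le> V"
    and K: "keys pK \<kappa> n m"
    and X: "flags px X n m" "X \<subseteq> {..<n}" "a < n" "1 \<le> s" "s \<le> card {u\<in>X. a \<in> F u}"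
    and lay: "pS \<le> px" "px + n \<le> Q" "pK + n * n \<le> pO"
    and F: "\<And>u. u \<in> X \<Longrightarrow> flags (pF + u * n) (F u) n m"
    and S: "marks pO S n m"
    and R: "\<And>r' m' \<tau>' U. same_off {17, 22, 23, 24, 28} r r' \<Longrightarrow>
      same_off ({px..<px + n} \<union> {pO..<pF} \<union> {Q..<Q + (1 + n)}) m m' \<Longrightarrow>
      r' 28 = Q \<Longrightarrow> m' Q = r 13 \<Longrightarrow> U \<subseteq> {u\<in>X. a \<in> F u} \<Longrightarrow> card U = s \<Longrightarrow> r' 22 \<in> U \<Longrightarrow>
      (\<And>u. u \<in> U \<Longrightarrow> \<kappa> u a \<le> \<kappa> (r' 22) a) \<Longrightarrow> flags px (X - U) n m' \<Longrightarrow>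
      flags (Q + 1) U n m' \<Longrightarrow> marks pO (S \<union> U \<times> {a}) n m' \<Longrightarrow> \<tau>' \<le> \<tau> + 100 * n + 50 \<Longrightarrow> R r' m' \<tau>'"
  shows "wp V split R r m \<tau>"
proof -
  let ?S = "{px..<px + n} \<union> {pO..<pF} \<union> {Q..<Q + (1 + n)}"
  let ?r = "r(28 := Q, 24 := 0, 23 := 0)" and ?m = "m(Q := r 13)"
  let ?I = "\<lambda>j r' m' \<tau>'. r' 17 = j \<and> same_off {17, 22, 23, 24, 28} r r' \<and> r' 28 = Q \<and>
    same_off ?S m m' \<and> m' Q = r 13 \<and> (\<exists>U. split_inv px Q a s \<kappa> X F S j U r' m') \<and>
    \<tau>' \<le> \<tau> + 100 * j + 40"
  have finX: "finite X" using X(2) finite_subset by blast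
  have r0: "r 0 = n" using r(1) by (simp add: regs_def)
  have main: "wp V (For 17 0 split_body) R ?r ?m \<tau>1" if t1: "\<tau>1 \<le> \<tau> + 30" for \<tau>1
  proof (rule wp_for[where N = n and I = ?I])
    have "flags px X n ?m"
      by (rule flags_same[OF X(1), of "{Q}"]) (use lay in \<open>auto simp: same_off_def\<close>)
    moreover have "marks pO S n ?m"
      by (rule marks_same[OF S, of "{Q}"]) (use lay in \<open>auto simp: same_off_def\<close>)
    ultimately have "split_inv px Q a s \<kappa> X F S 0 {} (?r(17 := 0)) ?m"
      unfolding split_inv_def by simp
    then show "?I 0 (?r(17 := 0)) ?m (\<tau>1 + 2)" using t1 by (auto simp: same_off_def)
  next
    fix j r1 m1 \<tau>1 assume "?I j r1 m1 \<tau>1"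
    then show "r1 17 = j \<and> r1 0 = n" using r0 same_offD[of _ r r1 0] by auto
  next
    fix j r1 m1 \<tau>1 assume j: "j < n" and I: "?I j r1 m1 \<tau>1"
    then obtain U where U: "split_inv px Q a s \<kappa> X F S j U r1 m1" by blast
    have so: "same_off ?S m m1" using I by simp
    have r1: "regs r1"
      by (rule regs_same[OF r(1), where M = "{17, 22, 23, 24, 28}"]) (use I in simp_all)
    show "wp V split_body (\<lambda>r' m' \<tau>'. r' 17 = j \<and> ?I (Suc j) (r'(17 := Suc j)) m' (\<tau>' + 4)) r1 m1 (\<tau>1 + 4)"
    proof (rule wp_split_body[OF r1, where px = px and pK = pK and s = s and j = j and a = a and Q = Q
          and \<kappa> = \<kappa> and X = X and F = F and S = S and U = U])
      have "keys pK \<kappa> n m1" by (rule keys_same[OF K so]) (use lay in auto)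
      then show "\<kappa> j a = m1 (pK + j * n + a)" using j X(3) by (simp add: keys_def)
      show "flags (pF + j * n) (F j) n m1" if "j \<in> X"
        by (rule flags_same[OF F[OF that] so]) (use lay row_region[OF j] in auto)
      fix r2 m2 \<tau>2 U'
      assume 2: "same_off {22, 23, 24} r1 r2"
        "same_off ({px..<px + n} \<union> {pO..<pF} \<union> {Q + 1..<Q + (1 + n)}) m1 m2"
        "split_inv px Q a s \<kappa> X F S (Suc j) U' r2 m2" "\<tau>2 \<le> \<tau>1 + 4 + 90"
      have "split_inv px Q a s \<kappa> X F S (Suc j) U' (r2(17 := Suc j)) m2"
        using 2(3) by (simp add: split_inv_def)
      moreover have "same_off ?S m m2" by (rule same_off_trans[OF so 2(2)]) auto
      moreover have "m2 Q = r 13" using I same_offD[OF 2(2), of Q] lay n by auto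
      moreover have "r2 17 = j" "r2 28 = Q" using I same_offD[OF 2(1)] by auto
      moreover have "same_off {17, 22, 23, 24, 28} r (r2(17 := Suc j))"
        using I 2(1) by (auto simp: same_off_def)
      ultimately show "r2 17 = j \<and> ?I (Suc j) (r2(17 := Suc j)) m2 (\<tau>2 + 4)"
        using I 2(4) by auto
    qed (use j X lay I U r finX same_offD[of _ r r1] in auto)
  next
    fix r1 m1 \<tau>1 assume I: "?I n r1 m1 \<tau>1"
    then obtain U where U: "split_inv px Q a s \<kappa> X F S n U r1 m1" by blast
    have "{u\<in>X. u < n \<and> a \<in> F u} = {u\<in>X. a \<in> F u}" using X(2) by auto
    \<comment> \<open>If the selection never filled up, \<open>U\<close> would be the set of all
      candidates, and there are at least \<open>s\<close> of them.\<close>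
    then have U': "U \<subseteq> {u\<in>X. a \<in> F u}" "card U = s"
      using U X(5) unfolding split_inv_def by auto
    then have "U \<noteq> {}" using X(4) by auto
    moreover have "flags (Q + 1) U n m1" using U unfolding split_inv_def flags_def by (simp add: add.assoc)
    ultimately show "R r1 m1 (\<tau>1 + 4)"
      using I U U' unfolding split_inv_def by (intro R) auto
  qed (use nV in auto)
  show ?thesis unfolding split_def
  proof (rule wp_seq_pre)
    assume b: "bnd V r m"
    show "pre V (Seq (Assign 28 (Plus (Reg 8) (Plus (Const 1) (Times (Const 2) (Reg 0)))))
     (Seq (Store (Reg 28) (Reg 13)) (Seq (Assign 24 (Const 0)) (Assign 23 (Const 0)))))
     (wp V (For 17 0 split_body) R) r m \<tau>"
      using main r r0 bndD[OF b] bound by (simp add: simple_def add.assoc)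
  qed
qed

lemma wp_spread:
  assumes r: "regs r" "r 12 = py" "r 22 = b" "r 28 = Q"
    and Y: "flags py Y n m" "b < n" "flags (pF + b * n) F n m" "F \<subseteq> Y"
    and lay: "pS \<le> py" "py + n \<le> Q"
    and S: "marks pO S n m" "Y \<subseteq> {..<n}"
    and R: "\<And>r' m' \<tau>'. same_off {18} r r' \<Longrightarrow>
      same_off ({pO..<pF} \<union> {Q + (1 + n)..<Q + (1 + 2 * n)}) m m' \<Longrightarrow>
      flags (Q + (1 + n)) F n m' \<Longrightarrow> marks pO (S \<union> {b} \<times> Y) n m' \<Longrightarrow> \<tau>' \<le> \<tau> + 70 * n + 10 \<Longrightarrow> R r' m' \<tau>'"
  shows "wp V spread R r m \<tau>"
proof -
  let ?I = "\<lambda>j r' m' \<tau>'. r' 18 = j \<and> same_off {18} r r' \<and>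
    same_off ({pO..<pF} \<union> {Q + (1 + n)..<Q + (1 + 2 * n)}) m m' \<and>
    (\<forall>v<j. m' (Q + (1 + (n + v))) = of_bool (v \<in> F)) \<and>
    marks pO (S \<union> {b} \<times> (Y \<inter> {..<j})) n m' \<and> \<tau>' \<le> \<tau> + 70 * j + 2"
  show ?thesis
    unfolding spread_def
  proof (rule wp_for[where N = n and I = ?I])
    let ?S = "{pO..<pF} \<union> {Q + (1 + n)..<Q + (1 + 2 * n)}"
    fix j r1 m1 \<tau>1
    assume j: "j < n" and I: "?I j r1 m1 \<tau>1"
    have so: "same_off ?S m m1" using I by simp
    have r1: "r1 0 = n" "r1 29 = pO" "r1 30 = pF" "r1 12 = py" "r1 22 = b" "r1 28 = Q" "r1 18 = j"
      using I r same_offD[of _ r r1] by (auto simp: regs_def)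
    have fY: "flags py Y n m1" by (rule flags_same[OF Y(1) so]) (use lay in auto)
    have fF: "flags (pF + b * n) F n m1"
      by (rule flags_same[OF Y(3) so]) (use lay row_region[OF Y(2)] in auto)
    have ji: "b * n + j < n * n" using index_less[OF Y(2) j] .
    have rd: "m1 (py + j) = of_bool (j \<in> Y)" "m1 (pF + b * n + j) = of_bool (j \<in> F)"
      using fY fF j by (auto simp: flags_def)
    have jF: "j \<in> F \<Longrightarrow> j \<in> Y" using Y(4) by blast
    let ?m1 = "if j \<in> Y then m1(pO + b * n + j := 1) else m1"
    let ?m2 = "?m1(Q + (1 + (n + j)) := of_bool (j \<in> F))"
    have mk: "marks pO (S \<union> {b} \<times> (Y \<inter> {..<Suc j})) n ?m1"
    proof (cases "j \<in> Y")
      case True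
      have e: "S \<union> {b} \<times> (Y \<inter> {..<Suc j}) = insert (b, j) (S \<union> {b} \<times> (Y \<inter> {..<j}))"
        using True by (auto simp: lessThan_Suc)
      show ?thesis unfolding e using marks_insert[OF _ Y(2) j] I True by simp
    next
      case False
      then have e: "Y \<inter> {..<Suc j} = Y \<inter> {..<j}" by (auto simp: lessThan_Suc)
      show ?thesis unfolding e using I False by simp
    qed
    have mk2: "marks pO (S \<union> {b} \<times> (Y \<inter> {..<Suc j})) n ?m2"
      by (rule marks_same[OF mk, of "{Q + (1 + (n + j))}"]) (use lay in \<open>auto simp: same_off_def\<close>)
    have so1: "same_off ?S m ?m1" using so ji by (auto intro: same_off_upd)
    have so2: "same_off ?S m ?m2" using so1 j by (intro same_off_upd) auto
    have fl: "?m2 (Q + (1 + (n + v))) = of_bool (v \<in> F)" if "v < Suc j" for v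
      using I that lay ji by (cases "v = j") auto
    show "wp V spread_cell
       (\<lambda>r' m' \<tau>'. r' 18 = j \<and> ?I (Suc j) (r'(18 := Suc j)) m' (\<tau>' + 4)) r1 m1 (\<tau>1 + 4)"
      (is "wp V ?c ?R r1 m1 _")
    proof -
      have step: "wp V ?c R' r1 m1 (\<tau>1 + 4)" if fin: "\<And>\<tau>'. \<tau>' \<le> \<tau>1 + 50 \<Longrightarrow> R' r1 ?m2 \<tau>'" for R'
      proof (rule wp_pre)
        have ne: "py + j \<noteq> pO + b * n + j" "pF + b * n + j \<noteq> pO + b * n + j" using lay ji n by auto
        assume b: "bnd V r1 m1"
        show "pre V ?c R' r1 m1 (\<tau>1 + 4)"
        proof (cases "j \<in> Y")
          case True
          have "?m1 (py + j) = of_bool (j \<in> Y)" "?m1 (pF + b * n + j) = of_bool (j \<in> F)"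
            using rd ne by auto
          then show ?thesis using fin r1 rd True bndD(1)[OF b]
            by (simp add: simple_def cell_def spread_cell_def del: fun_upd_apply)
        next
          case False
          then have "j \<notin> F" using jF by blast
          then show ?thesis using fin r1 rd bndD(1)[OF b] False
            by (simp add: simple_def cell_def spread_cell_def del: fun_upd_apply)
        qed
      qed
      show ?thesis
      proof (rule step, intro conjI)
        show "same_off {18} r (r1(18 := Suc j))" using I by (intro same_off_upd) auto
      qed (use I mk2 so2 fl in simp_all)
    qed
  next
    fix r1 m1 \<tau>1
    assume I: "?I n r1 m1 \<tau>1"
    moreover have "Y \<inter> {..<n} = Y" using S(2) by blast
    ultimately show "R r1 m1 (\<tau>1 + 4)" by (intro R) (auto simp: flags_def add.assoc)
  qed (use r nV S in \<open>auto simp: same_off_def regs_def\<close>)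
qed

end

context layout
begin

text \<open>The postcondition is the combinatorial step with its witnesses \<open>a\<close> and
  \<open>b\<close>, and the two resulting subproblems lie in the old and the new frame. The time is
  of the order of \<open>(|X| + |Y|) n (h + 1)\<close>, the form required for charging it to the
  potential.\<close>

lemma wp_step:
  assumes r: "regs r" "r 8 = P" "r 9 = card X" "r 10 = card Y" "r 11 = px" "r 12 = py" "r 14 = pK"
      "r 7 < V"
    and Q: "P + (1 + 2 * n) = Q" "Q \<le> V"
    and X: "flags px X n m" "X \<subseteq> {..<n}" and Y: "flags py Y n m" "Y \<subseteq> {..<n}" "Y \<noteq> {}"
    and lay: "pS \<le> px" "px + n \<le> Q" "pS \<le> py" "py + n \<le> Q" "px + n \<le> py \<or> py + n \<le> px"
      "pK + n * n \<le> pO"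
    and K: "keys pK \<kappa> n m" and S: "marks pO S n m"
    and d: "2 \<le> d" "card Y \<le> card X" "d < card X"
    and R: "\<And>r' m' \<tau>' U F a b. regs r' \<Longrightarrow> r' 7 = r 7 + 1 \<Longrightarrow>
      U \<subseteq> X \<Longrightarrow> card U = cdiv (card X) d \<Longrightarrow> b \<in> U \<Longrightarrow> segment Y (cdiv (card Y) d) (\<kappa> b) F \<Longrightarrow>
      a \<in> F \<Longrightarrow> (\<And>u. u \<in> U \<Longrightarrow> \<kappa> u a \<le> \<kappa> b a) \<Longrightarrow>
      marks pO (S \<union> U \<times> {a} \<union> {b} \<times> Y) n m' \<Longrightarrow> flags px (X - U) n m' \<Longrightarrow> flags py Y n m' \<Longrightarrow>
      m' Q = r 13 \<Longrightarrow> flags (Q + 1) U n m' \<Longrightarrow> flags (Q + (1 + n)) F n m' \<Longrightarrow>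
      same_off ({px..<px + n} \<union> {pO..<pOut} \<union> {Q..<Q + (1 + 2 * n)}) m m' \<Longrightarrow>
      \<tau>' \<le> \<tau> + card X * (200 * n * (h + 1)) + card Y * (40 * n + 50) + 210 * n + 200 \<Longrightarrow> R r' m' \<tau>'"
  shows "wp V step R r m \<tau>"
proof -
  define q s where "q = cdiv (card Y) d" and "s = cdiv (card X) d"
  have fin: "finite X" "finite Y" using X Y finite_subset by blast+
  have "card X \<le> n" using card_mono[OF _ X(2)] by simp
  then have dn: "d \<le> n" "card X + d \<le> V" "card Y + d \<le> V" using d V by auto

  have qY: "q \<le> card Y" unfolding q_def using d by (intro cdiv_le) simp
  have s1: "1 \<le> s" unfolding s_def using cdiv_pos[of d "card X"] d by simp
  let ?r = "r(15 := q, 16 := s)"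
  have main: "wp V (Seq select (Seq popular (Seq split (Seq spread (Assign 7 (Plus (Reg 7) (Const 1)))))))
      R ?r m \<tau>0" if t0: "\<tau>0 \<le> \<tau> + 20" for \<tau>0
  proof (rule wp_seq, rule wp_select[where py = py and q = q and px = px and pK = pK and \<kappa> = \<kappa> and X = X and Y = Y])
    fix r1 m1 \<tau>1 F
    assume 1: "same_off {17, 18, 19, 20, 25, 26, 27} ?r r1" "same_off ({pF..<pT} \<union> {pT..<pOut}) m m1"
      "\<And>u. u \<in> X \<Longrightarrow> segment Y q (\<kappa> u) (F u) \<and> flags (pF + u * n) (F u) n m1"
      "\<tau>1 \<le> \<tau>0 + card X * (200 * n * (h + 1)) + 20 * n + 10"
    have g1: "regs r1" by (rule regs_same[OF _ 1(1)]) (use r(1) in \<open>auto simp: regs_def\<close>)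
    have r1: "r1 8 = P" "r1 11 = px" "r1 12 = py" "r1 13 = r 13" "r1 14 = pK" "r1 15 = q" "r1 16 = s" "r1 7 = r 7"
      using same_offD[OF 1(1)] r by auto
    have X1: "flags px X n m1" by (rule flags_same[OF X(1) 1(2)]) (use lay in auto)
    have Y1: "flags py Y n m1" by (rule flags_same[OF Y(1) 1(2)]) (use lay in auto)
    have K1: "keys pK \<kappa> n m1" by (rule keys_same[OF K 1(2)]) (use lay in auto)
    have S1: "marks pO S n m1" by (rule marks_same[OF S 1(2)]) auto
    have ex: "\<exists>a\<in>Y. s \<le> card {u\<in>X. a \<in> F u}"
    proof (rule ex_popular[OF fin Y(3), where q = q and d = d])
      show "F u \<subseteq> Y \<and> card (F u) = q" if "u \<in> X" for u using 1(3)[OF that] by (simp add: segment_def)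
      show "card Y \<le> q * d" unfolding q_def using d by (intro cdiv_mult_ge) simp
      show "(s - 1) * d < card X" unfolding s_def using d by (intro cdiv_pred_mult_less) auto
    qed
    show "wp V (Seq popular (Seq split (Seq spread (Assign 7 (Plus (Reg 7) (Const 1)))))) R r1 m1 \<tau>1"
    proof (rule wp_seq, rule wp_popular[OF g1 r1(3,7,2) X1 X(2) Y1 Y(2) _ ex])
      show "flags (pF + u * n) (F u) n m1" if "u \<in> X" for u using 1(3)[OF that] by simp
      fix r2 :: "nat \<Rightarrow> nat" and \<tau>2
      define a where "a = r2 21"
      assume 2: "same_off {17, 18, 21, 24} r1 r2" "r2 21 \<in> Y" "s \<le> card {u\<in>X. r2 21 \<in> F u}"
        "\<tau>2 \<le> \<tau>1 + card Y * (40 * n + 50) + 20 * n + 10"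
      have g2: "regs r2" by (rule regs_same[OF g1 2(1)]) simp
      have r2: "r2 8 = P" "r2 11 = px" "r2 12 = py" "r2 13 = r 13" "r2 14 = pK" "r2 16 = s" "r2 7 = r 7"
        using same_offD[OF 2(1)] r1 by auto
      have an: "a < n" using 2(2) Y(2) unfolding a_def by auto
      show "wp V (Seq split (Seq spread (Assign 7 (Plus (Reg 7) (Const 1))))) R r2 m1 \<tau>2"
      proof (rule wp_seq, rule wp_split[OF g2 r2(2,5,6) a_def[symmetric] r2(1) Q K1 X1 X(2) an s1 _ lay(1,2,6) _ S1])
        show "s \<le> card {u\<in>X. a \<in> F u}" using 2(3) by (simp add: a_def)
        show "flags (pF + u * n) (F u) n m1" if "u \<in> X" for u using 1(3)[OF that] by simp
        fix r3 m3 :: "nat \<Rightarrow> nat" and \<tau>3 U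
        define b where "b = r3 22"
        assume 3: "same_off {17, 22, 23, 24, 28} r2 r3"
          "same_off ({px..<px + n} \<union> {pO..<pF} \<union> {Q..<Q + (1 + n)}) m1 m3"
          "r3 28 = Q" "m3 Q = r2 13" "U \<subseteq> {u\<in>X. a \<in> F u}" "card U = s" "r3 22 \<in> U"
          "\<And>u. u \<in> U \<Longrightarrow> \<kappa> u a \<le> \<kappa> (r3 22) a" "flags px (X - U) n m3" "flags (Q + 1) U n m3"
          "marks pO (S \<union> U \<times> {a}) n m3" "\<tau>3 \<le> \<tau>2 + 100 * n + 50"
        have g3: "regs r3" by (rule regs_same[OF g2 3(1)]) simp
        have r3: "r3 12 = py" "r3 7 = r 7" using same_offD[OF 3(1)] r2 by auto
        have b: "b \<in> X" "a \<in> F b" "b < n" using 3(5,7) X(2) unfolding b_def by auto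
        have Fb: "segment Y q (\<kappa> b) (F b)" "flags (pF + b * n) (F b) n m1" using 1(3)[OF b(1)] by auto
        have Y3: "flags py Y n m3" by (rule flags_same[OF Y1 3(2)]) (use lay in auto)
        have F3: "flags (pF + b * n) (F b) n m3"
          by (rule flags_same[OF Fb(2) 3(2)]) (use lay row_region[OF b(3)] Q in auto)
        show "wp V (Seq spread (Assign 7 (Plus (Reg 7) (Const 1)))) R r3 m3 \<tau>3"
        proof (rule wp_seq, rule wp_spread[OF g3 r3(1) b_def[symmetric] 3(3) Y3 b(3) F3 _ lay(3,4) 3(11) Y(2)])
          show "F b \<subseteq> Y" using Fb(1) by (simp add: segment_def)
          fix r4 m4 \<tau>4
          assume 4: "same_off {18} r3 r4" "same_off ({pO..<pF} \<union> {Q + (1 + n)..<Q + (1 + 2 * n)}) m3 m4"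
            "flags (Q + (1 + n)) (F b) n m4" "marks pO (S \<union> U \<times> {a} \<union> {b} \<times> Y) n m4"
            "\<tau>4 \<le> \<tau>3 + 70 * n + 10"
          have g4: "regs r4" by (rule regs_same[OF g3 4(1)]) simp
          have r47: "r4 7 = r 7" using same_offD[OF 4(1), of 7] r3 by simp
          show "wp V (Assign 7 (Plus (Reg 7) (Const 1))) R r4 m4 \<tau>4"
          proof (rule wp_assign)
            show "R (r4(7 := val (Plus (Reg 7) (Const 1)) (r4, m4))) m4 (\<tau>4 + 1 + cost (Plus (Reg 7) (Const 1)))"
            proof (rule R[where U = U and a = a and b = b and F = "F b"])
              show "regs (r4(7 := val (Plus (Reg 7) (Const 1)) (r4, m4)))" using g4 by (simp add: regs_def)
              show "same_off ({px..<px + n} \<union> {pO..<pOut} \<union> {Q..<Q + (1 + 2 * n)}) m m4"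
              proof -
                have "same_off ({px..<px + n} \<union> {pO..<pOut} \<union> {Q..<Q + (1 + 2 * n)}) m m3"
                  by (rule same_off_trans[OF 1(2) 3(2)]) auto
                then show ?thesis by (rule same_off_trans[OF _ 4(2)]) auto
              qed
              show "flags px (X - U) n m4" by (rule flags_same[OF 3(9) 4(2)]) (use lay Q in auto)
              show "flags py Y n m4" by (rule flags_same[OF Y3 4(2)]) (use lay Q in auto)
              show "flags (Q + 1) U n m4" by (rule flags_same[OF 3(10) 4(2)]) (use lay Q in auto)
              show "m4 Q = r 13" using same_offD[OF 4(2), of Q] 3(4) r2(4) lay Q by auto
              show "U \<subseteq> X" using 3(5) by auto
              show "card U = cdiv (card X) d" using 3(6) by (simp add: s_def)
              show "segment Y (cdiv (card Y) d) (\<kappa> b) (F b)" using Fb(1) by (simp add: q_def)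
              show "\<tau>4 + 1 + cost (Plus (Reg 7) (Const 1)) \<le> \<tau> + card X * (200 * n * (h + 1)) +
                  card Y * (40 * n + 50) + 210 * n + 200"
                using 4(5) 3(12) 2(4) 1(4) t0 by simp
            qed (use r47 3 4 b in \<open>auto simp: b_def\<close>)
          qed (use r r47 in \<open>auto simp: simple_def\<close>)
        qed
      qed
    qed
  qed (use r X Y lay qY K in \<open>auto simp: regs_def\<close>)
  have c: "(card Y + d - 1) div d = q" "(card X + d - 1) div d = s"
    unfolding q_def s_def cdiv_def by auto
  have "q \<le> V" "s \<le> V" using qY dn s_def cdiv_le[of d "card X"] d by auto
  then show ?thesis unfolding step_def
    using main r(1,3,4) c dn by (intro wp_seq_pre) (simp add: simple_def regs_def)
qed

section \<open>Subproblems with at most d vertices on either side\<close>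

lemma wp_base_row:
  assumes r: "regs r" "r 12 = py" "r 17 = u"
    and Y: "flags py Y n m" "Y \<subseteq> {..<n}" "pS \<le> py" "u < n" and S: "marks pO S n m"
    and R: "\<And>r' m' \<tau>'. same_off {18} r r' \<Longrightarrow> same_off {pO..<pF} m m' \<Longrightarrow>
      marks pO (S \<union> {u} \<times> Y) n m' \<Longrightarrow> \<tau>' \<le> \<tau> + 40 * n + 10 \<Longrightarrow> R r' m' \<tau>'"
  shows "wp V (For 18 0 base_cell) R r m \<tau>"
proof -
  let ?I = "\<lambda>j r' m' \<tau>'. r' 18 = j \<and> same_off {18} r r' \<and> same_off {pO..<pF} m m' \<and>
    marks pO (S \<union> {u} \<times> (Y \<inter> {..<j})) n m' \<and> \<tau>' \<le> \<tau> + 40 * j + 2"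
  show ?thesis
  proof (rule wp_for[where N = n and I = ?I])
    fix j r1 m1 \<tau>1
    assume j: "j < n" and I: "?I j r1 m1 \<tau>1"
    have so: "same_off {pO..<pF} m m1" using I by simp
    have r1: "r1 0 = n" "r1 29 = pO" "r1 12 = py" "r1 17 = u" "r1 18 = j"
      using I r same_offD[of _ r r1] by (auto simp: regs_def)
    have "flags py Y n m1" by (rule flags_same[OF Y(1) so]) (use Y(3) in auto)
    then have rd: "m1 (py + j) = of_bool (j \<in> Y)" using j by (simp add: flags_def)
    have ji: "u * n + j < n * n" using index_less[OF Y(4) j] .
    let ?m1 = "if j \<in> Y then m1(pO + u * n + j := 1) else m1"
    have mk: "marks pO (S \<union> {u} \<times> (Y \<inter> {..<Suc j})) n ?m1"
    proof (cases "j \<in> Y")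
      case True
      have e: "S \<union> {u} \<times> (Y \<inter> {..<Suc j}) = insert (u, j) (S \<union> {u} \<times> (Y \<inter> {..<j}))"
        using True by (auto simp: lessThan_Suc)
      show ?thesis unfolding e using marks_insert[OF _ Y(4) j] I True by simp
    next
      case False
      then have e: "Y \<inter> {..<Suc j} = Y \<inter> {..<j}" by (auto simp: lessThan_Suc)
      show ?thesis unfolding e using I False by simp
    qed
    have so1: "same_off {pO..<pF} m ?m1" using so ji by (auto intro: same_off_upd)
    have step: "wp V base_cell R' r1 m1 (\<tau>1 + 4)"
      if "\<And>\<tau>'. \<tau>' \<le> \<tau>1 + 30 \<Longrightarrow> R' r1 ?m1 \<tau>'" for R'
      using that r1 rd bndD(1)[of V r1 m1]
      by (intro wp_pre, cases "j \<in> Y") (simp_all add: simple_def cell_def base_cell_def del: fun_upd_apply)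
    show "wp V base_cell
       (\<lambda>r' m' \<tau>'. r' 18 = j \<and> ?I (Suc j) (r'(18 := Suc j)) m' (\<tau>' + 4)) r1 m1 (\<tau>1 + 4)"
    proof (rule step, intro conjI)
      show "same_off {18} r (r1(18 := Suc j))" using I by (intro same_off_upd) auto
    qed (use I mk so1 in simp_all)
  next
    fix r1 m1 \<tau>1
    assume I: "?I n r1 m1 \<tau>1"
    moreover have "Y \<inter> {..<n} = Y" using Y(2) by blast
    ultimately show "R r1 m1 (\<tau>1 + 4)" by (intro R) auto
  qed (use r nV S in \<open>auto simp: same_off_def regs_def\<close>)
qed

lemma wp_base:
  assumes r: "regs r" "r 11 = px" "r 12 = py"
    and X: "flags px X n m" "X \<subseteq> {..<n}" "pS \<le> px" and Y: "flags py Y n m" "Y \<subseteq> {..<n}" "pS \<le> py"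
    and S: "marks pO S n m"
    and R: "\<And>r' m' \<tau>'. regs r' \<Longrightarrow> r' 7 = r 7 - 1 \<Longrightarrow> same_off {pO..<pF} m m' \<Longrightarrow>
      marks pO (S \<union> X \<times> Y) n m' \<Longrightarrow> \<tau>' \<le> \<tau> + card X * (40 * n + 30) + 20 * n + 20 \<Longrightarrow> R r' m' \<tau>'"
  shows "wp V base R r m \<tau>"
proof -
  let ?I = "\<lambda>j r' m' \<tau>'. r' 17 = j \<and> same_off {17, 18} r r' \<and> same_off {pO..<pF} m m' \<and>
    marks pO (S \<union> (X \<inter> {..<j}) \<times> Y) n m' \<and>
    \<tau>' \<le> \<tau> + card (X \<inter> {..<j}) * (40 * n + 30) + 20 * j + 2"
  show ?thesis
    unfolding base_def
  proof (rule wp_seq, rule wp_for[where N = n and I = ?I])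
    have finX: "finite X" using X(2) finite_subset by blast
    fix j r1 m1 \<tau>1
    assume j: "j < n" and I: "?I j r1 m1 \<tau>1"
    have so: "same_off {pO..<pF} m m1" using I by simp
    have g1: "regs r1" by (rule regs_same[OF r(1), where M = "{17, 18}"]) (use I in simp_all)
    have r1: "r1 11 = px" "r1 12 = py" "r1 17 = j" using I r same_offD[of _ r r1] by auto
    have "flags px X n m1" by (rule flags_same[OF X(1) so]) (use X(3) in auto)
    then have rd: "m1 (px + j) = of_bool (j \<in> X)" using j by (simp add: flags_def)
    have fY: "flags py Y n m1" by (rule flags_same[OF Y(1) so]) (use Y(3) in auto)
    show "wp V (Cond (Mem (Plus (Reg 11) (Reg 17)))
         (For 18 0 base_cell) Skip)
       (\<lambda>r' m' \<tau>'. r' 17 = j \<and> ?I (Suc j) (r'(17 := Suc j)) m' (\<tau>' + 4)) r1 m1 (\<tau>1 + 4)"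
      (is "wp V _ ?R r1 m1 _")
    proof (rule wp_cond)
      assume "val (Mem (Plus (Reg 11) (Reg 17))) (r1, m1) \<noteq> 0"
      then have jX: "j \<in> X" using rd r1 by (cases "j \<in> X") auto
      have e: "S \<union> (X \<inter> {..<Suc j}) \<times> Y = S \<union> (X \<inter> {..<j}) \<times> Y \<union> {j} \<times> Y"
        using jX by (auto simp: lessThan_Suc)
      show "wp V (For 18 0 base_cell)
          ?R r1 m1 (\<tau>1 + 4 + 1 + cost (Mem (Plus (Reg 11) (Reg 17))))"
      proof (rule wp_base_row[OF g1 r1(2,3) fY Y(2,3) j])
        show "marks pO (S \<union> (X \<inter> {..<j}) \<times> Y) n m1" using I by simp
        fix r2 m2 \<tau>2
        assume 2: "same_off {18} r1 r2" "same_off {pO..<pF} m1 m2"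
          "marks pO (S \<union> (X \<inter> {..<j}) \<times> Y \<union> {j} \<times> Y) n m2"
          "\<tau>2 \<le> \<tau>1 + 4 + 1 + cost (Mem (Plus (Reg 11) (Reg 17))) + 40 * n + 10"
        have "same_off {pO..<pF} m m2" by (rule same_off_trans[OF so 2(2)]) auto
        moreover have "same_off {17, 18} r (r2(17 := Suc j))" using I 2(1) by (auto simp: same_off_def)
        moreover have "r2 17 = j" using same_offD[OF 2(1), of 17] r1 by simp
        moreover have "\<tau>2 + 4 \<le> \<tau> + card (X \<inter> {..<Suc j}) * (40 * n + 30) + 20 * Suc j + 2"
          using I 2(4) jX card_inter_Suc[OF finX, of j] by (simp add: distrib_right)
        ultimately show "?R r2 m2 \<tau>2" using 2(3) unfolding e by simp
      qed
    next
      assume "val (Mem (Plus (Reg 11) (Reg 17))) (r1, m1) = 0"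
      then have jX: "j \<notin> X" using rd r1 by auto
      then have e: "X \<inter> {..<Suc j} = X \<inter> {..<j}" by (auto simp: lessThan_Suc)
      show "wp V Skip ?R r1 m1 (\<tau>1 + 4 + 1 + cost (Mem (Plus (Reg 11) (Reg 17))))"
        unfolding e using I by (intro wp_skip) (auto intro!: same_off_upd)
    qed (simp add: simple_def)
  next
    fix r1 m1 \<tau>1
    assume I: "?I n r1 m1 \<tau>1" and b: "bnd V r1 m1"
    have e: "X \<inter> {..<n} = X" using X(2) by blast
    have g1: "regs r1" by (rule regs_same[OF r(1), where M = "{17, 18}"]) (use I in simp_all)
    have "r1 7 = r 7" using I same_offD[of _ r r1 7] by auto
    then show "wp V (Assign 7 (Monus (Reg 7) (Const 1))) R r1 m1 (\<tau>1 + 4)"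
      using I g1 bndD(2)[OF b, of 7] unfolding e
      by (intro wp_assign R) (auto simp: simple_def regs_def)
  qed (use r nV S in \<open>auto simp: same_off_def regs_def\<close>)
qed

text \<open>Nonempty sides are part of the invariant because they give each frame positive
  potential, which bounds the height of the stack.\<close>

definition is_frame :: "nat \<Rightarrow> nat \<times> nat set \<times> nat set \<Rightarrow> (nat \<Rightarrow> nat) \<Rightarrow> bool" where
  "is_frame p f m \<longleftrightarrow> (case f of (\<rho>, X, Y) \<Rightarrow> m p = \<rho> \<and> flags (p + 1) X n m \<and> flags (p + (1 + n)) Y n m \<and>
     \<rho> \<le> 1 \<and> X \<subseteq> {..<n} \<and> Y \<subseteq> {..<n} \<and> X \<noteq> {} \<and> Y \<noteq> {})"

lemma wp_prepare:
  assumes r: "regs r" "pS + (r 7 - 1) * (1 + 2 * n) = P" "P + (1 + 2 * n) \<le> V" "\<beta> + n * n \<le> V"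
    and f: "is_frame P (\<rho>, X, Y) m"
    and R: "\<And>r' \<tau>' \<rho>' X' Y' px py. regs r' \<Longrightarrow> r' 7 = r 7 \<Longrightarrow> r' 8 = P \<Longrightarrow> r' 9 = card X' \<Longrightarrow> r' 10 = card Y' \<Longrightarrow>
      r' 11 = px \<Longrightarrow> r' 12 = py \<Longrightarrow> r' 13 = \<rho>' \<Longrightarrow> r' 14 = \<beta> + \<rho>' * (n * n) \<Longrightarrow> card Y' \<le> card X' \<Longrightarrow>
      (\<rho>', X', Y', px, py) = (\<rho>, X, Y, P + 1, P + (1 + n)) \<or>
        (\<rho>', X', Y', px, py) = (1 - \<rho>, Y, X, P + (1 + n), P + 1) \<Longrightarrow>
      \<tau>' \<le> \<tau> + 60 * n + 80 \<Longrightarrow> R r' m \<tau>'"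
  shows "wp V prepare R r m \<tau>"
proof -
  have f': "m P = \<rho>" "flags (P + 1) X n m" "flags (P + (1 + n)) Y n m" "\<rho> \<le> 1" "X \<subseteq> {..<n}" "Y \<subseteq> {..<n}"
    using f by (auto simp: is_frame_def)
  have r': "r 33 = pS" "r 0 = n" using r(1) by (auto simp: regs_def)
  let ?r = "r(8 := P, 9 := 0, 10 := 0)"
  have fin: "finite X" "finite Y" using f' finite_subset by blast+
  let ?I = "\<lambda>j r' m' \<tau>'. r' 17 = j \<and> same_off {8, 9, 10, 17} r r' \<and> m' = m \<and> r' 8 = P \<and>
    r' 9 = card (X \<inter> {..<j}) \<and> r' 10 = card (Y \<inter> {..<j}) \<and> \<tau>' \<le> \<tau> + 60 * j + 30"
  have cj: "card (A \<inter> {..<j}) \<le> j" for A and j :: nat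
    using card_mono[of "{..<j}" "A \<inter> {..<j}"] by simp
  show ?thesis unfolding prepare_def
  proof (rule wp_seq_pre)
    let ?rest = "Seq (For 17 0 count_cell)
    orient"
    have main: "wp V ?rest R ?r m \<tau>0" if t0: "\<tau>0 \<le> \<tau> + 28" for \<tau>0
    proof (rule wp_seq, rule wp_for[where N = n and I = ?I])
      show "?I 0 (?r(17 := 0)) m (\<tau>0 + 2)" using t0 by (auto simp: same_off_def)
    next
      fix j r1 m1 \<tau>1 assume "?I j r1 m1 \<tau>1"
      then show "r1 17 = j \<and> r1 0 = n" using r' same_offD[of _ r r1] by auto
    next
      fix j r1 m1 \<tau>1 assume j: "j < n" and I: "?I j r1 m1 \<tau>1"
      have r1: "r1 0 = n" "r1 8 = P" "r1 17 = j" using I r' same_offD[of _ r r1] by auto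
      have rd: "m (P + (1 + j)) = of_bool (j \<in> X)" "m (P + (1 + (n + j))) = of_bool (j \<in> Y)"
        using f'(2,3) j by (simp_all add: flags_def add.assoc)
      have b: "card (X \<inter> {..<Suc j}) \<le> V" "card (Y \<inter> {..<Suc j}) \<le> V"
        using cj[of X "Suc j"] cj[of Y "Suc j"] j nV by auto
      show "wp V count_cell
        (\<lambda>r' m' \<tau>'. r' 17 = j \<and> ?I (Suc j) (r'(17 := Suc j)) m' (\<tau>' + 4)) r1 m1 (\<tau>1 + 4)"
        using I r1 rd b card_inter_Suc[OF fin(1), of j] card_inter_Suc[OF fin(2), of j]
        by (intro wp_pre) (auto simp: simple_def same_off_def count_cell_def)
    next
      fix r1 m1 \<tau>1 assume I: "?I n r1 m1 \<tau>1"
      have e: "X \<inter> {..<n} = X" "Y \<inter> {..<n} = Y" using f' by auto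
      have r1: "r1 0 = n" "r1 1 = \<beta>" "r1 2 = n * n" "r1 8 = P" "r1 9 = card X" "r1 10 = card Y" "m1 = m" "r1 7 = r 7"
        using I r same_offD[of _ r r1] e by (auto simp: regs_def)
      have g1: "regs r1" by (rule regs_same[OF r(1), where M = "{8, 9, 10, 17}"]) (use I in simp_all)
      have g: "regs (r1(x := v))" if "x \<notin> {0, 1, 2, 3, 29, 30, 31, 32, 33}" "regs r1" for x v r1
        using that by (auto simp: regs_def)
      have b: "card X \<le> V" "card Y \<le> V" using cj[of X n] cj[of Y n] nV e by auto
      have t: "\<tau>1 \<le> \<tau> + 60 * n + 30" using I by simp
      have rho: "\<beta> + n * n * \<rho> \<le> V" "\<beta> + n * n * (1 - \<rho>) \<le> V"
      proof -
        have "\<rho> = 0 \<or> \<rho> = 1" using f'(4) by auto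
        then show "\<beta> + n * n * \<rho> \<le> V" "\<beta> + n * n * (1 - \<rho>) \<le> V" using r(4) by auto
      qed
            show "wp V orient R r1 m1 (\<tau>1 + 4)"
      proof (rule wp_pre)
        assume bn: "bnd V r1 m1"
        show "pre V orient R r1 m1 (\<tau>1 + 4)"
        proof (cases "card X < card Y")
          case True
          have "R (r1(13 := 1 - \<rho>, 11 := P + (1 + n), 12 := P + 1, 27 := card X, 9 := card Y, 10 := card X,
              14 := \<beta> + (1 - \<rho>) * (n * n))) m \<tau>'" if "\<tau>' \<le> \<tau>1 + 50" for \<tau>'
            by (rule R[where \<rho>' = "1 - \<rho>" and X' = Y and Y' = X and px = "P + (1 + n)" and py = "P + 1"], (intro g; simp add: g1))
              (use r1 True that t in simp_all)
          then show ?thesis using r1 f'(1,4) r(3) True b rho bndD(1)[OF bn]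
            by (simp add: simple_def orient_def mult.commute fun_upd_twist)
        next
          case False
          have "R (r1(13 := \<rho>, 11 := P + 1, 12 := P + (1 + n), 14 := \<beta> + \<rho> * (n * n))) m \<tau>'"
            if "\<tau>' \<le> \<tau>1 + 50" for \<tau>'
            by (rule R[where \<rho>' = \<rho> and X' = X and Y' = Y and px = "P + 1" and py = "P + (1 + n)"], (intro g; simp add: g1))
              (use r1 False that t in simp_all)
          then show ?thesis using r1 f'(1,4) r(3) False b rho bndD(1)[OF bn]
            by (simp add: simple_def orient_def mult.commute)
        qed
      qed
    qed (use nV in auto)
    show "pre V (Seq (Assign 8 (Plus (Reg 33) (Times (Monus (Reg 7) (Const 1)) (Plus (Const 1) (Times (Const 2) (Reg 0))))))
       (Seq (Assign 9 (Const 0)) (Assign 10 (Const 0)))) (wp V ?rest R) r m \<tau>"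
      using main r r' by (simp add: simple_def)
  qed
qed

end

section \<open>The main loop\<close>

lemma (in layout) frame_same:
  "is_frame p f m \<Longrightarrow> same_off M m m' \<Longrightarrow> (\<And>i. i < 1 + 2 * n \<Longrightarrow> p + i \<notin> M) \<Longrightarrow> is_frame p f m'"
proof -
  assume a: "is_frame p f m" "same_off M m m'" "\<And>i. i < 1 + 2 * n \<Longrightarrow> p + i \<notin> M"
  obtain \<rho> X Y where f: "f = (\<rho>, X, Y)" by (cases f)
  have "m' p = m p" using same_offD[OF a(2), of p] a(3)[of 0] by simp
  moreover have "flags (p + 1) A n m' \<longleftrightarrow> flags (p + 1) A n m" for A
    using same_offD[OF a(2)] a(3)[of "1 + _"] by (simp add: flags_def add.assoc)
  moreover have "flags (p + (1 + n)) A n m' \<longleftrightarrow> flags (p + (1 + n)) A n m" for A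
    using same_offD[OF a(2)] a(3)[of "1 + (n + _)"] by (simp add: flags_def add.assoc)
  ultimately show ?thesis using a(1) unfolding is_frame_def f by simp
qed

text \<open>The pairs, as (source, target) in original time, that a frame is responsible for; a
  frame of role 1 stores its targets first.\<close>

fun rect :: "nat \<times> nat set \<times> nat set \<Rightarrow> (nat \<times> nat) set" where
  "rect (\<rho>, X, Y) = (if \<rho> = 0 then X \<times> Y else Y \<times> X)"

fun fpot :: "nat \<Rightarrow> nat \<times> nat set \<times> nat set \<Rightarrow> nat" where
  "fpot d (\<rho>, X, Y) = pot d (card X) (card Y)"

text \<open>\<open>pot0\<close> is the initial potential and \<open>T0\<close> the time at which the
  loop must be done. The keys of role 1 are only assumed to reverse the order of those of role 0. By
  \<open>room\<close> there is space for \<open>pot0 + 1\<close> frames.\<close>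

locale spanner_loop = layout +
  fixes \<kappa> :: "nat \<Rightarrow> nat \<Rightarrow> nat \<Rightarrow> nat" and pot0 T0 :: nat
  assumes d: "2 \<le> d" "d \<le> n"
    and sym: "sym_on {..<n} (\<kappa> 0)" "sym_on {..<n} (\<kappa> 1)"
    and rev: "\<And>x y x' y'. x < n \<Longrightarrow> y < n \<Longrightarrow> x' < n \<Longrightarrow> y' < n \<Longrightarrow>
      \<kappa> 1 x y \<le> \<kappa> 1 x' y' \<Longrightarrow> \<kappa> 0 x' y' \<le> \<kappa> 0 x y"
    and room: "pS + (pot0 + 1) * (1 + 2 * n) \<le> V"
begin

definition covered :: "(nat \<times> nat) set \<Rightarrow> (nat \<times> nat set \<times> nat set) list \<Rightarrow> bool" where
  "covered S fs \<longleftrightarrow> (\<forall>u<n. \<forall>v<n. reach (\<kappa> 0) S u v \<or> (\<exists>f\<in>set fs. (u, v) \<in> rect f))"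

lemma covered_update:
  assumes "covered S (gs @ [f])" "S \<subseteq> S'"
    and "\<And>u v. (u, v) \<in> rect f \<Longrightarrow> reach (\<kappa> 0) S' u v \<or> (\<exists>f\<in>set hs. (u, v) \<in> rect f)"
  shows "covered S' (gs @ hs)"
  unfolding covered_def
proof (intro allI impI)
  fix u v assume "u < n" "v < n"
  then consider "reach (\<kappa> 0) S u v" | f' where "f' \<in> set gs" "(u, v) \<in> rect f'" | "(u, v) \<in> rect f"
    using assms(1) unfolding covered_def by fastforce
  then show "reach (\<kappa> 0) S' u v \<or> (\<exists>f\<in>set (gs @ hs). (u, v) \<in> rect f)"
    using reach_mono[OF _ assms(2)] assms(3)[of u v] by cases auto
qed

lemma reach_role:
  assumes "reach (\<kappa> \<rho>) S u v" "\<rho> \<le> 1" "S \<subseteq> {..<n} \<times> {..<n}"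
  shows "if \<rho> = 0 then reach (\<kappa> 0) S u v else reach (\<kappa> 0) S v u"
proof (cases "\<rho> = 0")
  case False
  then have "\<rho> = 1" using assms(2) by simp
  then have "reach (\<kappa> 0) S v u"
    using reach_reverse[OF _ assms(3) sym(1), of "\<kappa> 1" u v] assms(1) rev by auto
  then show ?thesis using False by simp
qed (use assms in simp)

definition frames :: "(nat \<times> nat set \<times> nat set) list \<Rightarrow> (nat \<Rightarrow> nat) \<Rightarrow> bool" where
  "frames fs m \<longleftrightarrow> (\<forall>i<length fs. is_frame (pS + i * (1 + 2 * n)) (fs ! i) m)"

text \<open>The potential of the stack bounds the remaining edges, the remaining time and the height of
  the stack.\<close>

definition inv :: "nat \<Rightarrow> assertion" where
  "inv k r m \<tau> \<longleftrightarrow> regs r \<and> (\<exists>fs S. r 7 = length fs \<and> frames fs m \<and> marks pO S n m \<and>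
     S \<subseteq> {..<n} \<times> {..<n} \<and> keys \<beta> (\<kappa> 0) n m \<and> keys (\<beta> + n * n) (\<kappa> 1) n m \<and> covered S fs \<and>
     k = sum_list (map (fpot d) fs) \<and> 2 * card S + k \<le> pot0 \<and>
     \<tau> + 1000 * n * (h + 1) * d * k \<le> T0)"

lemma frames_append:
  "frames (gs @ hs) m \<longleftrightarrow> frames gs m \<and>
     (\<forall>i<length hs. is_frame (pS + (length gs + i) * (1 + 2 * n)) (hs ! i) m)"
  unfolding frames_def
proof (intro iffI conjI allI impI)
  fix i assume a: "\<forall>i<length (gs @ hs). is_frame (pS + i * (1 + 2 * n)) ((gs @ hs) ! i) m"
  show "i < length gs \<Longrightarrow> is_frame (pS + i * (1 + 2 * n)) (gs ! i) m"
    using a[rule_format, of i] by (simp add: nth_append)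
  show "i < length hs \<Longrightarrow> is_frame (pS + (length gs + i) * (1 + 2 * n)) (hs ! i) m"
    using a[rule_format, of "length gs + i"] by (simp add: nth_append)
next
  fix i assume a: "(\<forall>i<length gs. is_frame (pS + i * (1 + 2 * n)) (gs ! i) m) \<and>
      (\<forall>i<length hs. is_frame (pS + (length gs + i) * (1 + 2 * n)) (hs ! i) m)" and i: "i < length (gs @ hs)"
  show "is_frame (pS + i * (1 + 2 * n)) ((gs @ hs) ! i) m"
  proof (cases "i < length gs")
    case True
    then show ?thesis using a by (simp add: nth_append)
  next
    case False
    then show ?thesis using conjunct2[OF a, rule_format, of "i - length gs"] i by (simp add: nth_append)
  qed
qed

lemma frames_same:
  assumes "frames gs m" "same_off M m m'"
    and "\<And>x. pS \<le> x \<Longrightarrow> x < pS + length gs * (1 + 2 * n) \<Longrightarrow> x \<notin> M"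
  shows "frames gs m'"
  unfolding frames_def
proof (intro allI impI)
  fix i assume i: "i < length gs"
  have le: "i * (1 + 2 * n) + (1 + 2 * n) \<le> length gs * (1 + 2 * n)"
    using mult_le_mono1[of "Suc i" "length gs" "1 + 2 * n"] i by simp
  have "is_frame (pS + i * (1 + 2 * n)) (gs ! i) m" using assms(1) i by (simp add: frames_def)
  then show "is_frame (pS + i * (1 + 2 * n)) (gs ! i) m'"
  proof (rule frame_same[OF _ assms(2)])
    fix j assume j: "j < 1 + 2 * n"
    show "pS + i * (1 + 2 * n) + j \<notin> M"
      by (rule assms(3)) (use le j in linarith)+
  qed
qed

text \<open>Each frame has potential at least 1, so the height of the stack is bounded although
  frames are pushed repeatedly.\<close>

lemma length_le_pot:
  assumes "frames fs m"
  shows "length fs \<le> sum_list (map (fpot d) fs)"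
proof -
  have "1 \<le> fpot d f" if f: "f \<in> set fs" for f
  proof -
    obtain i where i: "i < length fs" "f = fs ! i" using f by (metis in_set_conv_nth)
    obtain \<rho> X Y where e: "f = (\<rho>, X, Y)" by (cases f)
    have XY: "X \<subseteq> {..<n}" "X \<noteq> {}"
      using assms i e unfolding frames_def is_frame_def by fastforce+
    have "0 < card X" using XY finite_subset[OF XY(1)] by (simp add: card_gt_0_iff)
    then have "1 \<le> card X + card Y" by simp
    also have "\<dots> \<le> pot d (card X) (card Y)" using d \<open>0 < card X\<close> by (intro pot_pos) auto
    finally show ?thesis using e by simp
  qed
  then show ?thesis
  proof (induction fs)
    case (Cons f fs)
    have "length fs \<le> sum_list (map (fpot d) fs)" using Cons by simp
    moreover have "1 \<le> fpot d f" using Cons.prems[of f] by simp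
    ultimately show ?case by simp
  qed simp
qed

text \<open>The potential released in an iteration covers twice the number of new marks, and
  multiplied by \<open>?D\<close> it also covers the time spent. Hence neither
  \<open>2 * card S + k\<close> nor the elapsed time plus \<open>?D * k\<close> increases.\<close>

lemma wp_body:
  assumes I: "inv k r m \<tau>" and nz: "r 7 \<noteq> 0"
  shows "wp V body (\<lambda>r m \<tau>. \<exists>k'<k. inv k' r m \<tau>) r m (\<tau> + 2)"
proof -
  obtain fs S where fs: "r 7 = length fs" "frames fs m" and S: "marks pO S n m" "S \<subseteq> {..<n} \<times> {..<n}"
    and K: "keys \<beta> (\<kappa> 0) n m" "keys (\<beta> + n * n) (\<kappa> 1) n m" and cov: "covered S fs"
    and k: "k = sum_list (map (fpot d) fs)" "2 * card S + k \<le> pot0" "\<tau> + 1000 * n * (h + 1) * d * k \<le> T0"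
    and g: "regs r" using I unfolding inv_def by auto
  have "fs \<noteq> []" using fs(1) nz by auto
  then obtain gs f where gs: "fs = gs @ [f]" by (metis append_butlast_last_id)
  obtain \<rho> X Y where f: "f = (\<rho>, X, Y)" by (cases f)
  let ?w = "1 + 2 * n"
  let ?D = "1000 * n * (h + 1) * d"
  define P Q where "P = pS + length gs * ?w" and "Q = P + ?w"
  have frP: "is_frame P (\<rho>, X, Y) m" using fs(2) unfolding gs frames_append f P_def by simp
  have frg: "frames gs m" using fs(2) unfolding gs frames_append by simp

  have "length fs \<le> pot0" using length_le_pot[OF fs(2)] k by simp
  then have lg: "length gs + 1 \<le> pot0" unfolding gs by simp
  \<comment> \<open>Besides the frames below, space is needed for the top frame and for one frame
    pushed above it.\<close>
  have "(length gs + 2) * ?w \<le> (pot0 + 1) * ?w" using lg by (intro mult_le_mono1) simp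
  moreover have e: "(length gs + 2) * ?w = length gs * ?w + ?w + ?w" by (simp add: algebra_simps)
  ultimately have QV: "Q + ?w \<le> V" using room unfolding P_def Q_def by linarith
  have lV: "length fs < V"
  proof -
    have "length gs \<le> length gs * ?w" by simp
    moreover have "length fs = length gs + 1" by (simp add: gs)
    ultimately show ?thesis using QV n unfolding P_def Q_def by linarith
  qed
  have rest: "sum_list (map (fpot d) gs) + pot d (card X) (card Y) = k" unfolding k(1) gs f by simp
  show ?thesis unfolding body_def
  proof (rule wp_seq, rule wp_prepare[OF g _ _ _ frP])
    show "pS + (r 7 - 1) * ?w = P" unfolding P_def fs(1) gs by simp
    show "P + ?w \<le> V" "\<beta> + n * n \<le> V" using QV unfolding P_def Q_def by simp_all
    fix r1 \<tau>1 \<rho>' X' Y' px py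
    assume 1: "regs r1" "r1 7 = r 7" "r1 8 = P" "r1 9 = card X'" "r1 10 = card Y'" "r1 11 = px"
      "r1 12 = py" "r1 13 = \<rho>'" "r1 14 = \<beta> + \<rho>' * (n * n)" "card Y' \<le> card X'"
      "(\<rho>', X', Y', px, py) = (\<rho>, X, Y, P + 1, P + (1 + n)) \<or>
        (\<rho>', X', Y', px, py) = (1 - \<rho>, Y, X, P + (1 + n), P + 1)" "\<tau>1 \<le> \<tau> + 2 + 60 * n + 80"
    have fr: "m P = \<rho>" "\<rho> \<le> 1" "X \<subseteq> {..<n}" "Y \<subseteq> {..<n}" "X \<noteq> {}" "Y \<noteq> {}"
      "flags (P + 1) X n m" "flags (P + (1 + n)) Y n m" using frP by (auto simp: is_frame_def)
    have role: "\<rho>' \<le> 1" "\<rho>' = 0 \<or> \<rho>' = 1" using 1(11) fr(2) by auto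
    have XY': "X' \<subseteq> {..<n}" "Y' \<subseteq> {..<n}" "X' \<noteq> {}" "Y' \<noteq> {}" "flags px X' n m" "flags py Y' n m"
      "rect (\<rho>', X', Y') = rect (\<rho>, X, Y)" using 1(11) fr by auto
    have fin: "finite X'" "finite Y'" using XY' finite_subset by blast+
    have pos: "1 \<le> card X'" "1 \<le> card Y'" using XY' fin by (simp_all add: Suc_le_eq card_gt_0_iff One_nat_def)
    have lay: "pS \<le> px" "px + n \<le> Q" "pS \<le> py" "py + n \<le> Q" "px + n \<le> py \<or> py + n \<le> px"
      "P \<le> px" using 1(11) unfolding P_def Q_def by auto
    have pot': "pot d (card X') (card Y') = pot d (card X) (card Y)" using 1(11) pot_sym by auto
    have K': "keys (r1 14) (\<kappa> \<rho>') n m" "r1 14 + n * n \<le> pO" using K role(2) 1(9) by auto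
    have sym': "sym_on {..<n} (\<kappa> \<rho>')" using sym role(2) by auto
    \<comment> \<open>Scans of length \<open>n\<close> that depend on neither side are absorbed
      because both sides are nonempty; all costs then become proportional to
      \<open>|X'| + |Y'|\<close>.\<close>
    have t1: "\<tau>1 + 4 + card X' * (200 * n * (h + 1)) + card Y' * (40 * n + 50) + 210 * n + 250
        \<le> \<tau> + 1000 * n * (h + 1) * (card X' + card Y')"
    proof -
      define N where "N = n * (h + 1)"
      have nN: "n \<le> N" unfolding N_def by simp
      have "card Y' * (40 * n + 50) \<le> card Y' * (90 * N)" by (intro mult_le_mono2) (use nN n in linarith)
      moreover have "card Y' * (90 * N) = 90 * (card Y' * N)" by simp
      moreover have "card X' * (200 * n * (h + 1)) = 200 * (card X' * N)" unfolding N_def by simp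
      moreover have "N \<le> card X' * N" using pos by simp
      moreover have "1000 * n * (h + 1) * (card X' + card Y') = 1000 * (card X' * N) + 1000 * (card Y' * N)"
        unfolding N_def by (simp add: algebra_simps)
      ultimately show ?thesis using 1(12) nN n by linarith
    qed
    show "wp V (Cond (Monus (Reg 9) (Reg 3)) step base) (\<lambda>r m \<tau>. \<exists>k'<k. inv k' r m \<tau>) r1 m \<tau>1"
    proof (rule wp_cond)
      assume "val (Monus (Reg 9) (Reg 3)) (r1, m) \<noteq> 0"
      then have dX: "d < card X'" using 1(1,4) by (auto simp: regs_def)
      show "wp V step (\<lambda>r m \<tau>. \<exists>k'<k. inv k' r m \<tau>) r1 m (\<tau>1 + 1 + cost (Monus (Reg 9) (Reg 3)))"
      proof (rule wp_step[OF 1(1,3,4,5,6,7) refl _ _ _ XY'(5,1,6,2,4) lay(1-5) K'(2,1) S(1) d(1) 1(10) dX])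
        show "P + (1 + 2 * n) = Q" "Q \<le> V" "r1 7 < V" using QV lV 1(2) fs(1) by (simp_all add: Q_def)
        fix r2 m2 \<tau>2 U F a b
        assume 2: "regs r2" "r2 7 = r1 7 + 1" "U \<subseteq> X'" "card U = cdiv (card X') d" "b \<in> U"
          "segment Y' (cdiv (card Y') d) (\<kappa> \<rho>' b) F" "a \<in> F" "\<And>u. u \<in> U \<Longrightarrow> \<kappa> \<rho>' u a \<le> \<kappa> \<rho>' b a"
          "marks pO (S \<union> U \<times> {a} \<union> {b} \<times> Y') n m2" "flags px (X' - U) n m2" "flags py Y' n m2"
          "m2 Q = r1 13" "flags (Q + 1) U n m2" "flags (Q + (1 + n)) F n m2"
          "same_off ({px..<px + n} \<union> {pO..<pOut} \<union> {Q..<Q + (1 + 2 * n)}) m m2"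
          "\<tau>2 \<le> \<tau>1 + 1 + cost (Monus (Reg 9) (Reg 3)) + card X' * (200 * n * (h + 1)) +
             card Y' * (40 * n + 50) + 210 * n + 200"
        define S' where "S' = S \<union> U \<times> {a} \<union> {b} \<times> Y'"
        \<comment> \<open>The old frame is edited in place and keeps its stored role and the order
          of its sides, whereas the new frame is written in the current role
          \<open>\<rho>'\<close>.\<close>
        define f1 where "f1 = (if px = P + 1 then (\<rho>, X' - U, Y') else (\<rho>, Y', X' - U))"
        define f2 where "f2 = (\<rho>', U, F)"
        have Y: "F \<subseteq> Y'" "card F = cdiv (card Y') d" using 2(6) by (auto simp: segment_def)
        have finU: "finite U" using 2(3) fin(1) finite_subset by blast
        have U1: "card U < card X'" unfolding 2(4) using d dX by (intro cdiv_less) auto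
        have neU: "X' - U \<noteq> {}"
        proof
          assume "X' - U = {}"
          then have "card X' \<le> card U" using finU by (intro card_mono) auto
          then show False using U1 by simp
        qed
        have S'n: "S' \<subseteq> {..<n} \<times> {..<n}"
          unfolding S'_def using S(2) 2(3,5,7) XY'(1,2) Y(1) by auto
        have cS': "card S' \<le> card S + cdiv (card X') d + card Y'"
        proof -
          have "card S' \<le> card S + card (U \<times> {a}) + card ({b} \<times> Y')"
            unfolding S'_def by (meson add_le_mono1 card_Un_le le_trans)
          then show ?thesis by (simp add: card_cartesian_product 2(4))
        qed
        have pxP: "px = P + 1 \<and> \<rho>' = \<rho> \<and> py = P + (1 + n) \<or> px = P + (1 + n) \<and> \<rho>' = 1 - \<rho> \<and> py = P + 1"
          using 1(11) by auto
        have rf1: "rect f1 = rect (\<rho>', X' - U, Y')"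
          unfolding f1_def using pxP fr(2) n by auto
        have pf1: "fpot d f1 = pot d (card X' - cdiv (card X') d) (card Y')"
          unfolding f1_def using 2(3,4) finU pot_sym by (simp add: card_Diff_subset)
        have pf2: "fpot d f2 = pot d (cdiv (card X') d) (cdiv (card Y') d)"
          unfolding f2_def using 2(4) Y(2) by simp
        have drop: "2 * (cdiv (card X') d + card Y') + fpot d f2 + fpot d f1 \<le> pot d (card X') (card Y')"
          unfolding pf1 pf2 by (rule pot_step[OF d(1) 1(10) dX])
        define kk where "kk = sum_list (map (fpot d) (gs @ [f1, f2]))"
        have k': "kk + 2 * (cdiv (card X') d + card Y') \<le> k" using drop rest pot' by (simp add: kk_def)
        have fr1: "is_frame P f1 m2"
        proof -
          have "m2 P = \<rho>" using same_offD[OF 2(15), of P] fr(1) lay(6) pxP unfolding P_def Q_def by auto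
          then show ?thesis using 2(10,11) pxP fr(2) XY'(1,2,4) neU n
            unfolding f1_def is_frame_def by auto
        qed
        have fr2: "is_frame Q f2 m2"
          using 2(3,5,7,12,13,14) 1(8) role(1) XY'(1,2) Y(1) unfolding f2_def is_frame_def by auto
        have "frames gs m2"
          by (rule frames_same[OF frg 2(15)]) (use lay(6) in \<open>auto simp: P_def Q_def\<close>)
        moreover have "is_frame (pS + (length gs + i) * ?w) ([f1, f2] ! i) m2" if "i < 2" for i
        proof -
          have "i = 0 \<or> i = 1" using that by auto
          then show ?thesis using fr1 fr2 by (auto simp: P_def Q_def algebra_simps)
        qed
        ultimately have frs: "frames (gs @ [f1, f2]) m2" unfolding frames_append by simp
        have cov': "covered S' (gs @ [f1, f2])"
        proof (rule covered_update[OF cov[unfolded gs]])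
          show "S \<subseteq> S'" unfolding S'_def by auto
          have main: "reach (\<kappa> \<rho>') S' u v \<or> u \<in> X' - U \<or> (u, v) \<in> U \<times> F" if uv: "u \<in> X'" "v \<in> Y'" for u v
          proof -
            have "reach (\<kappa> \<rho>') S' u v" if "u \<in> U" "v \<notin> F"
            proof (rule reach_star[OF sym' _ _ 2(5) _ 2(8) _ _ that(1)])
              show "\<kappa> \<rho>' b a \<le> \<kappa> \<rho>' b v" using 2(6,7) uv that unfolding segment_def by blast
            qed (use 2(3,7) Y(1) XY'(1,2) uv in \<open>auto simp: S'_def adj_def\<close>)
            then show ?thesis using uv by blast
          qed
          fix u v assume uv: "(u, v) \<in> rect f"
          then have uv': "(u, v) \<in> rect (\<rho>', X', Y')" unfolding XY'(7) f .
          show "reach (\<kappa> 0) S' u v \<or> (\<exists>f\<in>set [f1, f2]. (u, v) \<in> rect f)"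
          proof (cases "\<rho>' = 0")
            case True
            then show ?thesis using main[of u v] uv' rf1 unfolding f2_def by auto
          next
            case False
            then have r1: "\<rho>' = 1" using role by simp
            have "reach (\<kappa> \<rho>') S' v u \<or> v \<in> X' - U \<or> (v, u) \<in> U \<times> F"
              using main[of v u] uv' False by auto
            then show ?thesis using reach_role[OF _ role(1) S'n, of v u] uv' rf1 False
              unfolding f2_def by auto
          qed
        qed
        have K2: "keys \<beta> (\<kappa> 0) n m2" "keys (\<beta> + n * n) (\<kappa> 1) n m2"
          by (rule keys_same[OF K(1) 2(15)], use lay(1) in \<open>auto simp: P_def Q_def\<close>)
            (rule keys_same[OF K(2) 2(15)], use lay(1) in \<open>auto simp: P_def Q_def\<close>)
        have "0 < card Y'" using pos(2) by (rule less_le_trans[OF zero_less_one])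
        then have "kk < kk + 2 * (cdiv (card X') d + card Y')" by simp
        then have "kk < k" using k' by (rule less_le_trans)
        moreover have "inv kk r2 m2 \<tau>2"
          unfolding inv_def
        proof (intro conjI exI[of _ "gs @ [f1, f2]"] exI[of _ S'])
          show "r2 7 = length (gs @ [f1, f2])" using 2(2) 1(2) fs(1) by (simp add: gs)
          show "marks pO S' n m2" using 2(9) unfolding S'_def .
          show "2 * card S' + kk \<le> pot0" using mult_le_mono2[OF cS', of 2] k' k(2) by simp
          have "card X' \<le> cdiv (card X') d * d" using d by (intro cdiv_mult_ge) simp
          moreover have "card Y' \<le> card Y' * d" using d by simp
          moreover have "d * (2 * (cdiv (card X') d + card Y')) =
              (cdiv (card X') d * d + card Y' * d) + (cdiv (card X') d * d + card Y' * d)"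
            by (simp add: algebra_simps)
          \<comment> \<open>This is where the factor \<open>d\<close> in the running time arises:
            the cost is proportional to \<open>|X'|\<close>, but only \<open>|U|\<close>, which is
            at least \<open>|X'| / d\<close>, is released as potential.\<close>
          ultimately have "card X' + card Y' \<le> d * (2 * (cdiv (card X') d + card Y'))" by linarith
          then have "1000 * n * (h + 1) * (card X' + card Y') \<le>
              1000 * n * (h + 1) * (d * (2 * (cdiv (card X') d + card Y')))" by (rule mult_le_mono2)
          then have "1000 * n * (h + 1) * (card X' + card Y') \<le> ?D * (2 * (cdiv (card X') d + card Y'))"
            by (simp only: mult.assoc)
          moreover have "?D * kk + ?D * (2 * (cdiv (card X') d + card Y')) \<le> ?D * k"
            using mult_le_mono2[OF k', of ?D] by (simp only: add_mult_distrib2)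
          moreover have "cost (Monus (Reg 9) (Reg 3)) = 3" by simp
          ultimately show "\<tau>2 + ?D * kk \<le> T0"
            using t1 2(16) k(3) by linarith
        qed (use 2 S'n K2 frs cov' kk_def in auto)
        ultimately show "\<exists>k'<k. inv k' r2 m2 \<tau>2" by blast
      qed
    next
      assume "val (Monus (Reg 9) (Reg 3)) (r1, m) = 0"
      then have dX: "card X' \<le> d" using 1(1,4) by (auto simp: regs_def)
      show "wp V base (\<lambda>r m \<tau>. \<exists>k'<k. inv k' r m \<tau>) r1 m (\<tau>1 + 1 + cost (Monus (Reg 9) (Reg 3)))"
      proof (rule wp_base[OF 1(1,6,7) XY'(5,1) lay(1) XY'(6,2) lay(3) S(1)])
        fix r2 m2 \<tau>2
        assume 2: "regs r2" "r2 7 = r1 7 - 1" "same_off {pO..<pF} m m2" "marks pO (S \<union> X' \<times> Y') n m2"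
          "\<tau>2 \<le> \<tau>1 + 1 + cost (Monus (Reg 9) (Reg 3)) + card X' * (40 * n + 30) + 20 * n + 20"
        let ?S = "S \<union> X' \<times> Y'" and ?k = "sum_list (map (fpot d) gs)"
        have Sn: "?S \<subseteq> {..<n} \<times> {..<n}" using S(2) XY' by auto
        have "card ?S \<le> card S + card (X' \<times> Y')" by (rule card_Un_le)
        then have cS: "card ?S \<le> card S + card X' * card Y'" by (simp add: card_cartesian_product)
        have pb: "2 * (card X' * card Y') \<le> pot d (card X') (card Y')"
          "card X' + card Y' \<le> pot d (card X') (card Y')"
          using pot_base[OF d(1), of "card X'" "card Y'"] dX 1(10) by auto
        have k': "?k + pot d (card X') (card Y') = k" using rest pot' by simp
        have cov': "covered ?S (gs @ [])"
        proof (rule covered_update[OF cov[unfolded gs]])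
          fix u v assume uv: "(u, v) \<in> rect f"
          then have "(u, v) \<in> rect (\<rho>', X', Y')" unfolding XY'(7) f .
          then have "adj ?S u v" by (auto simp: adj_def split: if_splits)
          moreover have "\<kappa> 0 u v = \<kappa> 0 v u" using sym(1) uv fr(3,4) f by (auto simp: sym_on_def split: if_splits)
          ultimately show "reach (\<kappa> 0) ?S u v \<or> (\<exists>f\<in>set []. (u, v) \<in> rect f)"
            using reach_edge by auto
        qed simp
        have "frames gs m2" by (rule frames_same[OF frg 2(3)]) auto
        moreover have "keys \<beta> (\<kappa> 0) n m2" by (rule keys_same[OF K(1) 2(3)]) auto
        moreover have "keys (\<beta> + n * n) (\<kappa> 1) n m2" by (rule keys_same[OF K(2) 2(3)]) auto
        moreover have "\<tau>2 + ?D * ?k \<le> T0"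
        proof -
          have a: "card X' * (40 * n + 30) \<le> card X' * (200 * n * (h + 1))"
            by (intro mult_le_mono2) (use n in \<open>simp add: algebra_simps\<close>)
          have "card X' + card Y' \<le> d * pot d (card X') (card Y')"
            using pb(2) d mult_le_mono1[of 1 d "pot d (card X') (card Y')"] by linarith
          then have "1000 * n * (h + 1) * (card X' + card Y') \<le>
              1000 * n * (h + 1) * (d * pot d (card X') (card Y'))" by (rule mult_le_mono2)
          then have "1000 * n * (h + 1) * (card X' + card Y') \<le> ?D * pot d (card X') (card Y')"
            by (simp only: mult.assoc)
          moreover have "?D * ?k + ?D * pot d (card X') (card Y') = ?D * k"
            unfolding k'[symmetric] by (simp only: add_mult_distrib2)
          moreover have "cost (Monus (Reg 9) (Reg 3)) = 3" by simp
          ultimately show ?thesis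
            using t1 2(5) k(3) a by linarith
        qed
        ultimately have "inv ?k r2 m2 \<tau>2"
          unfolding inv_def using 2(1,2,4) 1(2) fs(1) Sn cov' cS pb(1) k' k(2)
          by (intro conjI exI[of _ gs] exI[of _ ?S]) (auto simp: gs)
        moreover have "?k < k" using k' pb(2) pos by linarith
        ultimately show "\<exists>k'<k. inv k' r2 m2 \<tau>2" by blast
      qed
    qed (simp add: simple_def)
  qed
qed

lemma wp_main_loop:
  assumes "inv k r m \<tau>"
    and Q: "\<And>r' m' \<tau>' S. regs r' \<Longrightarrow> S \<subseteq> {..<n} \<times> {..<n} \<Longrightarrow> marks pO S n m' \<Longrightarrow> keys \<beta> (\<kappa> 0) n m' \<Longrightarrow>
      (\<And>u v. u < n \<Longrightarrow> v < n \<Longrightarrow> reach (\<kappa> 0) S u v) \<Longrightarrow> 2 * card S \<le> pot0 \<Longrightarrow> \<tau>' \<le> T0 + 2 \<Longrightarrow> Q r' m' \<tau>'"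
  shows "wp V main_loop Q r m \<tau>"
  unfolding main_loop_def
proof (rule wp_while[where I = inv, OF _ assms(1)])
  fix k r m \<tau> assume "inv k r m \<tau>" "val (Reg 7) (r, m) \<noteq> 0"
  then show "wp V body (\<lambda>r m \<tau>. \<exists>k'<k. inv k' r m \<tau>) r m (\<tau> + 1 + cost (Reg 7))"
    using wp_body[of k r m \<tau>] by (simp add: add.assoc)
next
  fix k r m \<tau> assume I: "inv k r m \<tau>" "val (Reg 7) (r, m) = 0"
  then obtain S where "S \<subseteq> {..<n} \<times> {..<n}" "marks pO S n m" "keys \<beta> (\<kappa> 0) n m" "covered S []"
    "2 * card S \<le> pot0" "regs r" "\<tau> \<le> T0"
    unfolding inv_def by auto
  then show "Q r m (\<tau> + 1 + cost (Reg 7))"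
    by (intro Q[where S = S]) (auto simp: covered_def)
qed (simp add: simple_def)

end

section \<open>Parameters, input and output\<close>

lemma kpar_eqI:
  assumes "1 \<le> k" "n \<le> 2 ^ (k * (k + 1))" "\<And>i. 1 \<le> i \<Longrightarrow> i < k \<Longrightarrow> 2 ^ (i * (i + 1)) < n"
  shows "kpar n = k"
  unfolding kpar_def
proof (rule Least_equality)
  fix y assume "1 \<le> y \<and> n \<le> 2 ^ (y * (y + 1))"
  then show "k \<le> y" using assms(3)[of y] by (meson not_less)
qed (use assms in simp)

lemma dpar_eqI:
  assumes "2 \<le> d" "n \<le> d ^ kpar n" "\<And>i. 2 \<le> i \<Longrightarrow> i < d \<Longrightarrow> i ^ kpar n < n"
  shows "dpar n = d"
  unfolding dpar_def
proof (rule Least_equality)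
  fix y assume "2 \<le> y \<and> n \<le> y ^ kpar n"
  then show "d \<le> y" using assms(3)[of y] by (meson not_less)
qed (use assms in simp)

text \<open>From \<open>k\<close> to \<open>k + 1\<close> the exponent \<open>k * (k + 1)\<close>
  grows by \<open>2 * (k + 1)\<close>, so one multiplication by \<open>4 ^ (k + 1)\<close> updates
  the power. Before each round both \<open>2 ^ (k * (k + 1))\<close> and \<open>4 ^ k\<close> are
  below \<open>n\<close>, which keeps the next values within \<open>4 * (n * n)\<close>.\<close>

lemma wp_find_k:
  assumes r: "r 0 = n" and V: "2 \<le> n" "4 * (n * n) \<le> V"
    and R: "\<And>r' \<tau>'. same_off {4, 5, 28} r r' \<Longrightarrow> r' 28 = kpar n \<Longrightarrow> \<tau>' \<le> \<tau> + 40 * n + 20 \<Longrightarrow> R r' m \<tau>'"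
  shows "wp V find_k R r m \<tau>"
proof -
  let ?I = "\<lambda>x r' m' \<tau>'. \<exists>k. m' = m \<and> same_off {4, 5, 28} r r' \<and> r' 28 = k \<and> 1 \<le> k \<and> r' 4 = 4 ^ k \<and>
    r' 5 = 2 ^ (k * (k + 1)) \<and> (\<forall>i. 1 \<le> i \<longrightarrow> i < k \<longrightarrow> 2 ^ (i * (i + 1)) < n) \<and> x = n - r' 5 \<and>
    \<tau>' + 40 * x \<le> \<tau> + 40 * n + 10"
  have "2 * 2 \<le> n * n" using V(1) by (intro mult_le_mono)
  then have nn: "n \<le> n * n" "4 \<le> V" using V(2) by simp_all
  have loop: "wp V (While (Monus (Reg 0) (Reg 5)) find_k_body) R
     (r(28 := 1, 4 := 4, 5 := 4)) m (\<tau> + 6)"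
  proof (rule wp_while[where I = ?I])
    show "?I (n - 4) (r(28 := 1, 4 := 4, 5 := 4)) m (\<tau> + 6)"
      by (intro exI[of _ 1]) (auto simp: same_off_def)
  next
    fix x r1 m1 \<tau>1 assume "?I x r1 m1 \<tau>1" and nz: "val (Monus (Reg 0) (Reg 5)) (r1, m1) \<noteq> 0"
    then obtain k where I: "m1 = m" "same_off {4, 5, 28} r r1" "r1 28 = k" "1 \<le> k" "r1 4 = 4 ^ k"
      "r1 5 = 2 ^ (k * (k + 1))" "\<And>i. 1 \<le> i \<Longrightarrow> i < k \<Longrightarrow> 2 ^ (i * (i + 1)) < n" "x = n - r1 5"
      "\<tau>1 + 40 * x \<le> \<tau> + 40 * n + 10" by blast
    have r1: "r1 0 = n" using same_offD[OF I(2), of 0] r by simp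
    have pn: "2 ^ (k * (k + 1)) < n" using nz I r1 by simp
    have "(4::nat) ^ k = 2 ^ (2 * k)" by (simp add: power_mult)
    also have "\<dots> \<le> 2 ^ (k * (k + 1))" using I(4) by (intro power_increasing) auto
    finally have e: "4 ^ k < n" using pn by simp
    have k1: "k + 1 \<le> n"
    proof -
      have "k < 4 ^ k" using less_exp[of k] power_mono[of "2::nat" 4 k] by linarith
      then show ?thesis using e by simp
    qed
    have p1: "2 ^ (k * (k + 1)) * (4 * 4 ^ k) = (2::nat) ^ ((k + 1) * (k + 1 + 1))"
    proof -
      have "(4::nat) * 4 ^ k = 2 ^ (2 * (k + 1))" by (simp add: power_mult power_add)
      then show ?thesis by (simp only: power_add[symmetric]) (simp add: algebra_simps)
    qed
    have b1: "2 ^ (k * (k + 1)) * (4 * 4 ^ k) \<le> V"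
    proof -
      have "2 ^ (k * (k + 1)) * (4 * 4 ^ k) \<le> n * (4 * n)" using pn e by (intro mult_le_mono) auto
      then show ?thesis using V by simp
    qed
    have b2: "4 * 4 ^ k \<le> V" using e nn V by linarith
    have b3: "k + 1 \<le> V" using k1 nn V by linarith
    let ?p' = "(2::nat) ^ ((k + 1) * (k + 1 + 1))"
    have gt: "2 ^ (k * (k + 1)) < ?p'" by (intro power_strict_increasing) auto
    have fin: "\<exists>x'<x. ?I x' (r1(28 := k + 1, 4 := 4 * 4 ^ k, 5 := ?p')) m \<tau>2" if "\<tau>2 \<le> \<tau>1 + 40" for \<tau>2
    proof (rule exI[of _ "n - ?p'"], intro conjI exI[of _ "k + 1"])
      show lt: "n - ?p' < x" unfolding I(8,6) by (rule diff_less_mono2[OF gt pn])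
      show "\<forall>i. 1 \<le> i \<longrightarrow> i < k + 1 \<longrightarrow> 2 ^ (i * (i + 1)) < n"
        using I(7) pn by (metis Suc_eq_plus1 less_Suc_eq)
      show "(r1(28 := k + 1, 4 := 4 * 4 ^ k, 5 := ?p')) 4 = 4 ^ (k + 1)" by (simp add: power_add)
      have "n - ?p' + 1 \<le> x" using lt by linarith
      then show "\<tau>2 + 40 * (n - ?p') \<le> \<tau> + 40 * n + 10" using that I(9) by simp
    qed (use I in \<open>auto simp: same_off_def\<close>)
    show "wp V find_k_body
       (\<lambda>r m \<tau>. \<exists>x'<x. ?I x' r m \<tau>) r1 m1 (\<tau>1 + 1 + cost (Monus (Reg 0) (Reg 5)))"
    proof -
      have gen: "wp V find_k_body R'
        r1 m1 (\<tau>1 + 1 + cost (Monus (Reg 0) (Reg 5)))"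
        if "\<And>\<tau>2. \<tau>2 \<le> \<tau>1 + 40 \<Longrightarrow> R' (r1(28 := k + 1, 4 := 4 * 4 ^ k, 5 := ?p')) m \<tau>2" for R'
        using that I(1,3,5,6) b1 b2 b3 p1 by (intro wp_pre) (simp add: simple_def find_k_body_def)
      show ?thesis by (rule gen) (rule fin)
    qed
  next
    fix x r1 m1 \<tau>1 assume "?I x r1 m1 \<tau>1" and nz: "val (Monus (Reg 0) (Reg 5)) (r1, m1) = 0"
    then obtain k where I: "m1 = m" "same_off {4, 5, 28} r r1" "r1 28 = k" "1 \<le> k"
      "r1 5 = 2 ^ (k * (k + 1))" "\<And>i. 1 \<le> i \<Longrightarrow> i < k \<Longrightarrow> 2 ^ (i * (i + 1)) < n"
      "\<tau>1 + 40 * x \<le> \<tau> + 40 * n + 10" by blast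
    have r1: "r1 0 = n" using same_offD[OF I(2), of 0] r by simp
    then have "kpar n = k" using I nz by (intro kpar_eqI) auto
    then show "R r1 m1 (\<tau>1 + 1 + cost (Monus (Reg 0) (Reg 5)))" using I by (auto intro!: R)
  qed (simp add: simple_def)
  show ?thesis unfolding find_k_def
    using loop nn by (intro wp_seq_pre) (simp add: simple_def add.assoc)
qed

text \<open>Register 5 is multiplied only while it is below \<open>n\<close>, so it never exceeds
  \<open>n * n\<close>. Capping preserves the comparison of the power with \<open>n\<close>, since
  powers of \<open>d \<ge> 1\<close> do not decrease.\<close>

lemma wp_power_capped:
  assumes r: "r 0 = n" "r 28 = k" "r 3 = d" "r 5 = 1" and V: "2 \<le> n" "4 * (n * n) \<le> V" "1 \<le> d" "d \<le> n" "k < V"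
    and R: "\<And>r' \<tau>'. same_off {5, 17} r r' \<Longrightarrow> r' 5 < n \<longleftrightarrow> d ^ k < n \<Longrightarrow> \<tau>' \<le> \<tau> + 30 * k + 10 \<Longrightarrow> R r' m \<tau>'"
  shows "wp V capped_power R r m \<tau>"
proof -
  let ?I = "\<lambda>j r' m' \<tau>'. r' 17 = j \<and> m' = m \<and> same_off {5, 17} r r' \<and>
    (r' 5 < n \<longrightarrow> r' 5 = d ^ j) \<and> (n \<le> r' 5 \<longrightarrow> n \<le> d ^ j) \<and> \<tau>' \<le> \<tau> + 30 * j + 2"
  show ?thesis unfolding capped_power_def
  proof (rule wp_for[where N = k and I = ?I])
    fix j r1 m1 \<tau>1 assume I: "?I j r1 m1 \<tau>1"
    have r1: "r1 0 = n" "r1 3 = d" using I r same_offD[of _ r r1] by auto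
    have up: "d ^ j \<le> d ^ Suc j" using V by (intro power_increasing) auto
    have b: "d ^ j * d \<le> V" if "d ^ j < n"
    proof -
      have "d ^ j * d \<le> n * n" using that V by (intro mult_le_mono) auto
      then show ?thesis using V by simp
    qed
    let ?r = "r1(5 := if r1 5 < n then r1 5 * d else r1 5)"
    have gen: "wp V (Cond (Monus (Reg 0) (Reg 5)) (Assign 5 (Times (Reg 5) (Reg 3))) Skip) R' r1 m1 (\<tau>1 + 4)"
      if "\<And>\<tau>2. \<tau>2 \<le> \<tau>1 + 20 \<Longrightarrow> R' ?r m1 \<tau>2" for R'
      using that r1 b I by (intro wp_pre, cases "r1 5 < n") (simp_all add: simple_def)
    show "wp V (Cond (Monus (Reg 0) (Reg 5)) (Assign 5 (Times (Reg 5) (Reg 3))) Skip)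
        (\<lambda>r' m' \<tau>'. r' 17 = j \<and> ?I (Suc j) (r'(17 := Suc j)) m' (\<tau>' + 4)) r1 m1 (\<tau>1 + 4)"
    proof (rule gen, intro conjI)
      show "same_off {5, 17} r (?r(17 := Suc j))" using I by (auto simp: same_off_def)
      show "n \<le> (?r(17 := Suc j)) 5 \<longrightarrow> n \<le> d ^ Suc j"
        using I up by (cases "r1 5 < n") (auto simp: mult.commute intro: order_trans)
      show "(?r(17 := Suc j)) 5 < n \<longrightarrow> (?r(17 := Suc j)) 5 = d ^ Suc j"
        using I by (cases "r1 5 < n") (auto simp: mult.commute)
    qed (use I in auto)
  next
    fix r1 m1 \<tau>1 assume I: "?I k r1 m1 \<tau>1"
    then have "r1 5 < n \<longleftrightarrow> d ^ k < n" by (cases "r1 5 < n") auto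
    then show "R r1 m1 (\<tau>1 + 4)" using I by (auto intro!: R)
  next
    fix j r1 m1 \<tau>1 assume I: "?I j r1 m1 \<tau>1"
    then show "r1 17 = j \<and> r1 28 = k" using r same_offD[of _ r r1] by auto
  qed (use r V in \<open>auto simp: same_off_def\<close>)
qed

lemma kpar_le: "2 \<le> n \<Longrightarrow> kpar n \<le> n" and two_power_kpar: "2 \<le> n \<Longrightarrow> 2 ^ (kpar n - 1) \<le> n"
proof -
  assume n: "2 \<le> n"
  show p: "2 ^ (kpar n - 1) \<le> n"
  proof (cases "kpar n = 1")
    case False
    then have k: "1 < kpar n" using kpar_props(1)[of n] by simp
    have "(2::nat) ^ (kpar n - 1) \<le> 2 ^ ((kpar n - 1) * kpar n)"
      using k by (intro power_increasing) auto
    also have "\<dots> < n" by (rule kpar_less[OF k])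
    finally show ?thesis by simp
  qed (use n in simp)
  have "kpar n - 1 < 2 ^ (kpar n - 1)" by simp
  then show "kpar n \<le> n" using p by linarith
qed

lemma dpar_le: "2 \<le> n \<Longrightarrow> dpar n \<le> n"
proof -
  assume n: "2 \<le> n"
  have "n ^ 1 \<le> n ^ kpar n" using kpar_props(1)[of n] n by (intro power_increasing) auto
  then show ?thesis unfolding dpar_def using n
    by (intro Least_le[where P = "\<lambda>d. 2 \<le> d \<and> n \<le> d ^ kpar n"]) simp
qed

text \<open>The initial values 1 and 0 make 2 the first candidate. The search ends at
  \<open>n\<close> at the latest because \<open>n ^ kpar n \<ge> n\<close>. At most \<open>n\<close>
  candidates with at most \<open>kpar n \<le> n\<close> rounds each give quadratic time.\<close>

lemma wp_find_d:
  assumes r: "r 0 = n" "r 28 = kpar n" and V: "2 \<le> n" "4 * (n * n) \<le> V"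
    and R: "\<And>r' \<tau>'. same_off {3, 5, 17} r r' \<Longrightarrow> r' 3 = dpar n \<Longrightarrow> \<tau>' \<le> \<tau> + 50 * (n * n) + 20 \<Longrightarrow> R r' m \<tau>'"
  shows "wp V find_d R r m \<tau>"
proof -
  let ?k = "kpar n"
  let ?I = "\<lambda>x r' m' \<tau>'. \<exists>d. m' = m \<and> same_off {3, 5, 17} r r' \<and> r' 3 = d \<and> 1 \<le> d \<and> d \<le> n \<and>
    (\<forall>i. 2 \<le> i \<longrightarrow> i < d \<longrightarrow> i ^ ?k < n) \<and> (r' 5 < n \<longrightarrow> d = 1 \<or> d ^ ?k < n) \<and>
    (n \<le> r' 5 \<longrightarrow> 2 \<le> d \<and> n \<le> d ^ ?k) \<and> x = n - d \<and> \<tau>' + (50 * n) * x \<le> \<tau> + 50 * (n * n) + 10"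
  have a: "n \<le> n * n" "n * n < 4 * (n * n)" using V(1) by simp_all
  then have "n < V" using V(2) by linarith
  then have nn: "n \<le> n * n" "1 \<le> V" "n < V" using a V(1) by linarith+
  have loop: "wp V (While (Monus (Reg 0) (Reg 5)) (Seq (Seq (Assign 3 (Plus (Reg 3) (Const 1))) (Assign 5 (Const 1)))
       capped_power)) R
     (r(3 := 1, 5 := 0)) m (\<tau> + 4)"
  proof (rule wp_while[where I = ?I])
    show "?I (n - 1) (r(3 := 1, 5 := 0)) m (\<tau> + 4)"
      using V by (intro exI[of _ 1]) (auto simp: same_off_def diff_mult_distrib2)
  next
    fix x r1 m1 \<tau>1 assume "?I x r1 m1 \<tau>1" and nz: "val (Monus (Reg 0) (Reg 5)) (r1, m1) \<noteq> 0"
    then obtain d where I: "m1 = m" "same_off {3, 5, 17} r r1" "r1 3 = d" "1 \<le> d" "d \<le> n"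
      "\<And>i. 2 \<le> i \<Longrightarrow> i < d \<Longrightarrow> i ^ ?k < n" "r1 5 < n \<Longrightarrow> d = 1 \<or> d ^ ?k < n" "x = n - d"
      "\<tau>1 + (50 * n) * x \<le> \<tau> + 50 * (n * n) + 10" by blast
    have r1: "r1 0 = n" "r1 28 = ?k" using same_offD[OF I(2)] r by simp_all
    have lt: "i ^ ?k < n" if "2 \<le> i" "i < d + 1" for i
    proof (cases "i = d")
      case True
      then show ?thesis using I(7) nz r1 that by auto
    next
      case False
      then show ?thesis using I(6) that by simp
    qed
    have dn: "d + 1 \<le> n"
    proof (rule ccontr)
      assume "\<not> d + 1 \<le> n"
      then have "n ^ ?k < n" using lt[of n] V by simp
      moreover have "n ^ 1 \<le> n ^ ?k" using kpar_props(1)[of n] V by (intro power_increasing) auto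
      ultimately show False by simp
    qed
    have gen: "wp V (Seq (Seq (Assign 3 (Plus (Reg 3) (Const 1))) (Assign 5 (Const 1)))
       capped_power) R' r1 m1
       (\<tau>1 + 1 + cost (Monus (Reg 0) (Reg 5)))"
      if *: "\<And>r2 \<tau>2. same_off {5, 17} (r1(3 := d + 1, 5 := 1)) r2 \<Longrightarrow> r2 5 < n \<longleftrightarrow> (d + 1) ^ ?k < n \<Longrightarrow>
        \<tau>2 \<le> \<tau>1 + 30 * n + 40 \<Longrightarrow> R' r2 m \<tau>2" for R'
    proof (rule wp_seq_pre)
      have "wp V capped_power R'
        (r1(3 := d + 1, 5 := 1)) m (\<tau>1 + 10)"
      proof (rule wp_power_capped[where n = n and d = "d + 1" and k = ?k])
        fix r2 \<tau>2 assume 2: "same_off {5, 17} (r1(3 := d + 1, 5 := 1)) r2" "r2 5 < n \<longleftrightarrow> (d + 1) ^ ?k < n"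
          "\<tau>2 \<le> \<tau>1 + 10 + 30 * ?k + 10"
        then show "R' r2 m \<tau>2" using kpar_le[OF V(1)] by (intro *) auto
      qed (use r1 V dn nn kpar_le[OF V(1)] in auto)
      then show "pre V (Seq (Assign 3 (Plus (Reg 3) (Const 1))) (Assign 5 (Const 1)))
        (wp V capped_power R') r1 m1
        (\<tau>1 + 1 + cost (Monus (Reg 0) (Reg 5)))"
        using I(1,3) dn nn by (simp add: simple_def add.assoc)
    qed
    show "wp V (Seq (Seq (Assign 3 (Plus (Reg 3) (Const 1))) (Assign 5 (Const 1)))
       capped_power)
       (\<lambda>r m \<tau>. \<exists>x'<x. ?I x' r m \<tau>) r1 m1 (\<tau>1 + 1 + cost (Monus (Reg 0) (Reg 5)))"
    proof (rule gen)
      fix r2 \<tau>2 assume 2: "same_off {5, 17} (r1(3 := d + 1, 5 := 1)) r2" "r2 5 < n \<longleftrightarrow> (d + 1) ^ ?k < n"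
        "\<tau>2 \<le> \<tau>1 + 30 * n + 40"
      show "\<exists>x'<x. ?I x' r2 m \<tau>2"
      proof (rule exI[of _ "n - (d + 1)"], intro conjI exI[of _ "d + 1"])
        show "same_off {3, 5, 17} r r2" using I(2) 2(1) by (auto simp: same_off_def)
        show "r2 3 = d + 1" using same_offD[OF 2(1), of 3] by simp
        have "x = n - (d + 1) + 1" using I(8) dn by simp
        then have "(50 * n) * x = (50 * n) * (n - (d + 1)) + 50 * n" by (simp only: add_mult_distrib2 mult_1_right)
        then show "\<tau>2 + (50 * n) * (n - (d + 1)) \<le> \<tau> + 50 * (n * n) + 10"
          using I(9) 2(3) V(1) by simp
      qed (use I lt dn 2(2) in auto)
    qed
  next
    fix x r1 m1 \<tau>1 assume "?I x r1 m1 \<tau>1" and nz: "val (Monus (Reg 0) (Reg 5)) (r1, m1) = 0"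
    then obtain d where I: "m1 = m" "same_off {3, 5, 17} r r1" "r1 3 = d"
      "\<And>i. 2 \<le> i \<Longrightarrow> i < d \<Longrightarrow> i ^ ?k < n" "n \<le> r1 5 \<Longrightarrow> 2 \<le> d \<and> n \<le> d ^ ?k"
      "\<tau>1 \<le> \<tau> + 50 * (n * n) + 10" by auto
    have r1: "r1 0 = n" using same_offD[OF I(2), of 0] r by simp
    then have "dpar n = d" using I nz by (intro dpar_eqI) auto
    then show "R r1 m1 (\<tau>1 + 1 + cost (Monus (Reg 0) (Reg 5)))" using I by (auto intro!: R)
  qed (simp add: simple_def)
  show ?thesis unfolding find_d_def
    using loop nn by (intro wp_seq_pre) (simp add: simple_def add.assoc)
qed

context layout
begin

text \<open>Progress is lexicographic: all rows before \<open>j\<close> and the first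
  \<open>i\<close> entries of row \<open>j\<close>. On the diagonal only the bound by the maximum is
  recorded.\<close>

definition loaded :: "(nat \<Rightarrow> nat \<Rightarrow> nat) \<Rightarrow> nat \<Rightarrow> nat \<Rightarrow> (nat \<Rightarrow> nat) \<Rightarrow> nat \<Rightarrow> bool" where
  "loaded lab j i m M \<longleftrightarrow> (\<forall>u<n. \<forall>v<n. (u < j \<or> u = j \<and> v < i) \<longrightarrow>
     (u \<noteq> v \<longrightarrow> m (\<beta> + u * n + v) = lab u v) \<and> m (\<beta> + u * n + v) \<le> M)"

lemma wp_load_cell:
  assumes r: "regs r" "r 17 = u" "r 18 = v" and uv: "u < n" "v < n"
    and lab: "\<And>u v. u < v \<Longrightarrow> v < n \<Longrightarrow> m (m (2 + 2 * (u * n + v))) = lab u v"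
      "\<And>u v. lab u v = lab v u"
    and I: "loaded lab u v m (r 6)"
    and R: "\<And>r' m' \<tau>'. same_off {6, 27} r r' \<Longrightarrow> same_off {\<beta>..<\<beta> + n * n} m m' \<Longrightarrow>
      loaded lab u (Suc v) m' (r' 6) \<Longrightarrow> \<tau>' \<le> \<tau> + 60 \<Longrightarrow> R r' m' \<tau>'"
  shows "wp V load_cell R r m \<tau>"
proof -
  have r': "r 0 = n" "r 1 = \<beta>" using r by (auto simp: regs_def)
  have main: "R (r(27 := x, 6 := max x (r 6))) (m(\<beta> + u * n + v := x)) \<tau>'"
    if x: "u \<noteq> v \<longrightarrow> x = lab u v" and t: "\<tau>' \<le> \<tau> + 60" for x \<tau>'
  proof (rule R[OF _ _ _ t])
    show "same_off {\<beta>..<\<beta> + n * n} m (m(\<beta> + u * n + v := x))"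
      using index_less[OF uv] by (intro same_off_upd) auto
    show "loaded lab u (Suc v) (m(\<beta> + u * n + v := x)) ((r(27 := x, 6 := max x (r 6))) 6)"
      unfolding loaded_def
    proof (intro allI impI)
      fix u' v' assume a: "u' < n" "v' < n" "u' < u \<or> u' = u \<and> v' < Suc v"
      have e: "\<beta> + u' * n + v' = \<beta> + u * n + v \<longleftrightarrow> u' = u \<and> v' = v"
        using index_inj[OF a(2) uv(2), of u' u] by auto
      show "(u' \<noteq> v' \<longrightarrow> (m(\<beta> + u * n + v := x)) (\<beta> + u' * n + v') = lab u' v') \<and>
          (m(\<beta> + u * n + v := x)) (\<beta> + u' * n + v') \<le> (r(27 := x, 6 := max x (r 6))) 6"
      proof (cases "u' = u \<and> v' = v")
        case True
        then show ?thesis using x by auto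
      next
        case False
        then have "u' < u \<or> u' = u \<and> v' < v" using a(3) by (auto simp: less_Suc_eq)
        then have "(u' \<noteq> v' \<longrightarrow> m (\<beta> + u' * n + v') = lab u' v') \<and> m (\<beta> + u' * n + v') \<le> r 6"
          using I a(1,2) unfolding loaded_def by blast
        then show ?thesis using e False by auto
      qed
    qed
  qed (auto simp: same_off_def)
  define x where "x = (if u < v then m (m (2 + 2 * (u * n + v))) else m (m (2 + 2 * (v * n + u))))"
  have x: "u \<noteq> v \<longrightarrow> x = lab u v"
    using lab(1)[of u v] lab(1)[of v u] lab(2)[of u v] uv unfolding x_def by auto
  show ?thesis
  proof (rule wp_pre)
    assume b: "bnd V r m"
    have xV: "x \<le> V" unfolding x_def using bndD(3)[OF b] by simp
    note main' = main[OF x]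
    show "pre V load_cell R r m \<tau>"
    proof (cases "r 6 < x")
      case True
      then have mx: "max x (r 6) = x" by simp
      show ?thesis using main'[unfolded mx] r r' xV True unfolding x_def
        by (cases "u < v") (simp_all add: load_cell_def simple_def cell_def del: fun_upd_apply add: fun_upd_same fun_upd_other)
    next
      case False
      then have "max x (r 6) = r 6" by simp
      then have mx: "r(27 := x, 6 := max x (r 6)) = r(27 := x)" by (auto simp: fun_eq_iff)
      show ?thesis using main'[unfolded mx] r r' xV False unfolding x_def
        by (cases "u < v") (simp_all add: load_cell_def simple_def cell_def del: fun_upd_apply add: fun_upd_same fun_upd_other)
    qed
  qed
qed

lemma wp_load:
  assumes r: "regs r"
    and lab: "\<And>u v. u < v \<Longrightarrow> v < n \<Longrightarrow> 2 + 2 * (u * n + v) < \<beta> \<and> m (2 + 2 * (u * n + v)) < \<beta> \<and>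
        m (m (2 + 2 * (u * n + v))) = lab u v"
      "\<And>u v. lab u v = lab v u"
    and R: "\<And>r' m' \<tau>'. same_off {6, 17, 18, 27} r r' \<Longrightarrow> same_off {\<beta>..<\<beta> + n * n} m m' \<Longrightarrow>
      loaded lab n 0 m' (r' 6) \<Longrightarrow> \<tau>' \<le> \<tau> + 100 * (n * n) + 20 \<Longrightarrow> R r' m' \<tau>'"
  shows "wp V load R r m \<tau>"
proof -
  have r0: "r 0 = n" using r by (simp add: regs_def)
  let ?S = "{\<beta>..<\<beta> + n * n}"
  let ?I = "\<lambda>j r' m' \<tau>'. r' 17 = j \<and> same_off {6, 17, 18, 27} r r' \<and> same_off ?S m m' \<and>
    loaded lab j 0 m' (r' 6) \<and> \<tau>' \<le> \<tau> + 100 * n * j + 10"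
  have loop: "wp V (For 17 0 (For 18 0 load_cell)) R (r(6 := 0)) m (\<tau> + 2)"
  proof (rule wp_for[where N = n and I = ?I])
    fix j r1 m1 \<tau>1 assume j: "j < n" and I: "?I j r1 m1 \<tau>1"
    let ?J = "\<lambda>i r' m' \<tau>'. r' 18 = i \<and> same_off {6, 18, 27} r1 r' \<and> same_off ?S m m' \<and>
      loaded lab j i m' (r' 6) \<and> \<tau>' \<le> \<tau>1 + 70 * i + 6"
    show "wp V (For 18 0 load_cell) (\<lambda>r' m' \<tau>'. r' 17 = j \<and> ?I (Suc j) (r'(17 := Suc j)) m' (\<tau>' + 4)) r1 m1 (\<tau>1 + 4)"
    proof (rule wp_for[where N = n and I = ?J])
      fix i r2 m2 \<tau>2 assume i: "i < n" and J: "?J i r2 m2 \<tau>2"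
      have g2: "regs r2"
        by (rule regs_same[OF r, where M = "{6, 17, 18, 27}"]) (use I J in \<open>auto simp: same_off_def\<close>)
      have so: "same_off ?S m m2" using J by simp
      show "wp V load_cell (\<lambda>r' m' \<tau>'. r' 18 = i \<and> ?J (Suc i) (r'(18 := Suc i)) m' (\<tau>' + 4)) r2 m2 (\<tau>2 + 4)"
      proof (rule wp_load_cell[OF g2 _ _ j i, where lab = lab])
        show "m2 (m2 (2 + 2 * (u * n + v))) = lab u v" if uv: "u < v" "v < n" for u v
        proof -
          have a: "2 + 2 * (u * n + v) < \<beta>" "m (2 + 2 * (u * n + v)) < \<beta>"
            "m (m (2 + 2 * (u * n + v))) = lab u v" using lab(1)[OF uv] by simp_all
          have "m2 (2 + 2 * (u * n + v)) = m (2 + 2 * (u * n + v))" using a(1) by (intro same_offD[OF so]) simp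
          moreover have "m2 (m (2 + 2 * (u * n + v))) = m (m (2 + 2 * (u * n + v)))"
            using a(2) by (intro same_offD[OF so]) simp
          ultimately show ?thesis using a(3) by simp
        qed
        show "r2 17 = j" using I J same_offD[of _ r1 r2 17] by auto
        fix r3 m3 \<tau>3 assume 3: "same_off {6, 27} r2 r3" "same_off ?S m2 m3" "loaded lab j (Suc i) m3 (r3 6)"
          "\<tau>3 \<le> \<tau>2 + 4 + 60"
        have "same_off ?S m m3" by (rule same_off_trans[OF so 3(2)]) auto
        moreover have "r3 18 = i" using same_offD[OF 3(1), of 18] J by simp
        moreover have "same_off {6, 18, 27} r1 (r3(18 := Suc i))" using J 3(1) by (auto simp: same_off_def)
        ultimately show "r3 18 = i \<and> ?J (Suc i) (r3(18 := Suc i)) m3 (\<tau>3 + 4)" using J 3(3,4) by auto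
      qed (use J lab in auto)
    next
      fix r2 m2 \<tau>2 assume J: "?J n r2 m2 \<tau>2"
      have "loaded lab (Suc j) 0 m2 (r2 6)" using J unfolding loaded_def by (auto simp: less_Suc_eq)
      moreover have "same_off {6, 17, 18, 27} r (r2(17 := Suc j))" using I J by (auto simp: same_off_def)
      moreover have "r2 17 = j" using I J same_offD[of _ r1 r2 17] by auto
      moreover have "\<tau>2 + 8 \<le> \<tau> + 100 * n * Suc j + 10" using I J n by simp
      ultimately show "r2 17 = j \<and> ?I (Suc j) (r2(17 := Suc j)) m2 (\<tau>2 + 4 + 4)" using J by simp
    next
      fix i r2 m2 \<tau>2 assume J: "?J i r2 m2 \<tau>2"
      then show "r2 18 = i \<and> r2 0 = n" using I r0 by (auto simp: same_off_def)
    qed (use I nV in \<open>auto simp: same_off_def loaded_def\<close>)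
  next
    fix r1 m1 \<tau>1 assume I: "?I n r1 m1 \<tau>1"
    then show "R r1 m1 (\<tau>1 + 4)" by (intro R) (auto simp: mult.assoc)
  next
    fix j r1 m1 \<tau>1 assume I: "?I j r1 m1 \<tau>1"
    then show "r1 17 = j \<and> r1 0 = n" using r0 by (auto simp: same_off_def)
  qed (use nV in \<open>auto simp: same_off_def loaded_def\<close>)
  show ?thesis unfolding load_def
    using loop by (intro wp_seq_pre) (simp add: simple_def add.assoc)
qed

lemma wp_reverse:
  assumes r: "regs r" and V': "n * n < V"
    and R: "\<And>r' m' \<tau>'. same_off {17} r r' \<Longrightarrow> same_off {\<beta> + n * n..<pO} m m' \<Longrightarrow>
      (\<And>i. i < n * n \<Longrightarrow> m' (\<beta> + n * n + i) = r 6 - m (\<beta> + i)) \<Longrightarrow> \<tau>' \<le> \<tau> + 30 * (n * n) + 10 \<Longrightarrow> R r' m' \<tau>'"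
  shows "wp V reverse R r m \<tau>"
proof -
  let ?I = "\<lambda>j r' m' \<tau>'. r' 17 = j \<and> same_off {17} r r' \<and>
    same_off {\<beta> + n * n..<pO} m m' \<and>
    (\<forall>i<j. m' (\<beta> + n * n + i) = r 6 - m (\<beta> + i)) \<and>
    \<tau>' \<le> \<tau> + 30 * j + 2"
  show ?thesis
    unfolding reverse_def
  proof (rule wp_for[where N = "n * n" and I = ?I])
    fix j r1 m1 \<tau>1
    assume j: "j < n * n" and I: "?I j r1 m1 \<tau>1"
      and b: "bnd V r1 m1"
    have r1: "r1 1 = \<beta>" "r1 2 = n * n" "r1 6 = r 6" "r1 17 = j" using I r by (auto simp: same_off_def regs_def)
    have rd: "m1 (\<beta> + j) = m (\<beta> + j)" using I j same_offD[of _ m m1 "\<beta> + j"] by auto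
    have le: "r 6 - m (\<beta> + j) \<le> V" using bndD(2)[OF b, of 6] r1 by simp
    show "wp V (Store (Plus (Plus (Reg 1) (Reg 2)) (Reg 17)) (Monus (Reg 6) (Mem (Plus (Reg 1) (Reg 17)))))
       (\<lambda>r' m' \<tau>'. r' 17 = j \<and> ?I (Suc j) (r'(17 := Suc j)) m' (\<tau>' + 4)) r1 m1 (\<tau>1 + 4)"
      using I r1 rd le j
      by (intro wp_pre) (auto simp: simple_def less_Suc_eq intro!: same_off_upd)
  next
    fix r1 m1 \<tau>1
    assume "?I (n * n) r1 m1 \<tau>1"
    then show "R r1 m1 (\<tau>1 + 4)" by (intro R) auto
  qed (use r V' in \<open>auto simp: same_off_def regs_def\<close>)
qed

lemma wp_first_frame:
  assumes r: "regs r"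
    and R: "\<And>r' m' \<tau>'. same_off {7, 17} r r' \<Longrightarrow> r' 7 = 1 \<Longrightarrow> same_off {pS..<pS + (1 + 2 * n)} m m' \<Longrightarrow>
      is_frame pS (0, {..<n}, {..<n}) m' \<Longrightarrow> \<tau>' \<le> \<tau> + 40 * n + 20 \<Longrightarrow> R r' m' \<tau>'"
  shows "wp V first_frame R r m \<tau>"
proof -
  let ?S = "{pS..<pS + (1 + 2 * n)}"
  have r': "r 0 = n" "r 33 = pS" using r by (auto simp: regs_def)
  let ?I = "\<lambda>j r' m' \<tau>'. r' 17 = j \<and> r' 7 = 1 \<and> same_off {7, 17} r r' \<and> same_off ?S m m' \<and> m' pS = 0 \<and>
    (\<forall>v<j. m' (pS + (1 + v)) = 1 \<and> m' (pS + (1 + (n + v))) = 1) \<and> \<tau>' \<le> \<tau> + 40 * j + 10"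
  have loop: "wp V (For 17 0 frame_cell) R (r(7 := 1)) (m(pS := 0)) (\<tau> + 5)"
  proof (rule wp_for[where N = n and I = ?I])
    fix j r1 m1 \<tau>1 assume j: "j < n" and I: "?I j r1 m1 \<tau>1" and b: "bnd V r1 m1"
    have r1: "r1 33 = pS" "r1 0 = n" "r1 17 = j" using I r' by (auto simp: same_off_def)
    show "wp V frame_cell
       (\<lambda>r' m' \<tau>'. r' 17 = j \<and> ?I (Suc j) (r'(17 := Suc j)) m' (\<tau>' + 4)) r1 m1 (\<tau>1 + 4)"
      using I r1 j bndD(1)[OF b]
      by (intro wp_pre) (auto simp: simple_def frame_cell_def less_Suc_eq intro!: same_off_upd)
  next
    fix r1 m1 \<tau>1 assume I: "?I n r1 m1 \<tau>1"
    then have "is_frame pS (0, {..<n}, {..<n}) m1"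
      using n by (auto simp: is_frame_def flags_def add.assoc lessThan_empty_iff)
    then show "R r1 m1 (\<tau>1 + 4)" using I by (intro R) auto
  next
    fix j r1 m1 \<tau>1 assume I: "?I j r1 m1 \<tau>1"
    then show "r1 17 = j \<and> r1 0 = n" using r' by (auto simp: same_off_def)
  qed (use nV in \<open>auto simp: same_off_def\<close>)
  show ?thesis unfolding first_frame_def
  proof (rule wp_seq_pre)
    assume b: "bnd V r m"
    show "pre V (Seq (Store (Reg 33) (Const 0)) (Assign 7 (Const 1)))
      (wp V (For 17 0 frame_cell) R) r m \<tau>"
      using loop r' bndD(1)[OF b] by (simp add: simple_def add.assoc)
  qed
qed

section \<open>Listing the marked edges\<close>

definition triples :: "nat \<Rightarrow> (nat \<Rightarrow> nat) \<Rightarrow> (nat \<times> nat \<times> nat) set" where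
  "triples c m = (\<lambda>i. (m (pOut + 3 * i), m (pOut + 3 * i + 1), m (pOut + 3 * i + 2))) ` {..<c}"

text \<open>The bound on \<open>c\<close> keeps the list inside its \<open>3 * (n * n)\<close>
  cells. Only pairs with \<open>v < u\<close> occur, one for each edge.\<close>

definition listed :: "(nat \<Rightarrow> nat \<Rightarrow> nat) \<Rightarrow> (nat \<times> nat) set \<Rightarrow> nat \<Rightarrow> nat \<Rightarrow> nat \<Rightarrow> (nat \<Rightarrow> nat) \<Rightarrow> bool" where
  "listed L S j i c m \<longleftrightarrow> c \<le> j * n + i \<and>
     triples c m = {(u, v, L u v) | u v. (u < j \<or> u = j \<and> v < i) \<and> v < u \<and> adj S u v}"

lemma wp_emit_cell:
  assumes r: "regs r" "r 17 = u" "r 18 = v" "r 24 = c" and uv: "v < u" "u < n"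
    and K: "keys \<beta> L n m" and S: "marks pO S n m" and I: "listed L S u v c m" and V': "n * n < V"
    and R: "\<And>r' m' \<tau>'. same_off {24} r r' \<Longrightarrow> same_off {pOut..<pS} m m' \<Longrightarrow>
      listed L S u (Suc v) (r' 24) m' \<Longrightarrow> \<tau>' \<le> \<tau> + 80 \<Longrightarrow> R r' m' \<tau>'"
  shows "wp V emit_cell R r m \<tau>"
proof -
  have r': "r 0 = n" "r 1 = \<beta>" "r 29 = pO" "r 32 = pOut" using r by (auto simp: regs_def)
  have vn: "v < n" using uv by simp
  have c: "c < n * n" using I index_less[OF uv(2) vn] unfolding listed_def by simp
  have rd: "m (pO + u * n + v) = of_bool ((u, v) \<in> S)" "m (pO + v * n + u) = of_bool ((v, u) \<in> S)"
    "m (\<beta> + u * n + v) = L u v" using S K uv vn by (simp_all add: marks_def keys_def)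
  have set: "{(u', v', L u' v') | u' v'. (u' < u \<or> u' = u \<and> v' < Suc v) \<and> v' < u' \<and> adj S u' v'} =
    {(u', v', L u' v') | u' v'. (u' < u \<or> u' = u \<and> v' < v) \<and> v' < u' \<and> adj S u' v'} \<union>
      (if adj S u v then {(u, v, L u v)} else {})"
    using uv by (auto simp: less_Suc_eq)
  show ?thesis
  proof (cases "adj S u v")
    case False
    have "listed L S u (Suc v) c m" using I False unfolding listed_def set by simp
    then have "R r m \<tau>'" if "\<tau>' \<le> \<tau> + 80" for \<tau>' using r(4) that by (intro R) auto
    then show ?thesis unfolding emit_cell_def
      using r r' rd False by (intro wp_pre) (simp add: simple_def cell_def adj_def)
  next
    case True
    let ?m = "m(pOut + 3 * c := u, pOut + 3 * c + 1 := v, pOut + 3 * c + 2 := L u v)"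
    have "triples (Suc c) ?m = insert (u, v, L u v) (triples c m)"
    proof -
      have "(?m (pOut + 3 * i), ?m (pOut + 3 * i + 1), ?m (pOut + 3 * i + 2)) =
          (m (pOut + 3 * i), m (pOut + 3 * i + 1), m (pOut + 3 * i + 2))" if "i < c" for i
      proof -
        have "3 * i + 2 < 3 * c" using that by linarith
        then show ?thesis by simp
      qed
      then have "(\<lambda>i. (?m (pOut + 3 * i), ?m (pOut + 3 * i + 1), ?m (pOut + 3 * i + 2))) ` {..<c} = triples c m"
        unfolding triples_def by (intro image_cong) auto
      then show ?thesis unfolding triples_def lessThan_Suc by simp
    qed
    then have "listed L S u (Suc v) (Suc c) ?m" using I True unfolding listed_def set by simp
    then have "listed L S u (Suc v) (c + 1) ?m" by (simp only: Suc_eq_plus1)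
    moreover have "same_off {pOut..<pS} m ?m" using c by (intro same_off_upd) auto
    ultimately have fin: "R (r(24 := c + 1)) ?m \<tau>'" if "\<tau>' \<le> \<tau> + 80" for \<tau>'
      using that by (intro R) (auto simp: same_off_def)
    have nz: "m (pO + u * n + v) + m (pO + v * n + u) \<noteq> 0" using rd True by (auto simp: adj_def)
    show ?thesis
    proof (rule wp_pre)
      assume b: "bnd V r m"
      have "u \<le> V" "v \<le> V" "L u v \<le> V" "c + 1 \<le> V"
        using uv nV c V' bndD(3)[OF b, of "\<beta> + u * n + v"] rd(3) by auto
      moreover have "(m(pOut + 3 * c := u, pOut + 3 * c + 1 := v)) (\<beta> + u * n + v) = L u v"
        using rd(3) index_less[OF uv(2) vn] by auto
      ultimately show "pre V emit_cell R r m \<tau>"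
        using r r' fin nz by (auto simp: emit_cell_def simple_def cell_def simp del: fun_upd_apply)
    qed
  qed
qed

text \<open>Cells 0 and 1 are overwritten last; \<open>2 \<le> \<beta>\<close> keeps them apart from
  the list of triples.\<close>

lemma wp_emit:
  assumes r: "regs r" and K: "keys \<beta> L n m" and S: "marks pO S n m" and V': "n * n < V" "2 \<le> \<beta>"
    and R: "\<And>r' m' \<tau>'. output_triples m' = {(u, v, L u v) | u v. v < u \<and> u < n \<and> adj S u v} \<Longrightarrow>
      \<tau>' \<le> \<tau> + 120 * (n * n) + 30 \<Longrightarrow> R r' m' \<tau>'"
  shows "wp V emit R r m \<tau>"
proof -
  let ?S = "{pOut..<pS}"
  let ?I = "\<lambda>j r' m' \<tau>'. r' 17 = j \<and> same_off {17, 18, 24} r r' \<and> same_off ?S m m' \<and>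
    listed L S j 0 (r' 24) m' \<and> \<tau>' \<le> \<tau> + 120 * n * j + 6"
  have r': "r 0 = n" "r 32 = pOut" using r by (auto simp: regs_def)
  let ?rest = "Seq (For 17 0 (For 18 17 emit_cell)) (Seq (Store (Const 0) (Reg 32)) (Store (Const 1) (Reg 24)))"
  have loop: "wp V ?rest R (r(24 := 0)) m (\<tau> + 2)"
  proof (rule wp_seq, rule wp_for[where N = n and I = ?I])
    fix j r1 m1 \<tau>1 assume j: "j < n" and I: "?I j r1 m1 \<tau>1"
    let ?J = "\<lambda>i r' m' \<tau>'. r' 18 = i \<and> same_off {18, 24} r1 r' \<and> same_off ?S m m' \<and>
      listed L S j i (r' 24) m' \<and> \<tau>' \<le> \<tau>1 + 90 * i + 6"
    show "wp V (For 18 17 emit_cell) (\<lambda>r' m' \<tau>'. r' 17 = j \<and> ?I (Suc j) (r'(17 := Suc j)) m' (\<tau>' + 4)) r1 m1 (\<tau>1 + 4)"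
    proof (rule wp_for[where N = j and I = ?J])
      fix i r2 m2 \<tau>2 assume i: "i < j" and J: "?J i r2 m2 \<tau>2"
      have g2: "regs r2"
        by (rule regs_same[OF r, where M = "{17, 18, 24}"]) (use I J in \<open>auto simp: same_off_def\<close>)
      have so: "same_off ?S m m2" using J by simp
      have K2: "keys \<beta> L n m2" by (rule keys_same[OF K so]) auto
      have S2: "marks pO S n m2" by (rule marks_same[OF S so]) auto
      show "wp V emit_cell (\<lambda>r' m' \<tau>'. r' 18 = i \<and> ?J (Suc i) (r'(18 := Suc i)) m' (\<tau>' + 4)) r2 m2 (\<tau>2 + 4)"
      proof (rule wp_emit_cell[OF g2 _ _ refl i j K2 S2 _ V'(1)])
        show "r2 17 = j" using I J same_offD[of _ r1 r2 17] by auto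
        fix r3 m3 \<tau>3 assume 3: "same_off {24} r2 r3" "same_off ?S m2 m3" "listed L S j (Suc i) (r3 24) m3"
          "\<tau>3 \<le> \<tau>2 + 4 + 80"
        have "same_off ?S m m3" by (rule same_off_trans[OF so 3(2)]) auto
        moreover have "r3 18 = i" using same_offD[OF 3(1), of 18] J by simp
        moreover have "same_off {18, 24} r1 (r3(18 := Suc i))" using J 3(1) by (auto simp: same_off_def)
        ultimately show "r3 18 = i \<and> ?J (Suc i) (r3(18 := Suc i)) m3 (\<tau>3 + 4)" using J 3(3,4) by auto
      qed (use J in auto)
    next
      fix r2 m2 \<tau>2 assume J: "?J j r2 m2 \<tau>2"
      have "listed L S (Suc j) 0 (r2 24) m2"
      proof -
        have "{(u, v, L u v) | u v. (u < j \<or> u = j \<and> v < j) \<and> v < u \<and> adj S u v} =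
          {(u, v, L u v) | u v. (u < Suc j \<or> u = Suc j \<and> v < 0) \<and> v < u \<and> adj S u v}"
          by (auto simp: less_Suc_eq)
        then show ?thesis using J j unfolding listed_def by simp
      qed
      moreover have "same_off {17, 18, 24} r (r2(17 := Suc j))" using I J by (auto simp: same_off_def)
      moreover have "r2 17 = j" using I J same_offD[of _ r1 r2 17] by auto
      moreover have "\<tau>2 + 8 \<le> \<tau> + 120 * n * Suc j + 6" using I J n j by simp
      ultimately show "r2 17 = j \<and> ?I (Suc j) (r2(17 := Suc j)) m2 (\<tau>2 + 4 + 4)" using J by simp
    next
      fix i r2 m2 \<tau>2 assume J: "?J i r2 m2 \<tau>2"
      then show "r2 18 = i \<and> r2 17 = j" using I by (auto simp: same_off_def)
    qed (use I nV j in \<open>auto simp: same_off_def\<close>)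
  next
    fix r1 m1 \<tau>1 assume I: "?I n r1 m1 \<tau>1"
    have r1: "r1 32 = pOut" using I r' by (auto simp: same_off_def)
    let ?m = "m1(0 := pOut, 1 := r1 24)"
    have ne: "pOut + k \<noteq> 0" "pOut + k \<noteq> 1" for k using V'(2) by auto
    have ne': "pOut + k + l \<noteq> 0" "pOut + k + l \<noteq> 1" for k l using V'(2) by auto
    have "output_triples ?m = triples (r1 24) m1"
      unfolding output_triples_def triples_def using ne ne' by (intro image_cong) auto
    also have "\<dots> = {(u, v, L u v) | u v. v < u \<and> u < n \<and> adj S u v}"
      using I unfolding listed_def by auto
    finally have ot: "output_triples ?m = {(u, v, L u v) | u v. v < u \<and> u < n \<and> adj S u v}" .
    have fin: "R r1 ?m \<tau>'" if "\<tau>' \<le> \<tau>1 + 20" for \<tau>'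
      by (rule R[OF ot]) (use that I in \<open>simp add: mult.assoc\<close>)
    show "wp V (Seq (Store (Const 0) (Reg 32)) (Store (Const 1) (Reg 24))) R r1 m1 (\<tau>1 + 4)"
    proof (rule wp_pre)
      assume b: "bnd V r1 m1"
      have "pOut \<le> V" using bndD(2)[OF b, of 32] r1 by simp
      then show "pre V (Seq (Store (Const 0) (Reg 32)) (Store (Const 1) (Reg 24))) R r1 m1 (\<tau>1 + 4)"
        using fin r1 bndD(2)[OF b, of 24] by (simp add: simple_def)
    qed
  next
    fix j r1 m1 \<tau>1 assume I: "?I j r1 m1 \<tau>1"
    then show "r1 17 = j \<and> r1 0 = n" using r' by (auto simp: same_off_def)
  qed (use nV in \<open>auto simp: same_off_def listed_def triples_def\<close>)
  show ?thesis unfolding emit_def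
    using loop by (intro wp_seq_pre) (simp add: simple_def add.assoc)
qed

end

section \<open>Correctness and running time\<close>

text \<open>An upper bound for \<open>log 2 (2 * n)\<close> in terms of \<open>k\<close>, so that
  the logarithmic factor can be compared with powers of \<open>2 ^ k\<close>. It occurs only in the
  analysis; the program does not compute it.\<close>

definition height :: "nat \<Rightarrow> nat" where
  "height n = kpar n * (kpar n + 1) + 1"

text \<open>The first summand pays for everything outside the main loop, the second for the loop at
  a fixed price per unit of initial potential.\<close>

definition runtime :: "nat \<Rightarrow> nat" where
  "runtime n = 1000 * (n * n) + 1000 * n * (height n + 1) * dpar n * pot (dpar n) n n"

lemma pot_le: "pot (dpar n) n n \<le> n * 2 ^ (kpar n + 2) * dpar n"
proof -
  let ?d = "dpar n" and ?k = "kpar n"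
  have "level ?d n \<le> ?k - 1"
    using dpar_props(2)[of n] kpar_props(1)[of n] by (intro level_le) simp
  then have "pot ?d n n \<le> rate ?d (?k - 1) * (n + n)"
    unfolding pot_def by (intro mult_le_mono rate_mono) auto
  also have "\<dots> \<le> 2 ^ (?k - 1) * (4 * ?d) * (n + n)"
  proof (intro mult_le_mono1)
    have "rate ?d (?k - 1) \<le> 2 ^ (?k - 1) * (3 * ?d + 2)"
      using rate_closed[of ?d "?k - 1"] by linarith
    also have "\<dots> \<le> 2 ^ (?k - 1) * (4 * ?d)" using dpar_props(1)[of n] by (intro mult_le_mono2) linarith
    finally show "rate ?d (?k - 1) \<le> 2 ^ (?k - 1) * (4 * ?d)" .
  qed
  also have "\<dots> = n * (2 ^ 3 * 2 ^ (?k - 1)) * ?d" by simp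
  also have "\<dots> = n * 2 ^ (?k + 2) * ?d"
  proof -
    have "?k + 2 = 3 + (?k - 1)" using kpar_props(1)[of n] by linarith
    then show ?thesis by (simp only: power_add)
  qed
  finally show ?thesis .
qed

text \<open>With \<open>A = 2 ^ kpar n\<close>, the height contributes \<open>2 * (A * A)\<close>,
  the factor \<open>d\<close> contributes \<open>2 * A\<close>, and the potential contributes
  \<open>n * (4 * A) * (2 * A)\<close>. Together this is \<open>32000 * n * n\<close> times the
  fifth power of \<open>A\<close>; \<open>2 ^ 17\<close> absorbs the constants.\<close>

lemma runtime_le: "runtime n \<le> n\<^sup>2 * 2 ^ (5 * kpar n + 17)"
proof -
  define A where "A = (2::nat) ^ kpar n"
  have k: "kpar n + 1 \<le> A" using less_exp[of "kpar n"] unfolding A_def by linarith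
  then have A: "2 \<le> A" using kpar_props(1)[of n] by linarith
  have "kpar n * (kpar n + 1) \<le> A * A" using k by (intro mult_le_mono) linarith+
  moreover have "2 * 1 \<le> A * A" using A by (intro mult_le_mono) linarith+
  ultimately have h: "height n + 1 \<le> 2 * (A * A)" unfolding height_def by linarith
  have d: "dpar n \<le> 2 * A" using dpar_props(3)[of n] unfolding A_def by (simp add: power_add)
  have "pot (dpar n) n n \<le> n * (4 * A) * dpar n" using pot_le[of n] unfolding A_def by (simp add: power_add)
  also have "\<dots> \<le> n * (4 * A) * (2 * A)" using d by (rule mult_le_mono2)
  finally have "1000 * n * (height n + 1) * dpar n * pot (dpar n) n n
      \<le> 1000 * n * (2 * (A * A)) * (2 * A) * (n * (4 * A) * (2 * A))"
    using h d by (intro mult_le_mono order_refl)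
  also have "\<dots> = 32000 * (n * n * (A * A * A * A * A))" by simp
  finally have 1: "1000 * n * (height n + 1) * dpar n * pot (dpar n) n n
      \<le> 32000 * (n * n * (A * A * A * A * A))" .
  have "1 * 1 * 1 * 1 * 1 \<le> A * A * A * A * A" using A by (intro mult_le_mono) linarith+
  then have "1 \<le> A * A * A * A * A" by simp
  then have "n * n * 1 \<le> n * n * (A * A * A * A * A)" by (rule mult_le_mono2)
  then have "1000 * (n * n) \<le> 1000 * (n * n * (A * A * A * A * A))" by simp
  with 1 have "runtime n \<le> 33000 * (n * n * (A * A * A * A * A))" unfolding runtime_def by linarith
  also have "\<dots> \<le> 2 ^ 17 * (n * n * (A * A * A * A * A))" by (intro mult_le_mono1) simp
  also have "\<dots> = n\<^sup>2 * 2 ^ (5 * kpar n + 17)"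
  proof -
    have "5 * kpar n = kpar n + kpar n + kpar n + kpar n + kpar n" by simp
    then have e: "A * A * A * A * A = 2 ^ (5 * kpar n)" unfolding A_def by (simp only: power_add)
    have "2 ^ (5 * kpar n + 17) = 2 ^ (5 * kpar n) * (2::nat) ^ 17" by (rule power_add)
    then show ?thesis unfolding e power2_eq_square by (metis mult.commute mult.left_commute)
  qed
  finally show ?thesis .
qed

lemma two_n_le_power_height: "2 * n \<le> 2 ^ height n"
  using kpar_props(2)[of n] unfolding height_def by (simp add: power_add)

text \<open>The potential is at most \<open>8 n^3\<close> and a frame has \<open>1 + 2 n\<close>
  cells, so the stack takes of the order of \<open>n^4\<close> cells. An encoding forces
  \<open>2 n^2 \<le> \<beta> \<le> N\<close>, whence \<open>n^4\<close> is at most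
  \<open>N^2 / 4\<close> and a fixed power of \<open>N\<close> bounds all addresses.\<close>

lemma room_bound:
  assumes n: "2 \<le> n" and b: "2 + 2 * (n * n) \<le> \<beta>" "\<beta> \<le> N"
  shows "\<beta> + 8 * (n * n) + (pot (dpar n) n n + 1) * (1 + 2 * n) \<le> N ^ 4"
proof -
  have "2 ^ (kpar n + 2) = (8::nat) * 2 ^ (kpar n - 1)"
  proof -
    have "kpar n + 2 = 3 + (kpar n - 1)" using kpar_props(1)[of n] by linarith
    then have "(2::nat) ^ (kpar n + 2) = 2 ^ 3 * 2 ^ (kpar n - 1)" by (simp only: power_add)
    then show ?thesis by simp
  qed
  then have k: "2 ^ (kpar n + 2) \<le> 8 * n" using two_power_kpar[OF n] by simp
  have "pot (dpar n) n n \<le> n * (8 * n) * n"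
    using pot_le[of n] k dpar_le[OF n] by (meson le_refl le_trans mult_le_mono)
  moreover have "1 * 1 * 1 \<le> n * n * n" using n by (intro mult_le_mono) linarith+
  ultimately have "pot (dpar n) n n + 1 \<le> 9 * (n * n * n)" by simp
  moreover have "1 + 2 * n \<le> 3 * n" using n by simp
  ultimately have "(pot (dpar n) n n + 1) * (1 + 2 * n) \<le> 9 * (n * n * n) * (3 * n)" by (rule mult_le_mono)
  also have "\<dots> = 27 * ((n * n) * (n * n))" by simp
  finally have 1: "(pot (dpar n) n n + 1) * (1 + 2 * n) \<le> 27 * ((n * n) * (n * n))" .
  have nN: "2 * (n * n) \<le> N" using b by linarith
  have n4: "2 * 2 \<le> n * n" using n by (intro mult_le_mono)
  have N10: "10 \<le> N" using b n4 by linarith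
  have "(2 * (n * n)) * (2 * (n * n)) \<le> N * N" using nN nN by (rule mult_le_mono)
  then have "28 * ((n * n) * (n * n)) \<le> 7 * (N * N)" by simp
  then have 2: "27 * ((n * n) * (n * n)) \<le> 7 * (N * N)" by linarith
  have "\<beta> + 8 * (n * n) \<le> N + 4 * N" using b nN by linarith
  also have "\<dots> \<le> 5 * (N * N)" using N10 by simp
  finally have "\<beta> + 8 * (n * n) + (pot (dpar n) n n + 1) * (1 + 2 * n) \<le> 12 * (N * N)"
    using 1 2 by linarith
  also have "\<dots> \<le> (N * N) * (N * N)"
  proof -
    have "10 * 10 \<le> N * N" using N10 by (intro mult_le_mono)
    then have "12 \<le> N * N" by simp
    then show ?thesis by (rule mult_le_mono1)
  qed
  also have "\<dots> = N ^ 4" by (simp add: numeral_eq_Suc)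
  finally show ?thesis .
qed

text \<open>The triples name each edge with its larger endpoint first; symmetry of \<open>L\<close>
  makes this orientation immaterial.\<close>

lemma output_graph_eq:
  assumes out: "output_triples m = {(u, v, L u v) | u v. v < u \<and> u < n \<and> adj S u v}"
    and S: "S \<subseteq> {..<n} \<times> {..<n}" and sym: "sym_on {..<n} L"
  shows "output_graph n m = mark_graph {..<n} L S"
proof -
  have inn: "u < n \<and> v < n" if "adj S u v" for u v using that S by (auto simp: adj_def)
  have Ls: "L u v = L v u" if "adj S u v" for u v using inn[OF that] sym by (simp add: sym_on_def)
  have "{{u, v} | u v l. (u, v, l) \<in> output_triples m} = {{x, y} | x y. x \<noteq> y \<and> adj S x y}" (is "?A = ?B")
  proof
    show "?A \<subseteq> ?B" unfolding out by blast
    show "?B \<subseteq> ?A"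
    proof
      fix e assume "e \<in> ?B"
      then obtain x y where e: "e = {x, y}" "x \<noteq> y" "adj S x y" by blast
      show "e \<in> ?A"
      proof (cases "y < x")
        case True
        then show ?thesis unfolding out using e inn by blast
      next
        case False
        then have "x < y" "adj S y x" "e = {y, x}" using e adj_sym[of S x y] by (auto simp: insert_commute)
        then show ?thesis unfolding out using inn by blast
      qed
    qed
  qed
  moreover have "{l. \<exists>u v. e = {u, v} \<and> (u, v, l) \<in> output_triples m} =
      {L x y | x y. e = {x, y} \<and> x \<noteq> y \<and> adj S x y}" (is "?A = ?B") for e
  proof
    show "?A \<subseteq> ?B" unfolding out by blast
    show "?B \<subseteq> ?A"
    proof
      fix l assume "l \<in> ?B"
      then obtain x y where e: "l = L x y" "e = {x, y}" "x \<noteq> y" "adj S x y" by blast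
      show "l \<in> ?A"
      proof (cases "y < x")
        case True
        then show ?thesis unfolding out using e inn by blast
      next
        case False
        then have "x < y" "adj S y x" "e = {y, x}" "l = L y x" using e adj_sym[of S x y] Ls[of x y] by (auto simp: insert_commute)
        then show ?thesis unfolding out using inn by blast
      qed
    qed
  qed
  ultimately show ?thesis unfolding output_graph_def mark_graph_def by simp
qed

lemma wp_set_regs:
  assumes "m 0 = n" "m 1 = \<beta>" "n * n \<le> V" "\<beta> + 8 * (n * n) \<le> V"
    and R: "\<And>r' \<tau>'. r' 0 = n \<Longrightarrow> r' 1 = \<beta> \<Longrightarrow> r' 2 = n * n \<Longrightarrow> r' 29 = \<beta> + 2 * (n * n) \<Longrightarrow>
      r' 30 = \<beta> + 3 * (n * n) \<Longrightarrow> r' 31 = \<beta> + 4 * (n * n) \<Longrightarrow> r' 32 = \<beta> + 5 * (n * n) \<Longrightarrow>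
      r' 33 = \<beta> + 8 * (n * n) \<Longrightarrow> \<tau>' \<le> \<tau> + 70 \<Longrightarrow> R r' m \<tau>'"
  shows "wp V set_regs R r m \<tau>"
proof (rule wp_pre)
  assume b: "bnd V r m"
  have "n \<le> V" "\<beta> \<le> V" using assms(1,2) bndD(3)[OF b] by auto
  then show "pre V set_regs R r m \<tau>"
    using assms(1-4) by (auto simp: set_regs_def simple_def intro!: R)
qed

text \<open>In a clique each pair has a nonempty array, so its first cell exists and holds a valid
  label; one memory access per pair is enough.\<close>

lemma clique_label:
  assumes G: "temporal_clique G" "verts G = {..<n}" and enc: "encodes m G" and uv: "u < n" "v < n" "u \<noteq> v"
  shows "2 + 2 * (u * n + v) < m 1" "m (2 + 2 * (u * n + v)) < m 1"
    "m (m (2 + 2 * (u * n + v))) \<in> labels G {u, v}"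
proof -
  have n: "m 0 = n" and b: "2 + 2 * (n * n) \<le> m 1"
    using enc G(2) unfolding encodes_def by (auto simp: power2_eq_square)
  let ?p = "m (2 + 2 * (u * n + v))" and ?k = "m (3 + 2 * (u * n + v))"
  have arr: "?p + ?k \<le> m 1" "m ` {?p..<?p + ?k} = (if {u, v} \<in> edges G then labels G {u, v} else {})"
    using enc uv unfolding encodes_def n Let_def by auto
  have e: "{u, v} \<in> edges G" using G uv by (auto simp: temporal_clique_def nsets_def)
  then have "labels G {u, v} \<noteq> {}" using G(1) unfolding temporal_clique_def temporal_graph_def by blast
  then have ne: "m ` {?p..<?p + ?k} = labels G {u, v}" "{?p..<?p + ?k} \<noteq> {}" using arr(2) e by auto
  then have k: "0 < ?k" by simp
  then show "?p < m 1" using arr(1) by linarith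
  have "?p \<in> {?p..<?p + ?k}" using k by simp
  then show "m ?p \<in> labels G {u, v}" using ne(1) by blast
  have "2 * (u * n + v) < 2 * (n * n)" using index_less[OF uv(1,2)] by simp
  then show "2 + 2 * (u * n + v) < m 1" using b by linarith
qed

lemma wp_program:
  assumes n: "2 \<le> n" and G: "temporal_clique G" "card (verts G) = n" and enc: "encodes m G"
    and N: "\<And>a. m a \<le> N"
  shows "wp (N ^ 4) program (\<lambda>r m' \<tau>. \<exists>L S. S \<subseteq> {..<n} \<times> {..<n} \<and> sym_on {..<n} L \<and>
      (\<forall>u<n. \<forall>v<n. u \<noteq> v \<longrightarrow> L u v \<in> labels G {u, v}) \<and> (\<forall>u<n. \<forall>v<n. reach L S u v) \<and>
      2 * card S \<le> pot (dpar n) n n \<and>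
      output_triples m' = {(u, v, L u v) | u v. v < u \<and> u < n \<and> adj S u v} \<and> \<tau> \<le> runtime n) (\<lambda>_. 0) m 0"
proof -
  define \<beta> d h V pot0 where "\<beta> = m 1" and "d = dpar n" and "h = height n" and "V = N ^ 4" and
    "pot0 = pot (dpar n) n n"
  let ?R = "\<lambda>r m' \<tau>. \<exists>L S. S \<subseteq> {..<n} \<times> {..<n} \<and> sym_on {..<n} L \<and>
      (\<forall>u<n. \<forall>v<n. u \<noteq> v \<longrightarrow> L u v \<in> labels G {u, v}) \<and> (\<forall>u<n. \<forall>v<n. reach L S u v) \<and>
      2 * card S \<le> pot0 \<and>
      output_triples m' = {(u, v, L u v) | u v. v < u \<and> u < n \<and> adj S u v} \<and> \<tau> \<le> runtime n"
  have "verts G = {..<m 0}" using enc by (simp add: encodes_def)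
  then have vG: "verts G = {..<n}" and m0: "m 0 = n" using G(2) by auto
  have b: "2 + 2 * (n * n) \<le> \<beta>" and zero: "\<And>a. \<beta> \<le> a \<Longrightarrow> m a = 0"
    using enc m0 unfolding encodes_def \<beta>_def by (auto simp: power2_eq_square)
  have room: "\<beta> + 8 * (n * n) + (pot0 + 1) * (1 + 2 * n) \<le> V"
    unfolding pot0_def V_def by (rule room_bound[OF n b]) (simp add: \<beta>_def N)
  have nn: "2 * n \<le> n * n" using n by (intro mult_le_mono1)
  have V1: "8 * (n * n) \<le> V" "\<beta> + 8 * (n * n) \<le> V" using room by linarith+
  have V2: "2 * n \<le> V" "n * n < V" "4 * (n * n) \<le> V" using V1 nn n by linarith+
  interpret layout n \<beta> d h V
    by unfold_locales (use n V2 two_n_le_power_height[of n] in \<open>simp_all add: h_def\<close>)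
  define lab where "lab u v = m (m (2 + 2 * (min u v * n + max u v)))" for u v
  have labsym: "lab u v = lab v u" for u v by (simp add: lab_def min.commute max.commute)
  have "wp V program ?R (\<lambda>_. 0) m 0"
    unfolding program_def
  proof (rule wp_seq, rule wp_set_regs[where n = n and \<beta> = \<beta>])
    fix r1 :: "nat \<Rightarrow> nat" and \<tau>1 :: nat
    assume 1: "r1 0 = n" "r1 1 = \<beta>" "r1 2 = n * n" "r1 29 = pO" "r1 30 = pF" "r1 31 = pT" "r1 32 = pOut"
      "r1 33 = pS" "\<tau>1 \<le> 0 + 70"
    show "wp V (Seq find_k (Seq find_d (Seq load (Seq reverse (Seq first_frame (Seq main_loop emit)))))) ?R r1 m \<tau>1"
    proof (rule wp_seq, rule wp_find_k[where r = r1, OF 1(1) n V2(3)])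
      fix r2 \<tau>2 assume 2: "same_off {4, 5, 28} r1 r2" "r2 28 = kpar n" "\<tau>2 \<le> \<tau>1 + 40 * n + 20"
      have r20: "r2 0 = n" using same_offD[OF 2(1), of 0] 1(1) by simp
      show "wp V (Seq find_d (Seq load (Seq reverse (Seq first_frame (Seq main_loop emit))))) ?R r2 m \<tau>2"
      proof (rule wp_seq, rule wp_find_d[where r = r2, OF r20 2(2) n V2(3)])
        fix r3 \<tau>3 assume 3: "same_off {3, 5, 17} r2 r3" "r3 3 = dpar n" "\<tau>3 \<le> \<tau>2 + 50 * (n * n) + 20"
        have g3: "regs r3" unfolding regs_def
          using 1 3(2) same_offD[OF 2(1)] same_offD[OF 3(1)] by (simp add: d_def)
        show "wp V (Seq load (Seq reverse (Seq first_frame (Seq main_loop emit)))) ?R r3 m \<tau>3"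
        proof (rule wp_seq, rule wp_load[OF g3, where lab = lab])
          show "2 + 2 * (u * n + v) < \<beta> \<and> m (2 + 2 * (u * n + v)) < \<beta> \<and> m (m (2 + 2 * (u * n + v))) = lab u v"
            if "u < v" "v < n" for u v
            using clique_label[OF G(1) vG enc, of u v] that by (simp add: \<beta>_def lab_def)
          show "lab u v = lab v u" for u v by (rule labsym)
          fix r4 m4 \<tau>4
          assume 4: "same_off {6, 17, 18, 27} r3 r4" "same_off {\<beta>..<\<beta> + n * n} m m4"
            "loaded lab n 0 m4 (r4 6)" "\<tau>4 \<le> \<tau>3 + 100 * (n * n) + 20"
          have g4: "regs r4" by (rule regs_same[OF g3 4(1)]) simp
          define L M where "L u v = m4 (\<beta> + u * n + v)" and "M = r4 6" for u v
          have L: "u \<noteq> v \<Longrightarrow> L u v = lab u v" "L u v \<le> M" if "u < n" "v < n" for u v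
            using 4(3) that unfolding loaded_def L_def M_def by auto
          have Lsym: "sym_on {..<n} L" using L(1) labsym unfolding sym_on_def by (metis lessThan_iff)
          have Llab: "L u v \<in> labels G {u, v}" if "u < n" "v < n" "u \<noteq> v" for u v
          proof (cases "u < v")
            case True
            then show ?thesis using L(1) that clique_label(3)[OF G(1) vG enc, of u v] by (simp add: lab_def)
          next
            case False
            then show ?thesis using L(1) that clique_label(3)[OF G(1) vG enc, of v u]
              by (simp add: lab_def insert_commute)
          qed
          show "wp V (Seq reverse (Seq first_frame (Seq main_loop emit))) ?R r4 m4 \<tau>4"
          proof (rule wp_seq, rule wp_reverse[OF g4 V2(2)])
            fix r5 m5 \<tau>5
            assume 5: "same_off {17} r4 r5" "same_off {\<beta> + n * n..<pO} m4 m5"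
              "\<And>i. i < n * n \<Longrightarrow> m5 (\<beta> + n * n + i) = r4 6 - m4 (\<beta> + i)" "\<tau>5 \<le> \<tau>4 + 30 * (n * n) + 10"
            have g5: "regs r5" by (rule regs_same[OF g4 5(1)]) simp
            \<comment> \<open>Since \<open>M\<close> bounds all of \<open>L\<close>, the truncated
              difference is the true one and role 1 reverses the order of role 0.\<close>
            define \<kappa> where "\<kappa> \<rho> u v = (if \<rho> = 0 then L u v else M - L u v)" for \<rho> u v :: nat
            have K5: "keys \<beta> (\<kappa> 0) n m5" "keys (\<beta> + n * n) (\<kappa> 1) n m5"
            proof -
              have "keys \<beta> (\<kappa> 0) n m4" by (simp add: keys_def \<kappa>_def L_def)
              then show "keys \<beta> (\<kappa> 0) n m5" by (rule keys_same[OF _ 5(2)]) auto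
              show "keys (\<beta> + n * n) (\<kappa> 1) n m5"
                using 5(3) index_less by (simp add: keys_def \<kappa>_def L_def M_def add.assoc)
            qed
            show "wp V (Seq first_frame (Seq main_loop emit)) ?R r5 m5 \<tau>5"
            proof (rule wp_seq, rule wp_first_frame[OF g5])
              fix r6 m6 \<tau>6
              assume 6: "same_off {7, 17} r5 r6" "r6 7 = 1" "same_off {pS..<pS + (1 + 2 * n)} m5 m6"
                "is_frame pS (0, {..<n}, {..<n}) m6" "\<tau>6 \<le> \<tau>5 + 40 * n + 20"
              have g6: "regs r6" by (rule regs_same[OF g5 6(1)]) simp
              \<comment> \<open>The time budget is what has elapsed so far plus the price of the
                whole initial potential.\<close>
              interpret sl: spanner_loop n \<beta> d h V \<kappa> pot0 "\<tau>6 + 1000 * n * (h + 1) * d * pot0"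
              proof unfold_locales
                show "2 \<le> d" "d \<le> n" using dpar_props(1)[of n] dpar_le[OF n] by (simp_all add: d_def)
                show "sym_on {..<n} (\<kappa> 0)" "sym_on {..<n} (\<kappa> 1)"
                  using Lsym by (simp_all add: sym_on_def \<kappa>_def)
                show "\<kappa> 0 x' y' \<le> \<kappa> 0 x y"
                  if "x < n" "y < n" "x' < n" "y' < n" "\<kappa> 1 x y \<le> \<kappa> 1 x' y'" for x y x' y'
                  using that L(2)[of x y] L(2)[of x' y'] by (simp add: \<kappa>_def)
              qed (use room in simp)
              have mk: "marks pO {} n m6"
              proof -
                \<comment> \<open>Cells from \<open>\<beta>\<close> on are 0 in an encoding, so the
                  mark matrix starts out empty without being cleared.\<close>
                have "marks pO {} n m" using zero by (simp add: marks_def)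
                then have "marks pO {} n m4" by (rule marks_same[OF _ 4(2)]) auto
                then have "marks pO {} n m5" by (rule marks_same[OF _ 5(2)]) auto
                then show ?thesis by (rule marks_same[OF _ 6(3)]) auto
              qed
              have K6: "keys \<beta> (\<kappa> 0) n m6" "keys (\<beta> + n * n) (\<kappa> 1) n m6"
                by (auto intro: keys_same[OF K5(1) 6(3)] keys_same[OF K5(2) 6(3)])
              have start: "sl.inv pot0 r6 m6 \<tau>6"
                unfolding sl.inv_def
              proof (intro conjI exI[of _ "[(0, {..<n}, {..<n})]"] exI[of _ "{}"])
                show "sl.frames [(0, {..<n}, {..<n})] m6" using 6(4) by (simp add: sl.frames_def)
                show "sl.covered {} [(0, {..<n}, {..<n})]" by (simp add: sl.covered_def)
              qed (use g6 6(2) mk K6 in \<open>simp_all add: pot0_def d_def\<close>)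
              show "wp V (Seq main_loop emit) ?R r6 m6 \<tau>6"
              proof (rule wp_seq, rule sl.wp_main_loop[OF start])
                fix r7 m7 \<tau>7 S
                assume 7: "regs r7" "S \<subseteq> {..<n} \<times> {..<n}" "marks pO S n m7" "keys \<beta> (\<kappa> 0) n m7"
                  "\<And>u v. u < n \<Longrightarrow> v < n \<Longrightarrow> reach (\<kappa> 0) S u v" "2 * card S \<le> pot0"
                  "\<tau>7 \<le> \<tau>6 + 1000 * n * (h + 1) * d * pot0 + 2"
                have \<kappa>0: "\<kappa> 0 = L" by (simp add: \<kappa>_def fun_eq_iff)
                show "wp V emit ?R r7 m7 \<tau>7"
                proof (rule wp_emit[OF 7(1) 7(4)[unfolded \<kappa>0] 7(3) V2(2)])
                  show "2 \<le> \<beta>" using b by linarith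
                  fix r8 m8 \<tau>8
                  assume 8: "output_triples m8 = {(u, v, L u v) | u v. v < u \<and> u < n \<and> adj S u v}"
                    "\<tau>8 \<le> \<tau>7 + 120 * (n * n) + 30"
                  have "\<tau>8 \<le> 1000 * n * (h + 1) * d * pot0 + 80 * n + 300 * (n * n) + 222"
                    using 8(2) 7(7) 6(5) 5(4) 4(4) 3(3) 2(3) 1(9) by linarith
                  moreover have "80 * n \<le> 80 * (n * n)" "222 \<le> 222 * (n * n)" using n by simp_all
                  ultimately have "\<tau>8 \<le> runtime n"
                    unfolding runtime_def h_def d_def pot0_def by linarith
                  then show "?R r8 m8 \<tau>8"
                    by (intro exI[of _ L] exI[of _ S] conjI allI impI)
                      (simp_all only: 7(2,6) 7(5)[unfolded \<kappa>0] 8(1) Lsym Llab not_False_eq_True)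
                qed
              qed
            qed
          qed
        qed
      qed
    qed
  qed (use m0 V1 V2 in \<open>auto simp: \<beta>_def\<close>)
  then show ?thesis unfolding V_def pot0_def .
qed

lemma spanner_from_marks:
  assumes G: "temporal_clique G" "card (verts G) = n" "2 \<le> n" and S: "S \<subseteq> verts G \<times> verts G"
    and L: "\<And>x y. x \<in> verts G \<Longrightarrow> y \<in> verts G \<Longrightarrow> x \<noteq> y \<Longrightarrow> L x y \<in> labels G {x, y}"
    and sym: "sym_on (verts G) L" and r: "\<And>u v. u \<in> verts G \<Longrightarrow> v \<in> verts G \<Longrightarrow> reach L S u v"
    and c: "2 * card S \<le> pot (dpar n) n n"
  shows "temporal_spanner 3 G (mark_graph (verts G) L S)"
    "ereal_of_enat (tsize (mark_graph (verts G) L S)) \<le> ereal (real n powr (1 + 2 / sqrt (ln (real n))))"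
proof -
  let ?H = "mark_graph (verts G) L S"
  note sp = mark_graph_spanner[OF G(1) S L sym r, simplified]
  show "temporal_spanner 3 G ?H" using sp(1) .
  obtain k where k: "tsize ?H = enat k" using sp(2) by (cases "tsize ?H") auto
  have "k \<le> card S" "k \<le> n choose 2" using sp(2,3) k G(2) by simp_all
  then have "real k \<le> real n powr (1 + 2 / sqrt (ln (real n)))"
    using c by (intro spanner_size_bound[OF G(3)]) linarith+
  then show "ereal_of_enat (tsize ?H) \<le> ereal (real n powr (1 + 2 / sqrt (ln (real n))))"
    unfolding k by simp
qed

lemma spanner_exists:
  assumes G: "temporal_clique G" "card (verts G) = n" "2 \<le> n"
  shows "\<exists>H. temporal_spanner 3 G H \<and>
    ereal_of_enat (tsize H) \<le> ereal (real n powr (1 + 2 / sqrt (ln (real n))))"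
proof -
  \<comment> \<open>The choice depends on the unordered pair only and is therefore
    symmetric.\<close>
  define L where "L x y = (SOME l. l \<in> labels G {x, y})" for x y
  have L: "L x y \<in> labels G {x, y}" if "x \<in> verts G" "y \<in> verts G" "x \<noteq> y" for x y
  proof -
    have "{x, y} \<in> edges G" using G that by (auto simp: temporal_clique_def nsets_def)
    then have "labels G {x, y} \<noteq> {}" using G(1) unfolding temporal_clique_def temporal_graph_def by blast
    then show ?thesis unfolding L_def by (simp add: some_in_eq)
  qed
  have sym: "sym_on (verts G) L" by (simp add: sym_on_def L_def insert_commute)
  have fin: "finite (verts G)" "verts G \<noteq> {}"
    using G by (auto simp: temporal_clique_def temporal_graph_def)
  have "\<exists>S\<subseteq>verts G \<times> verts G. 2 * card S \<le> pot (dpar n) (card (verts G)) (card (verts G)) \<and>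
      (\<forall>u\<in>verts G. \<forall>v\<in>verts G. reach (\<lambda>x y. int (L x y)) S u v)"
    by (rule exists_marks[OF dpar_props(1) fin(1) order_refl order_refl fin(2) fin(2)])
      (use sym in \<open>simp add: sym_on_def\<close>)
  then obtain S where S: "S \<subseteq> verts G \<times> verts G" "2 * card S \<le> pot (dpar n) n n"
      "\<And>u v. u \<in> verts G \<Longrightarrow> v \<in> verts G \<Longrightarrow> reach (\<lambda>x y. int (L x y)) S u v"
    using G(2) by auto
  have "reach L S u v" if "u \<in> verts G" "v \<in> verts G" for u v
    using S(3)[OF that] by (simp add: reach_def)
  then show ?thesis using spanner_from_marks[OF G S(1) L sym _ S(2)] by blast
qed

lemma program_correct:
  assumes n: "2 \<le> n" and G: "temporal_clique G" "card (verts G) = n" and enc: "encodes m G"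
    and N: "\<And>a. m a \<le> N"
  shows "\<exists>t r m'. run (N ^ 128) program (\<lambda>_. 0, m) t (r, m') \<and> t \<le> runtime n \<and>
    temporal_spanner 3 G (output_graph n m') \<and>
    ereal_of_enat (tsize (output_graph n m')) \<le> ereal (real n powr (1 + 2 / sqrt (ln (real n))))"
proof -
  have vG: "verts G = {..<n}" using enc G(2) by (simp add: encodes_def)
  have "2 + 2 * n\<^sup>2 \<le> m 1" using enc vG by (auto simp: encodes_def)
  moreover have "2\<^sup>2 \<le> n\<^sup>2" using n by (intro power_mono) auto
  ultimately have N8: "8 \<le> N" using N[of 1] by simp
  have NV: "N ^ 1 \<le> N ^ 4" using N8 by (intro power_increasing) auto
  have b: "bnd (N ^ 4) (\<lambda>_. 0) m"
    unfolding bnd_def using N8 NV N by (auto intro: order_trans)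
  from wp_program[OF n G enc N, unfolded wp_def, THEN mp, OF b]
  obtain t r m' L S where run: "run ((N ^ 4) ^ 32) program (\<lambda>_. 0, m) t (r, m')"
    and S: "S \<subseteq> {..<n} \<times> {..<n}" "sym_on {..<n} L"
      "\<forall>u<n. \<forall>v<n. u \<noteq> v \<longrightarrow> L u v \<in> labels G {u, v}"
      "\<forall>u<n. \<forall>v<n. reach L S u v" "2 * card S \<le> pot (dpar n) n n"
      "output_triples m' = {(u, v, L u v) | u v. v < u \<and> u < n \<and> adj S u v}" "0 + t \<le> runtime n"
    by (elim exE conjE) (rule that; assumption)
  have o: "output_graph n m' = mark_graph (verts G) L S"
    unfolding vG by (rule output_graph_eq[OF S(6,1,2)])
  have h: "S \<subseteq> verts G \<times> verts G" "sym_on (verts G) L" using S(1,2) by (simp_all only: vG)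
  have L: "L x y \<in> labels G {x, y}" if "x \<in> verts G" "y \<in> verts G" "x \<noteq> y" for x y
    using that S(3) unfolding vG by simp
  have reach: "reach L S u v" if "u \<in> verts G" "v \<in> verts G" for u v
    using that S(4) unfolding vG by simp
  note sp = spanner_from_marks[OF G n h(1) _ h(2) _ S(5)]
  show ?thesis
  proof (rule exI[of _ t], rule exI[of _ r], rule exI[of _ m'], intro conjI)
    show "run (N ^ 128) program (\<lambda>_. 0, m) t (r, m')" using run by (simp flip: power_mult)
    show "t \<le> runtime n" using S(7) by simp
    show "temporal_spanner 3 G (output_graph n m')" unfolding o by (rule sp(1)) (simp_all add: L reach)
    show "ereal_of_enat (tsize (output_graph n m')) \<le> ereal (real n powr (1 + 2 / sqrt (ln (real n))))"
      unfolding o by (rule sp(2)) (simp_all add: L reach)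
  qed
qed

theorem theorem1:
  shows "(\<forall>n\<ge>2. \<forall>G :: 'a tgraph. temporal_clique G \<and> card (verts G) = n \<longrightarrow>
            (\<exists>H. temporal_spanner 3 G H \<and>
                 ereal_of_enat (tsize H) \<le> ereal (real n powr (1 + 2 / sqrt (ln (real n))))))
       \<and> (\<lambda>n::nat. 2 / sqrt (ln (real n))) \<longlonglongrightarrow> 0
       \<and> (\<exists>(P :: com) (c :: nat) (T :: nat \<Rightarrow> nat) (\<epsilon> :: nat \<Rightarrow> real).
            \<epsilon> \<longlonglongrightarrow> 0 \<and>
            (\<lambda>n. real (T n)) \<in> O(\<lambda>n. real n powr (2 + \<epsilon> n)) \<and>
            (\<forall>n\<ge>2. \<forall>(G :: nat tgraph) (m :: nat \<Rightarrow> nat) (N :: nat).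
               temporal_clique G \<and> card (verts G) = n \<and> encodes m G \<and> (\<forall>a. m a \<le> N) \<longrightarrow>
               (\<exists>t r m'. run (N ^ c) P (\<lambda>_. 0, m) t (r, m') \<and> t \<le> T n \<and>
                  temporal_spanner 3 G (output_graph n m') \<and>
                  ereal_of_enat (tsize (output_graph n m'))
                    \<le> ereal (real n powr (1 + 2 / sqrt (ln (real n)))))))"
proof (intro conjI allI impI)
  fix n :: nat and G :: "'a tgraph"
  assume "2 \<le> n" "temporal_clique G \<and> card (verts G) = n"
  then show "\<exists>H. temporal_spanner 3 G H \<and>
      ereal_of_enat (tsize H) \<le> ereal (real n powr (1 + 2 / sqrt (ln (real n))))"
    using spanner_exists by blast
next
  show "(\<lambda>n::nat. 2 / sqrt (ln (real n))) \<longlonglongrightarrow> 0" by real_asymp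
next
  obtain \<epsilon> :: "nat \<Rightarrow> real" where \<epsilon>: "\<epsilon> \<longlonglongrightarrow> 0"
    "(\<lambda>n. real (runtime n)) \<in> O(\<lambda>n. real n powr (2 + \<epsilon> n))"
    using time_bound_asymptotics[of runtime 5 17] runtime_le by blast
  show "\<exists>(P :: com) (c :: nat) (T :: nat \<Rightarrow> nat) (\<epsilon> :: nat \<Rightarrow> real).
      \<epsilon> \<longlonglongrightarrow> 0 \<and>
      (\<lambda>n. real (T n)) \<in> O(\<lambda>n. real n powr (2 + \<epsilon> n)) \<and>
      (\<forall>n\<ge>2. \<forall>(G :: nat tgraph) (m :: nat \<Rightarrow> nat) (N :: nat).
         temporal_clique G \<and> card (verts G) = n \<and> encodes m G \<and> (\<forall>a. m a \<le> N) \<longrightarrow>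
         (\<exists>t r m'. run (N ^ c) P (\<lambda>_. 0, m) t (r, m') \<and> t \<le> T n \<and>
            temporal_spanner 3 G (output_graph n m') \<and>
            ereal_of_enat (tsize (output_graph n m'))
              \<le> ereal (real n powr (1 + 2 / sqrt (ln (real n))))))"
    \<comment> \<open>The exponent is \<open>128 = 4 * 32\<close>: registers and cells stay within
      \<open>N ^ 4\<close>, and intermediate values within its 32nd power.\<close>
    by (rule exI[of _ program], rule exI[of _ 128], rule exI[of _ runtime], rule exI[of _ \<epsilon>])
      (use \<epsilon> program_correct in blast)
qed

end
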